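(* Let $n\in\mathbb{N}$, $j\in\{1,\ldots,n\}$, and $\boldsymbol{A}:=(A_1,\ldots,A_n)$, where for each $k\in\{1,\ldots,n\}$ the matrix $A_k:=\begin{bmatrix}a_k&b_k\\c_k&d_k\end{bmatrix}$ is a real $2\times2$ matrix with determinant $1$ such that $b_k\neq0$ and $a_k=d_k$. For any given $p\in(1,\infty)$, the linear canonical Riesz transform $R_j^{\boldsymbol{A}}$, initially defined on $\mathscr{S}(\mathbb{R}^n)$, can be extended to a bounded linear operator on $L^p(\mathbb{R}^n)$ and, moreover, there exists a positive constant $C$ such that, for any $f\in L^p(\mathbb{R}^n)$, $$\left\|R_j^{\boldsymbol{A}}(f)\right\|_{L^p(\mathbb{R}^n)}\leq C\,\|f\|_{L^p(\mathbb{R}^n)}.$$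
   Context: $\mathscr{S}(\mathbb{R}^n)$ is the space of (complex-valued) Schwartz functions on $\mathbb{R}^n$. Linear canonical Riesz transform (LCRT). For $\boldsymbol{A}=(A_1,\ldots,A_n)$ with $A_k=\begin{bmatrix}a_k&b_k\\c_k&d_k\end{bmatrix}$ real of determinant $1$ and all $b_k\neq0$, $j\in\{1,\ldots,n\}$, $f\in\mathscr{S}(\mathbb{R}^n)$ and $\boldsymbol{x}\in\mathbb{R}^n$, $$R_j^{\boldsymbol{A}}(f)(\boldsymbol{x}):=\widetilde{c}_n\,e^{-i\sum_{k=1}^n\frac{d_k}{2b_k}x_k^2}\ \mathrm{p.v.}\int_{\mathbb{R}^n}\frac{(x_j-y_j)\,f(\boldsymbol{y})\,e^{i\sum_{k=1}^n\frac{a_k}{2b_k}y_k^2}}{|\boldsymbol{x}-\boldsymbol{y}|^{n+1}}\,d\boldsymbol{y},\qquad \widetilde{c}_n:=\frac{\Gamma(\frac{n+1}{2})}{\pi^{\frac{n+1}{2}}},$$ where $\mathrm{p.v.}\int$ denotes $\lim_{\varepsilon\to0^+}\int_{|\boldsymbol{x}-\boldsymbol{y}|\geq\varepsilon}$. The constant $C$ is independent of $f$. *)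

theory Defs
  imports "HOL-Analysis.Analysis"
begin

section \<open>Schwartz functions\<close>

definition partial_deriv :: "'n \<Rightarrow> (real ^ 'n \<Rightarrow> complex) \<Rightarrow> real ^ 'n \<Rightarrow> complex" where
  "partial_deriv i f x = frechet_derivative f (at x) (axis i 1)"

text \<open>A mixed partial derivative is given by the list of the directions of differentiation; the
  multi-index \<open>\<beta>\<close> corresponds to any list in which each direction \<open>i\<close> occurs \<open>\<beta> i\<close> times.\<close>

definition partial_derivs :: "'n list \<Rightarrow> (real ^ 'n \<Rightarrow> complex) \<Rightarrow> real ^ 'n \<Rightarrow> complex" where
  "partial_derivs is f = foldr partial_deriv is f"

text \<open>The first conjunct says that \<open>f\<close> is infinitely differentiable. It is also what makes
  the values of \<^const>\<open>frechet_derivative\<close> (a choice operator) meaningful.\<close>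

definition schwartz :: "(real ^ 'n \<Rightarrow> complex) set" where
  "schwartz = {f.
     (\<forall>is x. partial_derivs is f differentiable (at x)) \<and>
     (\<forall>(\<alpha> :: 'n \<Rightarrow> nat) is.
        bounded (range (\<lambda>x. (\<Prod>k\<in>UNIV. (x $ k) ^ \<alpha> k) *\<^sub>R partial_derivs is f x)))}"

section \<open>Lebesgue spaces\<close>

text \<open>Elements of \<open>L\<^sup>p\<close> are represented by measurable functions; identification of functions that
  agree almost everywhere is built into the notion of an operator on \<open>L\<^sup>p\<close> below.\<close>

definition Lp_space :: "real \<Rightarrow> ('a::euclidean_space \<Rightarrow> complex) set" where
  "Lp_space p = {f \<in> borel_measurable lebesgue. integrable lebesgue (\<lambda>x. norm (f x) powr p)}"

definition Lp_norm :: "real \<Rightarrow> ('a::euclidean_space \<Rightarrow> complex) \<Rightarrow> real" where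
  "Lp_norm p f = (\<integral>x. norm (f x) powr p \<partial>lebesgue) powr (1 / p)"

text \<open>The second conjunct says that \<open>T\<close> descends to almost-everywhere classes.\<close>

definition bounded_linear_on_Lp ::
    "real \<Rightarrow> (('a::euclidean_space \<Rightarrow> complex) \<Rightarrow> ('a \<Rightarrow> complex)) \<Rightarrow> bool" where
  "bounded_linear_on_Lp p T \<longleftrightarrow>
     (\<forall>f\<in>Lp_space p. T f \<in> Lp_space p) \<and>
     (\<forall>f\<in>Lp_space p. \<forall>g\<in>Lp_space p.
        (AE x in lebesgue. f x = g x) \<longrightarrow> (AE x in lebesgue. T f x = T g x)) \<and>
     (\<forall>f\<in>Lp_space p. \<forall>g\<in>Lp_space p.
        AE x in lebesgue. T (\<lambda>y. f y + g y) x = T f x + T g x) \<and>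
     (\<forall>c. \<forall>f\<in>Lp_space p. AE x in lebesgue. T (\<lambda>y. c * f y) x = c * T f x) \<and>
     (\<exists>C. \<forall>f\<in>Lp_space p. Lp_norm p (T f) \<le> C * Lp_norm p f)"

section \<open>Principal value integrals\<close>

definition truncated_integral ::
    "'a::euclidean_space \<Rightarrow> ('a \<Rightarrow> complex) \<Rightarrow> real \<Rightarrow> complex" where
  "truncated_integral x h \<epsilon> = set_lebesgue_integral lebesgue {y. norm (x - y) \<ge> \<epsilon>} h"

definition pv_exists :: "'a::euclidean_space \<Rightarrow> ('a \<Rightarrow> complex) \<Rightarrow> bool" where
  "pv_exists x h \<longleftrightarrow>
     (\<forall>\<epsilon>>0. set_integrable lebesgue {y. norm (x - y) \<ge> \<epsilon>} h) \<and>
     (\<exists>l. (truncated_integral x h \<longlongrightarrow> l) (at_right 0))"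

text \<open>The value is meaningful only if \<^const>\<open>pv_exists\<close> holds.\<close>

definition pv_integral :: "'a::euclidean_space \<Rightarrow> ('a \<Rightarrow> complex) \<Rightarrow> complex" where
  "pv_integral x h = Lim (at_right 0) (truncated_integral x h)"

section \<open>The linear canonical Riesz transform\<close>

text \<open>The entries of the \<open>k\<close>-th matrix are \<open>a\<^sub>k = A $ k $ 1 $ 1\<close>, \<open>b\<^sub>k = A $ k $ 1 $ 2\<close>,
  \<open>c\<^sub>k = A $ k $ 2 $ 1\<close> and \<open>d\<^sub>k = A $ k $ 2 $ 2\<close>.\<close>

definition riesz_const :: "nat \<Rightarrow> real" where
  "riesz_const n = Gamma ((real n + 1) / 2) / pi powr ((real n + 1) / 2)"

definition LCRT_integrand ::
    "real ^ 2 ^ 2 ^ 'n \<Rightarrow> 'n \<Rightarrow> (real ^ 'n \<Rightarrow> complex) \<Rightarrow> real ^ 'n \<Rightarrow> real ^ 'n \<Rightarrow> complex" where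
  "LCRT_integrand A j f x y =
     of_real (x $ j - y $ j) * f y
       * exp (\<i> * of_real (\<Sum>k\<in>UNIV. A $ k $ 1 $ 1 / (2 * A $ k $ 1 $ 2) * (y $ k)\<^sup>2))
       / of_real (norm (x - y) ^ (CARD('n) + 1))"

definition LCRT ::
    "real ^ 2 ^ 2 ^ 'n \<Rightarrow> 'n \<Rightarrow> (real ^ 'n \<Rightarrow> complex) \<Rightarrow> real ^ 'n \<Rightarrow> complex" where
  "LCRT A j f x =
     of_real (riesz_const CARD('n))
       * exp (- \<i> * of_real (\<Sum>k\<in>UNIV. A $ k $ 2 $ 2 / (2 * A $ k $ 1 $ 2) * (x $ k)\<^sup>2))
       * pv_integral x (LCRT_integrand A j f x)"

end

theory Submission
  imports Defs "HOL-Complex_Analysis.Complex_Analysis"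
begin

text \<open>
  The phase factors in the linear canonical Riesz transform have modulus one. Hence multiplication
  by them preserves every \<open>L\<^sup>p\<close> norm, and the transform of \<open>f\<close> is a constant times a phase times the
  classical Riesz transform of \<open>f\<close> times a phase (\<open>LCRT_integrand_eq_riesz_kernel\<close>). What has to be
  proved is therefore the theorem of M. Riesz in \<open>n\<close> dimensions. The proof is the method of
  rotations, arranged so that it needs neither polar coordinates nor interpolation.

  \<^emph>\<open>One dimension.\<close> For nonzero \<open>f \<ge> 0\<close> the Cauchy integral \<open>F = u + \<i>v\<close> of \<open>f\<close> is holomorphic on the upper
  half plane; up to the factor \<open>\<pi>\<close>, \<open>u > 0\<close> is the Poisson integral of \<open>f\<close> and \<open>v\<close> is the
  conjugate Poisson integral.
  Since \<open>F\<^sup>p\<close> decays like \<open>\<bar>z\<bar>\<close> to the power \<open>-p\<close>, its integral over a horizontal line is zero. For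
  \<open>1 < p < 3\<close> there are constants with \<open>\<bar>F\<bar>\<^sup>p \<le> a u\<^sup>p - b Re F\<^sup>p\<close>
  (\<open>norm_powr_le_Re_powr_complex\<close>), so that integration bounds \<open>F\<close> in \<open>L\<^sup>p\<close> by \<open>u\<close>, and \<open>u\<close> is bounded
  by \<open>f\<close> because it is, up to that factor, an average of translates of \<open>f\<close>. The truncated kernel \<open>1/t\<close> differs from
  a difference of two conjugate Poisson kernels by at most a sum of two Poisson kernels, so the
  same bound holds for truncated Hilbert transforms, uniformly in the truncation. Duality gives
  \<open>p \<ge> 3\<close> (\<open>trunc_hilbert_Lp\<close>).

  \<^emph>\<open>From lines to space.\<close> Applying the inequality on the line to \<open>s \<mapsto> f (x + s z)\<close> and integrating
  over \<open>x\<close> bounds the truncated Hilbert transform in the direction \<open>z\<close>, with a constant that does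
  not depend on \<open>z\<close> (\<open>dir_hilbert_Lp\<close>). Its average over \<open>z\<close> in the unit ball, with the weight
  \<open>z \<bullet> e\<close>, is convolution with a regularized Riesz kernel: substitute \<open>y = t z\<close> and compute
  an integral of a power of \<open>t\<close> (\<open>average_dir_hilbert\<close>). Jensen's inequality then gives an
  \<open>L\<^sup>p\<close> bound that is uniform in the regularization (\<open>weighted_riesz_Lp\<close>).

  \<^emph>\<open>Limits.\<close> For a bounded integrable Lipschitz function every regularization by even weights that
  tend to one has the same limit (\<open>riesz_weighted_limit\<close>). With sharp truncations this shows that
  the principal value exists (\<open>riesz_pv\<close>); with the regularized kernels above and Fatou's lemma it
  gives the \<open>L\<^sup>p\<close> bound (\<open>riesz_Lp\<close>). Such functions are dense in \<open>L\<^sup>p\<close>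
  (\<open>Lp_space_approximable\<close>), the product of a Schwartz function and a chirp is one of them
  (\<open>schwartz_chirp_tame\<close>), and an operator bounded on a dense subspace extends
  (\<open>bounded_extension\<close>).
\<close>

section \<open>Inequalities for powers\<close>

lemma powr_add_le:
  fixes a b p :: real
  assumes "0 \<le> a" "0 \<le> b" "0 \<le> p"
  shows "(a + b) powr p \<le> 2 powr p * (a powr p + b powr p)"
proof -
  have "(a + b) powr p \<le> (2 * max a b) powr p"
    using assms by (intro powr_mono2) auto
  also have "\<dots> = 2 powr p * max a b powr p" using assms by (simp add: powr_mult)
  also have "max a b powr p \<le> a powr p + b powr p" by (auto simp: max_def)
  finally show ?thesis by (simp add: mult_left_mono)
qed

lemma mult_le_powr_add_conjugate:
  fixes a b p q :: real
  assumes "0 \<le> a" "0 \<le> b" "1 < p" "q = p / (p - 1)"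
  shows "a * b \<le> a powr p + b powr q"
proof -
  have q: "1 < q" "1/p + 1/q = 1" using assms(3) unfolding assms(4) by (auto simp: field_simps)
  have "a * b \<le> a powr p / p + b powr q / q"
    using Youngs_inequality[of p q a b] q assms by simp
  also have "\<dots> \<le> a powr p + b powr q"
    using q(1) assms(3)
    by (intro add_mono) (simp_all add: divide_le_eq mult_le_cancel_left1)
  finally show ?thesis .
qed

text \<open>Young's inequality says that the graph of \<open>a \<mapsto> a\<^sup>p\<close> lies above its tangent at \<open>m\<close>.\<close>

lemma powr_ge_tangent:
  fixes a m p :: real
  assumes "0 \<le> a" "0 < m" "1 < p"
  shows "p * m powr (p - 1) * a \<le> a powr p + (p - 1) * m powr p"
proof -
  define q where "q = p / (p - 1)"
  have q: "1 < q" "1/p + 1/q = 1" using assms by (auto simp: q_def field_simps)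
  have "a * m powr (p - 1) \<le> a powr p / p + (m powr (p - 1)) powr q / q"
    using Youngs_inequality[of p q a "m powr (p - 1)"] q assms by simp
  also have "(m powr (p - 1)) powr q = m powr p"
    using assms by (simp add: powr_powr q_def)
  finally have "p * (a * m powr (p - 1)) \<le> p * (a powr p / p + m powr p / q)"
    using assms by (intro mult_left_mono) auto
  also have "p * (a powr p / p + m powr p / q) = a powr p + (p - 1) * m powr p"
    using assms by (simp add: q_def field_simps)
  finally show ?thesis by (simp add: mult_ac)
qed

text \<open>Integrate the tangent inequality at the mean value \<open>m = I / W\<close>. The measure is only assumed to
  have mass at most \<open>W\<close>, so that it can be a Poisson kernel or Lebesgue measure on a ball. If \<open>g\<close> is
  not integrable, its Bochner integral is zero and there is nothing to prove.\<close>

lemma jensen_powr_norm: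
  fixes g :: "'a \<Rightarrow> 'b::{banach,second_countable_topology}"
  assumes [measurable]: "g \<in> borel_measurable M"
    and W: "0 < W" "emeasure M (space M) \<le> ennreal W" and p: "1 < p"
  shows "ennreal (norm (integral\<^sup>L M g) powr p)
    \<le> ennreal (W powr (p - 1)) * (\<integral>\<^sup>+x. ennreal (norm (g x) powr p) \<partial>M)"
proof (cases "integrable M g \<and> integral\<^sup>L M (\<lambda>x. norm (g x)) > 0")
  case False
  then have "norm (integral\<^sup>L M g) \<le> 0"
  proof (cases "integrable M g")
    case True
    then show ?thesis using False integral_norm_bound[of M g] by linarith
  qed (simp add: not_integrable_integral_eq)
  then show ?thesis using p by simp
next
  case True
  define I where "I = integral\<^sup>L M (\<lambda>x. norm (g x))"
  define m where "m = I / W"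
  have I: "I > 0" "m > 0" and intg: "integrable M g" using True W by (auto simp: I_def m_def)
  have nnI: "(\<integral>\<^sup>+x. ennreal (norm (g x)) \<partial>M) = ennreal I"
    unfolding I_def using intg by (intro nn_integral_eq_integral) auto
  define J where "J = (\<integral>\<^sup>+x. ennreal (norm (g x) powr p) \<partial>M)"
  have "ennreal (p * m powr (p - 1)) * ennreal I
      = (\<integral>\<^sup>+x. ennreal (p * m powr (p - 1) * norm (g x)) \<partial>M)"
    using p by (simp add: nnI[symmetric] nn_integral_cmult ennreal_mult)
  also have "\<dots> \<le> (\<integral>\<^sup>+x. ennreal (norm (g x) powr p) + ennreal ((p - 1) * m powr p) \<partial>M)"
    using p I by (intro nn_integral_mono)
      (simp add: ennreal_plus[symmetric] powr_ge_tangent del: ennreal_plus)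
  also have "\<dots> = J + ennreal ((p - 1) * m powr p) * emeasure M (space M)"
    by (subst nn_integral_add) (auto simp: J_def)
  also have "\<dots> \<le> J + ennreal ((p - 1) * m powr p) * ennreal W"
    using W by (intro add_left_mono mult_left_mono) auto
  finally have *: "ennreal (p * m powr (p - 1)) * ennreal I \<le> J + ennreal ((p - 1) * m powr p) * ennreal W" .
  have mp: "m powr (p - 1) * I = m powr p * W"
    using I W p by (simp add: powr_diff m_def)
  have J: "ennreal (m powr p * W) \<le> J"
  proof (cases "J = \<infinity>")
    case False
    then obtain r where r: "J = ennreal r" "r \<ge> 0" by (cases J) auto
    have "ennreal (p * (m powr (p - 1) * I)) \<le> ennreal (r + (p - 1) * m powr p * W)"
      using * r p I W by (simp add: ennreal_mult[symmetric] ennreal_plus[symmetric] mult.assoc del: ennreal_plus)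
    then have "p * (m powr (p - 1) * I) \<le> r + (p - 1) * m powr p * W"
      using r p W by (subst (asm) ennreal_le_iff) auto
    then show ?thesis using r unfolding mp by (simp add: ennreal_leI algebra_simps)
  qed simp
  have "norm (integral\<^sup>L M g) powr p \<le> I powr p"
    unfolding I_def using p by (intro powr_mono2 integral_norm_bound) auto
  also have "I powr p = W powr (p - 1) * (m powr p * W)"
    using W I by (simp add: m_def powr_divide powr_diff)
  finally have "ennreal (norm (integral\<^sup>L M g) powr p) \<le> ennreal (W powr (p - 1)) * ennreal (m powr p * W)"
    using W by (simp add: ennreal_mult[symmetric] ennreal_leI)
  also have "\<dots> \<le> ennreal (W powr (p - 1)) * J" by (intro mult_left_mono J) auto
  finally show ?thesis by (simp add: J_def)
qed

section \<open>Powers of the \<open>L\<^sup>p\<close> norm\<close>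

text \<open>The \<open>p\<close>-th power of the \<open>L\<^sup>p\<close> norm, as an extended number, so that Tonelli's theorem and Fatou's
  lemma apply to it directly. Constants depending on \<open>p\<close> are harmless below, which is why the
  crude factor \<open>2\<^sup>p\<close> can replace Minkowski's inequality.\<close>

definition Lp_mass :: "'a measure \<Rightarrow> real \<Rightarrow> ('a \<Rightarrow> 'b::real_normed_vector) \<Rightarrow> ennreal" where
  "Lp_mass M p f = (\<integral>\<^sup>+x. ennreal (norm (f x) powr p) \<partial>M)"

lemma Lp_mass_mono:
  assumes "\<And>x. norm (f x) \<le> norm (g x)" "0 \<le> p"
  shows "Lp_mass M p f \<le> Lp_mass M p g"
  unfolding Lp_mass_def using assms by (intro nn_integral_mono ennreal_leI powr_mono2) auto

lemma Lp_mass_norm_add_le: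
  fixes f :: "'a \<Rightarrow> 'b::{banach,second_countable_topology}" and g :: "'a \<Rightarrow> 'c::{banach,second_countable_topology}"
    and h :: "'a \<Rightarrow> 'd::real_normed_vector"
  assumes [measurable]: "f \<in> borel_measurable M" "g \<in> borel_measurable M" and p: "0 \<le> p"
    and le: "\<And>x. norm (h x) \<le> norm (f x) + norm (g x)"
  shows "Lp_mass M p h \<le> ennreal (2 powr p) * (Lp_mass M p f + Lp_mass M p g)"
proof -
  have "Lp_mass M p h
     \<le> (\<integral>\<^sup>+x. ennreal (2 powr p) * (ennreal (norm (f x) powr p) + ennreal (norm (g x) powr p)) \<partial>M)"
    unfolding Lp_mass_def
  proof (intro nn_integral_mono)
    fix x
    have "norm (h x) powr p \<le> (norm (f x) + norm (g x)) powr p"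
      using p le by (intro powr_mono2) auto
    also have "\<dots> \<le> 2 powr p * (norm (f x) powr p + norm (g x) powr p)"
      using p by (intro powr_add_le) auto
    finally show "ennreal (norm (h x) powr p)
       \<le> ennreal (2 powr p) * (ennreal (norm (f x) powr p) + ennreal (norm (g x) powr p))"
      by (simp add: ennreal_plus[symmetric] ennreal_mult[symmetric] ennreal_leI del: ennreal_plus)
  qed
  also have "\<dots> = ennreal (2 powr p) * (Lp_mass M p f + Lp_mass M p g)"
    by (simp add: nn_integral_cmult nn_integral_add Lp_mass_def)
  finally show ?thesis .
qed

lemma Lp_mass_scale:
  fixes f :: "'a \<Rightarrow> 'b::{banach,second_countable_topology}"
  assumes [measurable]: "f \<in> borel_measurable M" and "\<And>x. norm (g x) = c * norm (f x)" "0 \<le> c"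
  shows "Lp_mass M p g = ennreal (c powr p) * Lp_mass M p f"
  unfolding Lp_mass_def using assms(2,3)
  by (simp add: powr_mult ennreal_mult nn_integral_cmult)

lemma Lp_mass_lebesgue_eq_lborel:
  "f \<in> borel_measurable borel \<Longrightarrow> Lp_mass lebesgue p f = Lp_mass lborel p f"
  by (simp add: Lp_mass_def nn_integral_completion)

text \<open>Fatou's lemma; the bounds may vary along the sequence as long as they converge.\<close>

lemma Lp_mass_le_of_AE_limit:
  fixes u :: "nat \<Rightarrow> 'a \<Rightarrow> 'b::{banach,second_countable_topology}"
  assumes [measurable]: "\<And>k. u k \<in> borel_measurable M" and p: "0 < p"
    and lim: "AE x in M. (\<lambda>k. u k x) \<longlonglongrightarrow> v x"
    and b: "\<And>k. Lp_mass M p (u k) \<le> b k" "b \<longlonglongrightarrow> c"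
  shows "Lp_mass M p v \<le> c"
proof -
  have "Lp_mass M p v = (\<integral>\<^sup>+x. liminf (\<lambda>k. ennreal (norm (u k x) powr p)) \<partial>M)"
    unfolding Lp_mass_def
  proof (rule nn_integral_cong_AE)
    show "AE x in M. ennreal (norm (v x) powr p) = liminf (\<lambda>k. ennreal (norm (u k x) powr p))"
      using lim
    proof eventually_elim
      case (elim x)
      have "(\<lambda>k. ennreal (norm (u k x) powr p)) \<longlonglongrightarrow> ennreal (norm (v x) powr p)"
        using p by (intro tendsto_ennrealI tendsto_powr2 tendsto_norm elim tendsto_const) auto
      then show ?case by (rule lim_imp_Liminf[symmetric, rotated]) simp
    qed
  qed
  also have "\<dots> \<le> liminf (\<lambda>k. Lp_mass M p (u k))"
    unfolding Lp_mass_def by (rule nn_integral_liminf) measurable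
  also have "\<dots> \<le> liminf b" by (intro Liminf_mono always_eventually allI b(1))
  also have "liminf b = c" by (rule lim_imp_Liminf[OF _ b(2)]) simp
  finally show ?thesis .
qed

section \<open>Holomorphic functions of positive real part on a half plane\<close>

text \<open>By homogeneity this is an inequality for \<open>z = exp (\<i> \<theta>)\<close> with \<open>\<bar>\<theta>\<bar> < \<pi>/2\<close>, namely
  \<open>1 \<le> a cos\<^sup>p \<theta> - b cos (p \<theta>)\<close>. Near the ends of the interval the first term is useless, but there
  \<open>cos (p \<theta>)\<close> is close to \<open>cos (p \<pi>/2)\<close>, which is negative exactly because \<open>p\<close> lies between 1 and 3;
  away from the ends \<open>cos \<theta>\<close> is bounded below and a large \<open>a\<close> suffices.\<close>

lemma norm_powr_le_Re_powr_complex: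
  fixes p :: real
  assumes p: "1 < p" "p < 3"
  obtains a b where "0 \<le> a" "0 \<le> b"
    "\<And>z::complex. Re z > 0 \<Longrightarrow> norm z powr p \<le> a * Re z powr p - b * Re (z powr of_real p)"
proof -
  have neg: "cos (p * (pi/2)) < 0"
  proof -
    have "cos (p * (pi/2)) = - cos (p * (pi/2) - pi)" by (simp add: cos_diff)
    moreover have "cos (p * (pi/2) - pi) > 0"
      using p pi_gt_zero by (intro cos_gt_zero_pi) (auto simp: field_simps)
    ultimately show ?thesis by simp
  qed
  define c where "c = - cos (p * (pi/2)) / 2"
  have c: "c > 0" using neg by (simp add: c_def)
  have "isCont (\<lambda>\<theta>. cos (p * \<theta>)) (pi/2)" by (intro continuous_intros)
  then obtain d where d: "d > 0" "\<And>\<theta>. \<bar>\<theta> - pi/2\<bar> < d \<Longrightarrow> \<bar>cos (p * \<theta>) - cos (p * (pi/2))\<bar> < c"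
    using c unfolding continuous_at_eps_delta dist_real_def by blast
  \<comment> \<open>for angles beyond \<open>t0\<close> the continuity estimate applies; up to \<open>t0\<close> the cosine is at least \<open>cos t0\<close>\<close>
  define t0 where "t0 = max 0 (pi/2 - d/2)"
  have t0: "0 \<le> t0" "t0 < pi/2" using d(1) pi_gt_zero unfolding t0_def by linarith+
  have ct0: "cos t0 > 0" using t0 by (intro cos_gt_zero_pi) auto
  define b where "b = 1 / c"
  define a where "a = (1 + b) / cos t0 powr p"
  have ab: "a \<ge> 0" "b \<ge> 0" using c by (auto simp: a_def b_def)
  have ang: "1 \<le> a * cos \<theta> powr p - b * cos (p * \<theta>)" if th: "\<bar>\<theta>\<bar> < pi/2" for \<theta>
  proof (cases "\<bar>\<theta>\<bar> \<le> t0")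
    case True
    have "cos t0 \<le> cos \<bar>\<theta>\<bar>" using True t0 by (intro cos_monotone_0_pi_le) auto
    then have "cos t0 powr p \<le> cos \<theta> powr p" using ct0 p by (intro powr_mono2) auto
    then have "a * cos t0 powr p \<le> a * cos \<theta> powr p" using ab by (intro mult_left_mono)
    moreover have "a * cos t0 powr p = 1 + b" using ct0 by (simp add: a_def)
    moreover have "b * cos (p * \<theta>) \<le> b * 1" using ab by (intro mult_left_mono) auto
    ultimately show ?thesis by linarith
  next
    case False
    then have "\<bar>\<bar>\<theta>\<bar> - pi/2\<bar> < d" using th d by (auto simp: t0_def)
    from d(2)[OF this] have "cos (p * \<bar>\<theta>\<bar>) < - c" by (simp add: c_def abs_if split: if_splits)
    moreover have "cos (p * \<bar>\<theta>\<bar>) = cos (p * \<theta>)" by (cases "\<theta> \<ge> 0") auto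
    ultimately have "b * cos (p * \<theta>) \<le> b * (- c)" using ab by (intro mult_left_mono) auto
    moreover have "b * (- c) = -1" using c by (simp add: b_def)
    moreover have "0 \<le> a * cos \<theta> powr p" using ab by simp
    ultimately show ?thesis by linarith
  qed
  have "norm z powr p \<le> a * Re z powr p - b * Re (z powr of_real p)" if z: "Re z > 0" for z
  proof -
    define r \<theta> where "r = norm z" and "\<theta> = Im (Ln z)"
    have nz: "z \<noteq> 0" using z by auto
    then have r: "r > 0" by (simp add: r_def)
    have th: "\<bar>\<theta>\<bar> < pi/2" unfolding \<theta>_def using Re_Ln_pos_lt z nz by blast
    have zr: "z = of_real r * exp (\<i> * of_real \<theta>)"
      using exp_Ln[OF nz] Re_Ln[OF nz] r
      by (metis \<theta>_def complex_eq exp_add exp_of_real exp_ln r_def)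
    have "Re z = r * cos \<theta>" by (subst zr) (simp add: Re_exp)
    then have "Re z powr p = r powr p * cos \<theta> powr p" using r z
      by (simp add: powr_mult zero_less_mult_iff)
    moreover have "Re (z powr of_real p) = r powr p * cos (p * \<theta>)"
    proof -
      have "z powr of_real p = exp (of_real p * Ln z)" using nz by (simp add: powr_def)
      moreover have "Re (Ln z) = ln r" "Im (Ln z) = \<theta>"
        using nz by (auto simp: r_def \<theta>_def)
      ultimately show ?thesis using r by (simp add: Re_exp powr_def)
    qed
    moreover have "r powr p * 1 \<le> r powr p * (a * cos \<theta> powr p - b * cos (p * \<theta>))"
      using ang[OF th] by (intro mult_left_mono) auto
    ultimately show ?thesis by (simp add: r_def algebra_simps)
  qed
  with ab show ?thesis using that by blast
qed

lemma nn_integral_le_of_symmetric_intervals: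
  fixes h :: "real \<Rightarrow> real"
  assumes [measurable]: "h \<in> borel_measurable borel"
    and e: "(e \<longlongrightarrow> 0) at_top" "\<forall>\<^sub>F R in at_top. (\<integral>\<^sup>+x\<in>{-R..R}. ennreal (h x) \<partial>lborel) \<le> A + ennreal (e R)"
  shows "(\<integral>\<^sup>+x. ennreal (h x) \<partial>lborel) \<le> A"
proof (rule ennreal_le_epsilon)
  fix d :: real assume "A < top" "0 < d"
  then have "\<forall>\<^sub>F R in at_top. e R < d" using e(1) order_tendstoD(2) by blast
  then have "\<forall>\<^sub>F R in at_top. (\<integral>\<^sup>+x\<in>{-R..R}. ennreal (h x) \<partial>lborel) \<le> A + ennreal d"
    using e(2) by eventually_elim (meson add_left_mono ennreal_leI less_imp_le order_trans)
  then obtain R0 where R0: "\<And>R. R \<ge> R0 \<Longrightarrow> (\<integral>\<^sup>+x\<in>{-R..R}. ennreal (h x) \<partial>lborel) \<le> A + ennreal d"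
    by (auto simp: eventually_at_top_linorder)
  define R where "R k = max R0 (real k)" for k
  have "(\<integral>\<^sup>+x. ennreal (h x) \<partial>lborel) = (\<integral>\<^sup>+x. (SUP k. ennreal (h x) * indicator {-R k..R k} x) \<partial>lborel)"
  proof (intro nn_integral_cong)
    fix x
    obtain k where "\<bar>x\<bar> \<le> real k" using real_arch_simple by blast
    then have "x \<in> {-R k..R k}" by (auto simp: R_def)
    then show "ennreal (h x) = (SUP k. ennreal (h x) * indicator {-R k..R k} x)"
      by (intro antisym SUP_upper2[of k] SUP_least) (auto simp: indicator_def)
  qed
  also have "\<dots> = (SUP k. \<integral>\<^sup>+x\<in>{-R k..R k}. ennreal (h x) \<partial>lborel)"
    by (intro nn_integral_monotone_convergence_SUP)
      (auto simp: incseq_def le_fun_def indicator_def R_def)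
  also have "\<dots> \<le> A + ennreal d" by (intro SUP_least R0) (auto simp: R_def)
  finally show "(\<integral>\<^sup>+x. ennreal (h x) \<partial>lborel) \<le> A + ennreal d" .
qed

text \<open>The integral of \<open>G\<^sup>p\<close> over the segment from \<open>-R\<close> to \<open>R\<close> is minus that over the half circle above
  it, and the latter is at most \<open>\<pi> R (B/R)\<^sup>p\<close>, which tends to zero because \<open>p > 1\<close>. So the term
  \<open>Re G\<^sup>p\<close> drops out of the pointwise inequality after integration.\<close>

lemma half_plane_nn_integral_norm_le_Re:
  fixes G :: "complex \<Rightarrow> complex"
  assumes y: "y > 0" and holG: "G holomorphic_on {z. Im z > - y}"
    and pos: "\<And>z. Im z > - y \<Longrightarrow> Re (G z) > 0"
    and decay: "\<And>z. Im z \<ge> 0 \<Longrightarrow> norm z \<ge> K \<Longrightarrow> norm (G z) \<le> B / norm z"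
    and p: "1 < p" and ab: "0 \<le> a" "0 \<le> b"
    and ineq: "\<And>z::complex. Re z > 0 \<Longrightarrow> norm z powr p \<le> a * Re z powr p - b * Re (z powr of_real p)"
  shows "(\<integral>\<^sup>+x. ennreal (norm (G (of_real x)) powr p) \<partial>lborel)
    \<le> ennreal a * (\<integral>\<^sup>+x. ennreal (Re (G (of_real x)) powr p) \<partial>lborel)"
proof (rule nn_integral_le_of_symmetric_intervals)
  let ?S = "{z. Im z > - y}"
  define P where "P z = G z powr of_real p" for z
  have holP: "P holomorphic_on ?S"
    unfolding P_def using pos
    by (intro holomorphic_intros holG) (auto simp: complex_nonpos_Reals_iff, force)
  have convS: "convex ?S" by (rule convex_halfspace_Im_gt)
  have contG: "continuous_on UNIV (\<lambda>x. G (of_real x))"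
    by (rule continuous_on_compose2[OF holomorphic_on_imp_continuous_on[OF holG]])
      (use y in \<open>auto intro!: continuous_intros\<close>)
  have contP: "continuous_on UNIV (\<lambda>x. P (of_real x))"
    by (rule continuous_on_compose2[OF holomorphic_on_imp_continuous_on[OF holP]])
      (use y in \<open>auto intro!: continuous_intros\<close>)
  have posx: "Re (G (of_real x)) > 0" for x using pos[of "of_real x"] y by simp
  have contN: "continuous_on UNIV (\<lambda>x. norm (G (of_real x)) powr p)"
    using posx by (intro continuous_intros contG) (auto, metis less_irrefl zero_complex.simps(1))
  have contR: "continuous_on UNIV (\<lambda>x. Re (G (of_real x)) powr p)"
    using posx by (intro continuous_intros contG) (auto, metis less_irrefl)
  show "(\<lambda>x. norm (G (of_real x)) powr p) \<in> borel_measurable borel"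
    using contN borel_measurable_continuous_onI by blast
  define e where "e R = b * ((B / R) powr p * R * pi)" for R
  have "(e \<longlongrightarrow> b * (B powr p * 0 * pi)) at_top"
  proof -
    have "((\<lambda>R. b * (B powr p * R powr (1 - p) * pi)) \<longlongrightarrow> b * (B powr p * 0 * pi)) at_top"
      using p by (intro tendsto_intros tendsto_neg_powr filterlim_ident) auto
    moreover have "\<forall>\<^sub>F R in at_top. e R = b * (B powr p * R powr (1 - p) * pi)"
      using eventually_gt_at_top[of 0]
    proof eventually_elim
      case (elim R)
      show ?case using elim
        by (simp add: e_def powr_divide powr_diff divide_simps)
    qed
    ultimately show ?thesis using tendsto_cong by fast
  qed
  then show "(e \<longlongrightarrow> 0) at_top" by simp
  show "\<forall>\<^sub>F R in at_top. (\<integral>\<^sup>+x\<in>{-R..R}. ennreal (norm (G (of_real x)) powr p) \<partial>lborel)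
    \<le> ennreal a * (\<integral>\<^sup>+x. ennreal (Re (G (of_real x)) powr p) \<partial>lborel) + ennreal (e R)"
    using eventually_gt_at_top[of "max 0 K"]
  proof eventually_elim
    case (elim R)
    then have R: "R > 0" "R \<ge> K" by auto
    let ?l = "linepath (of_real (-R)) (of_real R :: complex)" and ?c = "part_circlepath 0 R 0 pi"
    have imc: "Im z \<ge> 0" "norm z = R" if "z \<in> path_image ?c" for z
      using that R sin_ge_zero by (auto simp: path_image_part_circlepath' closed_segment_eq_real_ivl norm_mult)
    have cS: "path_image ?c \<subseteq> ?S" using imc y by fastforce
    have lS: "path_image ?l \<subseteq> ?S" using y by (auto simp: closed_segment_def)
    have intl: "P contour_integrable_on ?l"
      using holP lS by (intro contour_integrable_continuous_linepath)
        (auto intro: holomorphic_on_imp_continuous_on holomorphic_on_subset)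
    have intc: "P contour_integrable_on ?c"
      using holP cS by (intro contour_integrable_continuous_part_circlepath)
        (auto intro: holomorphic_on_imp_continuous_on holomorphic_on_subset)
    have "(P has_contour_integral 0) (?l +++ ?c)"
      using cS lS by (intro Cauchy_theorem_convex_simple[OF holP convS]) (auto simp: path_image_join)
    then have "contour_integral ?l P + contour_integral ?c P = 0"
      using intl intc contour_integral_unique contour_integral_join
      by (metis valid_path_linepath valid_path_part_circlepath)
    moreover have "contour_integral ?l P = integral {-R..R} (\<lambda>x. P (of_real x))"
      using R by (subst contour_integral_linepath_Reals_eq) auto
    moreover have "norm (contour_integral ?c P) \<le> (B / R) powr p * R * \<bar>pi - 0\<bar>"
    proof (rule contour_integral_bound_part_circlepath[OF intc])
      fix z assume z: "z \<in> path_image ?c"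
      have "norm (P z) = norm (G z) powr p"
        unfolding P_def by (simp add: norm_powr_real_powr')
      also have "\<dots> \<le> (B / R) powr p"
        using decay[of z] imc[OF z] R p by (intro powr_mono2) auto
      finally show "norm (P z) \<le> (B / R) powr p" .
    qed (use R in auto)
    ultimately have "norm (integral {-R..R} (\<lambda>x. P (of_real x))) \<le> (B / R) powr p * R * pi"
      by (metis add_eq_0_iff diff_zero norm_minus_cancel abs_of_nonneg pi_ge_zero)
    moreover have intP: "(\<lambda>x. P (of_real x)) integrable_on {-R..R}"
      using contP by (intro integrable_continuous_real) (auto intro: continuous_on_subset)
    then have "integral {-R..R} (\<lambda>x. Re (P (of_real x))) = Re (integral {-R..R} (\<lambda>x. P (of_real x)))"
      by (intro integral_unique has_integral_Re integrable_integral)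
    ultimately have IP: "\<bar>integral {-R..R} (\<lambda>x. Re (P (of_real x)))\<bar> \<le> (B / R) powr p * R * pi"
      using abs_Re_le_cmod order_trans by metis
    have i1: "(\<lambda>x. norm (G (of_real x)) powr p) integrable_on {-R..R}"
      "(\<lambda>x. Re (G (of_real x)) powr p) integrable_on {-R..R}"
      "(\<lambda>x. Re (P (of_real x))) integrable_on {-R..R}"
      using contN contR continuous_on_Re[OF contP]
      by (auto intro!: integrable_continuous_real intro: continuous_on_subset)
    have "integral {-R..R} (\<lambda>x. norm (G (of_real x)) powr p)
       \<le> integral {-R..R} (\<lambda>x. a * Re (G (of_real x)) powr p - b * Re (P (of_real x)))"
      using ineq[OF posx] i1 by (intro integral_le integrable_diff integrable_on_mult_right) (auto simp: P_def)
    also have "\<dots> = a * integral {-R..R} (\<lambda>x. Re (G (of_real x)) powr p)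
        - b * integral {-R..R} (\<lambda>x. Re (P (of_real x)))"
      using i1 by (subst integral_diff) (auto intro!: integrable_on_mult_right)
    also have "\<dots> \<le> a * integral {-R..R} (\<lambda>x. Re (G (of_real x)) powr p) + e R"
    proof -
      have "b * (- integral {-R..R} (\<lambda>x. Re (P (of_real x)))) \<le> e R"
        unfolding e_def using IP ab by (intro mult_left_mono) auto
      then show ?thesis by simp
    qed
    finally have le: "integral {-R..R} (\<lambda>x. norm (G (of_real x)) powr p)
      \<le> a * integral {-R..R} (\<lambda>x. Re (G (of_real x)) powr p) + e R" .
    have eR: "e R \<ge> 0" using ab R by (auto simp: e_def)
    have nI: "0 \<le> integral {-R..R} (\<lambda>x. Re (G (of_real x)) powr p)"
      by (intro integral_nonneg i1) auto
    have "(\<integral>\<^sup>+x\<in>{-R..R}. ennreal (norm (G (of_real x)) powr p) \<partial>lborel)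
        = ennreal (integral {-R..R} (\<lambda>x. norm (G (of_real x)) powr p))"
      using i1 by (intro nn_integral_has_integral_lebesgue') (auto simp: integrable_integral)
    also have "\<dots> \<le> ennreal (a * integral {-R..R} (\<lambda>x. Re (G (of_real x)) powr p) + e R)"
      by (rule ennreal_leI[OF le])
    also have "\<dots> = ennreal a * ennreal (integral {-R..R} (\<lambda>x. Re (G (of_real x)) powr p)) + ennreal (e R)"
      using ab eR nI by (simp add: ennreal_mult ennreal_plus)
    also have "ennreal (integral {-R..R} (\<lambda>x. Re (G (of_real x)) powr p))
       = (\<integral>\<^sup>+x\<in>{-R..R}. ennreal (Re (G (of_real x)) powr p) \<partial>lborel)"
      using i1 by (intro nn_integral_has_integral_lebesgue'[symmetric]) (auto simp: integrable_integral)
    also have "\<dots> \<le> (\<integral>\<^sup>+x. ennreal (Re (G (of_real x)) powr p) \<partial>lborel)"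
      by (intro nn_integral_mono) (auto simp: indicator_def)
    finally show ?case by (simp add: add_right_mono mult_left_mono)
  qed
qed

lemma nn_integral_Poisson_kernel_le:
  assumes y: "y > (0::real)"
  shows "(\<integral>\<^sup>+t. ennreal (y / ((x - t)\<^sup>2 + y\<^sup>2)) \<partial>lborel) \<le> ennreal pi"
proof -
  let ?g = "\<lambda>t. y / ((x - t)\<^sup>2 + y\<^sup>2)"
  have pos: "(x - t)\<^sup>2 + y\<^sup>2 > 0" for t using y by (intro add_nonneg_pos) auto
  have half: "(\<integral>\<^sup>+t. ennreal (?g t) * indicator {x..} t \<partial>lborel) = ennreal (pi/2 - arctan ((x - x) / y))"
  proof (rule nn_integral_FTC_atLeast[where F="\<lambda>t. arctan ((t - x) / y)"])
    show "((\<lambda>t. arctan ((t - x) / y)) has_real_derivative ?g t) (at t)" for t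
    proof -
      have "((\<lambda>t. arctan ((t - x) / y)) has_real_derivative (1/y) * inverse (1 + ((t - x)/y)\<^sup>2)) (at t)"
        using y by (auto intro!: derivative_eq_intros)
      also have "(1/y) * inverse (1 + ((t - x)/y)\<^sup>2) = ?g t"
        using y pos[of t] by (simp add: divide_simps power2_eq_square) (simp add: algebra_simps)
      finally show ?thesis .
    qed
    have "filterlim (\<lambda>t. (1/y) * (t - x)) at_top at_top"
      using y by (intro filterlim_tendsto_pos_mult_at_top[OF tendsto_const])
        (auto intro!: filterlim_tendsto_add_at_top[OF tendsto_const filterlim_ident, of "-x", simplified])
    then have "filterlim (\<lambda>t. (t - x) / y) at_top at_top" by (simp add: field_simps)
    then show "((\<lambda>t. arctan ((t - x) / y)) \<longlongrightarrow> pi/2) at_top"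
      by (rule filterlim_compose[OF tendsto_arctan_at_top])
  qed (use y in \<open>auto\<close>)
  \<comment> \<open>the reflection about \<open>x\<close> maps the left half line to the right one\<close>
  have "(\<integral>\<^sup>+t. ennreal (?g t) \<partial>lborel)
      \<le> (\<integral>\<^sup>+t. ennreal (?g t) * indicator {x..} t + ennreal (?g (2*x + (-1)*t)) * indicator {x..} (2*x + (-1)*t) \<partial>lborel)"
    by (intro nn_integral_mono) (auto simp: indicator_def power2_commute)
  also have "\<dots> = (\<integral>\<^sup>+t. ennreal (?g t) * indicator {x..} t \<partial>lborel)
       + (\<integral>\<^sup>+t. ennreal (?g (2*x + (-1)*t)) * indicator {x..} (2*x + (-1)*t) \<partial>lborel)"
    by (intro nn_integral_add) auto
  also have "(\<integral>\<^sup>+t. ennreal (?g (2*x + (-1)*t)) * indicator {x..} (2*x + (-1)*t) \<partial>lborel)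
      = (\<integral>\<^sup>+t. ennreal (?g t) * indicator {x..} t \<partial>lborel)"
    by (subst (2) nn_integral_real_affine[where c="-1" and t="2*x"]) auto
  also have "(\<integral>\<^sup>+t. ennreal (?g t) * indicator {x..} t \<partial>lborel) + (\<integral>\<^sup>+t. ennreal (?g t) * indicator {x..} t \<partial>lborel)
     = ennreal pi"
    unfolding half by (simp add: ennreal_plus[symmetric] del: ennreal_plus)
  finally show ?thesis .
qed

section \<open>The Cauchy integral of a function on the line\<close>

text \<open>The functions on the line for which all integrals below exist without further comment. The class
  is preserved by truncated Hilbert transforms, which the duality argument uses.\<close>

definition cont_compact_supp :: "(real \<Rightarrow> 'b::real_normed_vector) \<Rightarrow> bool" where
  "cont_compact_supp f \<longleftrightarrow> continuous_on UNIV f \<and> (\<exists>M. \<forall>t. M < \<bar>t\<bar> \<longrightarrow> f t = 0)"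

lemma cont_compact_supp_E:
  assumes "cont_compact_supp f"
  obtains M where "M > 0" "continuous_on UNIV f" "\<And>t. t \<notin> {-M..M} \<Longrightarrow> f t = 0"
proof -
  obtain M where "continuous_on UNIV f" "\<And>t. M < \<bar>t\<bar> \<Longrightarrow> f t = 0"
    using assms by (auto simp: cont_compact_supp_def)
  then show thesis by (intro that[of "max 1 M"]) auto
qed

lemma cont_compact_supp_bounded:
  assumes "cont_compact_supp f"
  obtains B where "B > 0" "\<And>t. norm (f t) \<le> B"
proof -
  obtain M where M: "M > 0" "continuous_on UNIV f" "\<And>t. t \<notin> {-M..M} \<Longrightarrow> f t = 0"
    using assms by (auto elim: cont_compact_supp_E)
  have "compact (f ` {-M..M})"
    using M by (intro compact_continuous_image) (auto intro: continuous_on_subset)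
  then obtain B where "B > 0" "\<And>t. t \<in> {-M..M} \<Longrightarrow> norm (f t) \<le> B"
    by (metis (full_types) bounded_pos compact_imp_bounded imageI)
  then show thesis using M(3) by (intro that[of B]) (metis norm_zero less_imp_le)+
qed

lemma cont_compact_supp_integrable:
  fixes f :: "real \<Rightarrow> 'b::{euclidean_space}"
  assumes "continuous_on {-M..M} f" "\<And>t. t \<notin> {-M..M} \<Longrightarrow> f t = 0"
  shows "integrable lborel f" "integral\<^sup>L lborel f = integral {-M..M} f"
proof -
  have *: "(\<lambda>x. indicator {-M..M} x *\<^sub>R f x) = f"
    using assms(2) by (auto simp: indicator_def)
  have si: "set_integrable lborel {-M..M} f"
    unfolding set_integrable_def using assms by (intro borel_integrable_compact) auto
  show "integrable lborel f" using si unfolding set_integrable_def * .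
  show "integral\<^sup>L lborel f = integral {-M..M} f"
    using set_borel_integral_eq_integral(2)[OF si] unfolding set_lebesgue_integral_def * .
qed

lemma cont_compact_supp_measurable [measurable_dest]: "cont_compact_supp f \<Longrightarrow> f \<in> borel_measurable borel"
  by (auto simp: cont_compact_supp_def intro: borel_measurable_continuous_onI)

text \<open>The kernel \<open>\<i> / (z - t)\<close> at \<open>z = x + \<i>y\<close> has the Poisson kernel \<open>y / ((x - t)\<^sup>2 + y\<^sup>2)\<close> as its
  real part and the conjugate Poisson kernel as its imaginary part.\<close>

definition cauchy_ext :: "(real \<Rightarrow> real) \<Rightarrow> complex \<Rightarrow> complex" where
  "cauchy_ext f z = (\<integral>t. of_real (f t) * (\<i> / (z - of_real t)) \<partial>lborel)"

lemma cauchy_kernel_eq: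
  assumes "y > 0"
  shows "\<i> / (Complex x y - of_real t)
    = Complex (y / ((x - t)\<^sup>2 + y\<^sup>2)) ((x - t) / ((x - t)\<^sup>2 + y\<^sup>2))"
  using assms by (simp add: complex_eq_iff Re_divide Im_divide power2_eq_square)

lemma cauchy_ext_integrand_continuous:
  assumes "continuous_on UNIV f" "Im z > 0"
  shows "continuous_on UNIV (\<lambda>t. of_real (f t) * (\<i> / (z - of_real t)))"
proof -
  have "z \<noteq> of_real t" for t using assms by auto
  then show ?thesis using assms by (intro continuous_intros) auto
qed

lemma cauchy_ext_integrable:
  assumes "cont_compact_supp f" "Im z > 0"
  shows "integrable lborel (\<lambda>t. of_real (f t) * (\<i> / (z - of_real t)))"
proof -
  obtain M where M: "M > 0" "continuous_on UNIV f" "\<And>t. t \<notin> {-M..M} \<Longrightarrow> f t = 0"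
    using assms by (auto elim: cont_compact_supp_E)
  show ?thesis
    using M by (intro cont_compact_supp_integrable(1)[of M] continuous_on_subset[OF cauchy_ext_integrand_continuous] assms) auto
qed

lemma Re_Im_cauchy_ext:
  assumes "cont_compact_supp f" "y > 0"
  shows "Re (cauchy_ext f (Complex x y)) = (\<integral>t. f t * (y / ((x - t)\<^sup>2 + y\<^sup>2)) \<partial>lborel)"
    and "Im (cauchy_ext f (Complex x y)) = (\<integral>t. f t * ((x - t) / ((x - t)\<^sup>2 + y\<^sup>2)) \<partial>lborel)"
    and "integrable lborel (\<lambda>t. f t * (y / ((x - t)\<^sup>2 + y\<^sup>2)))"
    and "integrable lborel (\<lambda>t. f t * ((x - t) / ((x - t)\<^sup>2 + y\<^sup>2)))"
proof -
  have i: "integrable lborel (\<lambda>t. of_real (f t) * (\<i> / (Complex x y - of_real t)))"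
    using assms by (intro cauchy_ext_integrable) auto
  note e = cauchy_kernel_eq[OF assms(2)]
  from integral_Re[OF i] integral_Im[OF i]
  show "Re (cauchy_ext f (Complex x y)) = (\<integral>t. f t * (y / ((x - t)\<^sup>2 + y\<^sup>2)) \<partial>lborel)"
    and "Im (cauchy_ext f (Complex x y)) = (\<integral>t. f t * ((x - t) / ((x - t)\<^sup>2 + y\<^sup>2)) \<partial>lborel)"
    unfolding cauchy_ext_def e by simp_all
  from integrable_Re[OF i] integrable_Im[OF i]
  show "integrable lborel (\<lambda>t. f t * (y / ((x - t)\<^sup>2 + y\<^sup>2)))"
    and "integrable lborel (\<lambda>t. f t * ((x - t) / ((x - t)\<^sup>2 + y\<^sup>2)))"
    unfolding e by simp_all
qed

text \<open>The Poisson kernel has mass at most \<open>\<pi>\<close> in each of its two variables. Jensen's inequality uses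
  this in one variable and Tonelli's theorem in the other.\<close>

lemma nn_integral_Re_cauchy_ext_le:
  assumes f: "cont_compact_supp f" "\<And>t. f t \<ge> 0" and y: "y > 0" and p: "1 < p"
  shows "(\<integral>\<^sup>+x. ennreal (Re (cauchy_ext f (Complex x y)) powr p) \<partial>lborel)
    \<le> ennreal (pi powr p) * (\<integral>\<^sup>+t. ennreal (f t powr p) \<partial>lborel)"
proof -
  note [measurable] = cont_compact_supp_measurable[OF f(1)]
  let ?k = "\<lambda>x t. y / ((x - t)\<^sup>2 + y\<^sup>2)"
  have pw: "ennreal (Re (cauchy_ext f (Complex x y)) powr p)
     \<le> ennreal (pi powr (p - 1)) * (\<integral>\<^sup>+t. ennreal (?k x t) * ennreal (f t powr p) \<partial>lborel)" for x
  proof -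
    let ?D = "density lborel (\<lambda>t. ennreal (?k x t))"
    have "(\<integral>t. f t \<partial>?D) = Re (cauchy_ext f (Complex x y))"
      using y by (subst integral_density) (auto simp: Re_Im_cauchy_ext[OF f(1) y] mult.commute)
    moreover have "(\<integral>t. f t \<partial>?D) \<ge> 0" using f(2) by simp
    moreover have "ennreal (norm (\<integral>t. f t \<partial>?D) powr p)
        \<le> ennreal (pi powr (p - 1)) * (\<integral>\<^sup>+t. ennreal (norm (f t) powr p) \<partial>?D)"
      using nn_integral_Poisson_kernel_le[OF y, of x] p
      by (intro jensen_powr_norm) (auto simp: emeasure_density)
    ultimately show ?thesis using f(2) by (simp add: nn_integral_density)
  qed
  have "(\<integral>\<^sup>+x. ennreal (Re (cauchy_ext f (Complex x y)) powr p) \<partial>lborel)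
     \<le> (\<integral>\<^sup>+x. ennreal (pi powr (p - 1)) * (\<integral>\<^sup>+t. ennreal (?k x t) * ennreal (f t powr p) \<partial>lborel) \<partial>lborel)"
    by (intro nn_integral_mono pw)
  also have "\<dots> = ennreal (pi powr (p - 1)) * (\<integral>\<^sup>+x. \<integral>\<^sup>+t. ennreal (?k x t) * ennreal (f t powr p) \<partial>lborel \<partial>lborel)"
    by (intro nn_integral_cmult) measurable
  also have "(\<integral>\<^sup>+x. \<integral>\<^sup>+t. ennreal (?k x t) * ennreal (f t powr p) \<partial>lborel \<partial>lborel)
     = (\<integral>\<^sup>+t. \<integral>\<^sup>+x. ennreal (?k x t) * ennreal (f t powr p) \<partial>lborel \<partial>lborel)"
    by (intro lborel_pair.Fubini') measurable
  also have "\<dots> \<le> (\<integral>\<^sup>+t. ennreal pi * ennreal (f t powr p) \<partial>lborel)"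
  proof (intro nn_integral_mono)
    fix t
    have "(\<integral>\<^sup>+x. ennreal (?k x t) * ennreal (f t powr p) \<partial>lborel)
        = (\<integral>\<^sup>+x. ennreal (?k t x) \<partial>lborel) * ennreal (f t powr p)"
      by (subst nn_integral_multc[symmetric]) (auto simp: power2_commute)
    also have "\<dots> \<le> ennreal pi * ennreal (f t powr p)"
      by (intro mult_right_mono nn_integral_Poisson_kernel_le y) auto
    finally show "(\<integral>\<^sup>+x. ennreal (?k x t) * ennreal (f t powr p) \<partial>lborel) \<le> ennreal pi * ennreal (f t powr p)" .
  qed
  also have "\<dots> = ennreal pi * (\<integral>\<^sup>+t. ennreal (f t powr p) \<partial>lborel)"
    by (intro nn_integral_cmult) measurable
  finally have "(\<integral>\<^sup>+x. ennreal (Re (cauchy_ext f (Complex x y)) powr p) \<partial>lborel)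
    \<le> ennreal (pi powr (p - 1)) * (ennreal pi * (\<integral>\<^sup>+t. ennreal (f t powr p) \<partial>lborel))"
    by (simp add: mult_left_mono)
  also have "\<dots> = ennreal (pi powr p) * (\<integral>\<^sup>+t. ennreal (f t powr p) \<partial>lborel)"
    by (simp add: mult.assoc[symmetric] ennreal_mult[symmetric] powr_diff)
  finally show ?thesis .
qed

text \<open>The estimate on the half plane is applied to the Cauchy integral moved down by \<open>y\<close>; the constant
  is independent of \<open>y\<close>. Strict positivity of the real part requires \<open>f \<noteq> 0\<close>, and decay like \<open>1/\<bar>z\<bar>\<close>
  comes from the compact support.\<close>

lemma nn_integral_cauchy_ext_le:
  assumes p: "1 < p" "p < 3"
  obtains C where "C \<ge> 0" "\<And>f y. cont_compact_supp f \<Longrightarrow> (\<And>t. f t \<ge> 0) \<Longrightarrow> y > 0 \<Longrightarrow>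
    (\<integral>\<^sup>+x. ennreal (norm (cauchy_ext f (Complex x y)) powr p) \<partial>lborel)
    \<le> ennreal C * (\<integral>\<^sup>+t. ennreal (f t powr p) \<partial>lborel)"
proof -
  obtain a b where ab: "0 \<le> a" "0 \<le> b"
    "\<And>z::complex. Re z > 0 \<Longrightarrow> norm z powr p \<le> a * Re z powr p - b * Re (z powr of_real p)"
    using norm_powr_le_Re_powr_complex[OF p] by blast
  have "(\<integral>\<^sup>+x. ennreal (norm (cauchy_ext f (Complex x y)) powr p) \<partial>lborel)
    \<le> ennreal (a * pi powr p) * (\<integral>\<^sup>+t. ennreal (f t powr p) \<partial>lborel)"
    if f: "cont_compact_supp f" "\<And>t. f t \<ge> 0" and y: "y > 0" for f y
  proof (cases "\<forall>t. f t = 0")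
    case True
    then show ?thesis by (simp add: cauchy_ext_def)
  next
    case False
    then obtain t0 where t0: "f t0 \<noteq> 0" by blast
    obtain M where M: "M > 0" "continuous_on UNIV f" "\<And>t. t \<notin> {-M..M} \<Longrightarrow> f t = 0"
      using f by (auto elim: cont_compact_supp_E)
    obtain B where B: "B > 0" "\<And>t. norm (f t) \<le> B" using f cont_compact_supp_bounded by blast
    have t0M: "t0 \<in> {-M..M}" using t0 M(3) by blast
    have HK: "cauchy_ext f z = integral {-M..M} (\<lambda>t. of_real (f t) * (\<i> / (z - of_real t)))" if "Im z > 0" for z
      unfolding cauchy_ext_def using M that
      by (intro cont_compact_supp_integrable(2) continuous_on_subset[OF cauchy_ext_integrand_continuous]) auto
    define G where "G z = cauchy_ext f (z + \<i> * of_real y)" for z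
    have hol: "cauchy_ext f holomorphic_on {z. Im z > 0}"
    proof -
      have "(\<lambda>z. integral (cbox (-M) M) (\<lambda>t. of_real (f t) * (\<i> / (z - of_real t)))) holomorphic_on {z. Im z > 0}"
      proof (rule leibniz_rule_holomorphic)
        show "((\<lambda>z. of_real (f t) * (\<i> / (z - of_real t))) has_field_derivative
          of_real (f t) * (- \<i> / (z - of_real t)\<^sup>2)) (at z within {z. Im z > 0})" if "z \<in> {z. Im z > 0}" for z t
        proof -
          have "z - of_real t \<noteq> 0" using that by (auto simp: complex_eq_iff)
          then show ?thesis by (auto intro!: derivative_eq_intros simp: power2_eq_square)
        qed
        show "(\<lambda>t. of_real (f t) * (\<i> / (z - of_real t))) integrable_on cbox (-M) M"
          if "z \<in> {z. Im z > 0}" for z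
          using that by (intro integrable_continuous continuous_on_subset[OF cauchy_ext_integrand_continuous[OF M(2)]]) auto
        have ne: "Im z > 0 \<Longrightarrow> z \<noteq> of_real t" for z t by auto
        have cf: "continuous_on A (\<lambda>x. f (snd x))" for A :: "(complex \<times> real) set"
          by (rule continuous_on_compose2[OF M(2)]) (auto intro!: continuous_intros)
        show "continuous_on ({z. Im z > 0} \<times> cbox (-M) M)
            (\<lambda>(z, t). of_real (f t) * (- \<i> / (z - of_real t)\<^sup>2))"
          unfolding case_prod_beta by (intro continuous_intros cf) (use ne in auto)
      qed (rule convex_halfspace_Im_gt)
      then show ?thesis by (rule holomorphic_transform) (auto simp: HK)
    qed
    have "(\<integral>\<^sup>+x. ennreal (norm (G (of_real x)) powr p) \<partial>lborel)
        \<le> ennreal a * (\<integral>\<^sup>+x. ennreal (Re (G (of_real x)) powr p) \<partial>lborel)"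
    proof (rule half_plane_nn_integral_norm_le_Re[OF y _ _ _ p(1) ab])
      show "G holomorphic_on {z. - y < Im z}"
        unfolding G_def
        by (rule holomorphic_on_compose_gen[OF _ hol, of "\<lambda>z. z + \<i> * of_real y", unfolded o_def])
          (auto intro!: holomorphic_intros)
      show "Re (G z) > 0" if z: "- y < Im z" for z
      proof -
        define x' y' where "x' = Re z" and "y' = Im z + y"
        have y': "y' > 0" using z by (simp add: y'_def)
        have Gz: "G z = cauchy_ext f (Complex x' y')"
          by (simp add: G_def x'_def y'_def) (metis (no_types) Complex_eq add.assoc complex_eq distrib_left of_real_add)
        let ?h = "\<lambda>t. f t * (y' / ((x' - t)\<^sup>2 + y'\<^sup>2))"
        have ps: "(x' - t)\<^sup>2 + y'\<^sup>2 > 0" for t using y' by (intro add_nonneg_pos) auto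
        have ch: "continuous_on {-M..M} ?h"
          using ps by (intro continuous_intros continuous_on_subset[OF M(2)]) (auto, metis less_irrefl)
        have "Re (G z) = integral {-M..M} ?h"
          unfolding Gz Re_Im_cauchy_ext(1)[OF f(1) y'] using M ch by (intro cont_compact_supp_integrable(2)) auto
        moreover have "integral {-M..M} ?h \<ge> 0"
          using ch f(2) y' by (intro integral_nonneg integrable_continuous_real) auto
        moreover have "integral {-M..M} ?h \<noteq> 0"
          using ch M(1) f(2) y' t0 t0M ps[of t0]
          by (subst integral_eq_0_iff) auto
        ultimately show ?thesis by linarith
      qed
      show "norm (G z) \<le> (4 * B * M) / norm z" if z: "Im z \<ge> 0" "norm z \<ge> 2 * (y + M)" for z
      proof -
        let ?w = "z + \<i> * of_real y"
        have w: "Im ?w > 0" using z y by simp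
        have z0: "norm z > 0" by (rule less_le_trans[OF _ z(2)]) (use y M(1) in auto)
        have "norm (integral {-M..M} (\<lambda>t. of_real (f t) * (\<i> / (?w - of_real t)))) \<le> (B * (2 / norm z)) * (M - (-M))"
        proof (rule integral_bound)
          show "continuous_on {-M..M} (\<lambda>t. of_real (f t) * (\<i> / (?w - of_real t)))"
            by (intro continuous_on_subset[OF cauchy_ext_integrand_continuous[OF M(2) w]]) auto
          fix t assume t: "t \<in> {-M..M}"
          have n1: "norm z \<le> norm (?w - of_real t) + norm (\<i> * of_real y - of_real t :: complex)"
            using norm_triangle_ineq4[of "?w - of_real t" "\<i> * of_real y - of_real t"] by simp
          have n2: "norm (\<i> * of_real y - of_real t :: complex) \<le> y + M"
            using norm_triangle_ineq4[of "\<i> * of_real y" "of_real t :: complex"] t y by (auto simp: norm_mult)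
          have "norm (?w - of_real t) \<ge> norm z / 2"
            using order_trans[OF n1 add_left_mono[OF n2]] z(2) by (simp add: field_simps)
          then have "norm (\<i> / (?w - of_real t)) \<le> 2 / norm z"
            using z0 by (simp add: norm_divide) (simp add: divide_simps mult.commute)
          then show "norm (of_real (f t) * (\<i> / (?w - of_real t))) \<le> B * (2 / norm z)"
            unfolding norm_mult using B by (intro mult_mono) auto
        qed (use M in auto)
        then show ?thesis unfolding G_def HK[OF w] by (simp add: field_simps)
      qed
    qed
    moreover have "G (of_real x) = cauchy_ext f (Complex x y)" for x
      by (simp add: G_def Complex_eq)
    ultimately have "(\<integral>\<^sup>+x. ennreal (norm (cauchy_ext f (Complex x y)) powr p) \<partial>lborel)
      \<le> ennreal a * (\<integral>\<^sup>+x. ennreal (Re (cauchy_ext f (Complex x y)) powr p) \<partial>lborel)"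
      by simp
    also have "\<dots> \<le> ennreal a * (ennreal (pi powr p) * (\<integral>\<^sup>+t. ennreal (f t powr p) \<partial>lborel))"
      by (intro mult_left_mono nn_integral_Re_cauchy_ext_le f y p) auto
    finally show ?thesis using ab by (simp add: ennreal_mult mult.assoc)
  qed
  then show thesis using that[of "a * pi powr p"] ab by auto
qed

section \<open>Truncated Hilbert transforms on the line\<close>

definition hilbert_kernel :: "real \<Rightarrow> real \<Rightarrow> real \<Rightarrow> real" where
  "hilbert_kernel \<epsilon> N t = indicator {t. \<epsilon> \<le> \<bar>t\<bar> \<and> \<bar>t\<bar> \<le> N} t / t"

text \<open>Both truncations, near zero and near infinity, are kept until the very end, so that every
  integral converges absolutely.\<close>

definition trunc_hilbert ::
    "real \<Rightarrow> real \<Rightarrow> (real \<Rightarrow> 'b::{banach,second_countable_topology}) \<Rightarrow> real \<Rightarrow> 'b" where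
  "trunc_hilbert \<epsilon> N f s = (\<integral>t. hilbert_kernel \<epsilon> N (s - t) *\<^sub>R f t \<partial>lborel)"

lemma hilbert_kernel_measurable [measurable]: "hilbert_kernel \<epsilon> N \<in> borel_measurable borel"
  unfolding hilbert_kernel_def by measurable

lemma hilbert_kernel_minus: "hilbert_kernel \<epsilon> N (- t) = - hilbert_kernel \<epsilon> N t"
  by (simp add: hilbert_kernel_def indicator_def)

lemma hilbert_kernel_bound:
  assumes "\<epsilon> > 0"
  shows "\<bar>hilbert_kernel \<epsilon> N t\<bar> \<le> 1 / \<epsilon> * indicator {-N..N} t"
  using assms by (auto simp: hilbert_kernel_def indicator_def divide_simps)

lemma hilbert_kernel_bound': "\<epsilon> > 0 \<Longrightarrow> \<bar>hilbert_kernel \<epsilon> N t\<bar> \<le> 1 / \<epsilon>"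
  by (rule order_trans[OF hilbert_kernel_bound]) (auto simp: indicator_def)

lemma trunc_hilbert_integrable:
  fixes f :: "real \<Rightarrow> 'b::euclidean_space"
  assumes \<epsilon>: "\<epsilon> > 0" and f: "cont_compact_supp f"
  shows "integrable lborel (\<lambda>t. hilbert_kernel \<epsilon> N (s - t) *\<^sub>R f t)"
proof (rule Bochner_Integration.integrable_bound)
  note [measurable] = cont_compact_supp_measurable[OF f]
  show "(\<lambda>t. hilbert_kernel \<epsilon> N (s - t) *\<^sub>R f t) \<in> borel_measurable lborel" by measurable
  obtain M where M: "M > 0" "continuous_on UNIV f" "\<And>t. t \<notin> {-M..M} \<Longrightarrow> f t = 0"
    using f by (auto elim: cont_compact_supp_E)
  show "integrable lborel (\<lambda>t. (1 / \<epsilon>) *\<^sub>R f t)"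
    by (intro integrable_scaleR_right cont_compact_supp_integrable(1)[of M] M continuous_on_subset[OF M(2)]) auto
  show "AE t in lborel. norm (hilbert_kernel \<epsilon> N (s - t) *\<^sub>R f t) \<le> norm ((1 / \<epsilon>) *\<^sub>R f t)"
  proof (intro AE_I2)
    fix t
    have "\<bar>hilbert_kernel \<epsilon> N (s - t)\<bar> * norm (f t) \<le> (1 / \<epsilon>) * norm (f t)"
      by (intro mult_right_mono hilbert_kernel_bound' \<epsilon>) auto
    then show "norm (hilbert_kernel \<epsilon> N (s - t) *\<^sub>R f t) \<le> norm ((1 / \<epsilon>) *\<^sub>R f t)"
      using \<epsilon> by simp
  qed
qed

lemma trunc_hilbert_eq:
  fixes f :: "real \<Rightarrow> 'b::euclidean_space"
  shows "trunc_hilbert \<epsilon> N f s = (\<integral>t. hilbert_kernel \<epsilon> N t *\<^sub>R f (s - t) \<partial>lborel)"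
  unfolding trunc_hilbert_def
  by (subst lborel_integral_real_affine[where c="-1" and t=s]) auto

lemma cont_compact_supp_trunc_hilbert:
  fixes f :: "real \<Rightarrow> 'b::euclidean_space"
  assumes \<epsilon>: "\<epsilon> > 0" and f: "cont_compact_supp f"
  shows "cont_compact_supp (trunc_hilbert \<epsilon> N f)"
proof -
  note [measurable] = cont_compact_supp_measurable[OF f]
  obtain M where M: "M > 0" "continuous_on UNIV f" "\<And>t. t \<notin> {-M..M} \<Longrightarrow> f t = 0"
    using f by (auto elim: cont_compact_supp_E)
  obtain B where B: "B > 0" "\<And>t. norm (f t) \<le> B" using f cont_compact_supp_bounded by blast
  have "isCont (trunc_hilbert \<epsilon> N f) s" for s
    unfolding continuous_at_sequentially o_def
  proof safe
    fix x :: "nat \<Rightarrow> real" assume x: "x \<longlonglongrightarrow> s"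
    show "(\<lambda>n. trunc_hilbert \<epsilon> N f (x n)) \<longlonglongrightarrow> trunc_hilbert \<epsilon> N f s"
      unfolding trunc_hilbert_eq
    proof (rule integral_dominated_convergence[where w="\<lambda>t. (1/\<epsilon> * B) * indicator {-N..N} t"])
      show "AE t in lborel. (\<lambda>n. hilbert_kernel \<epsilon> N t *\<^sub>R f (x n - t)) \<longlonglongrightarrow> hilbert_kernel \<epsilon> N t *\<^sub>R f (s - t)"
      proof (intro AE_I2 tendsto_scaleR tendsto_const)
        fix t
        have "isCont f (s - t)" using M(2) continuous_on_eq_continuous_at by blast
        then show "(\<lambda>n. f (x n - t)) \<longlonglongrightarrow> f (s - t)"
          by (rule isCont_tendsto_compose) (intro tendsto_intros x)
      qed
      show "AE t in lborel. norm (hilbert_kernel \<epsilon> N t *\<^sub>R f (x n - t)) \<le> (1/\<epsilon> * B) * indicator {-N..N} t" for n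
      proof (intro AE_I2)
        fix t
        have "norm (hilbert_kernel \<epsilon> N t *\<^sub>R f (x n - t)) \<le> (1 / \<epsilon> * indicator {-N..N} t) * B"
          unfolding norm_scaleR using \<epsilon> by (intro mult_mono hilbert_kernel_bound B) auto
        then show "norm (hilbert_kernel \<epsilon> N t *\<^sub>R f (x n - t)) \<le> (1/\<epsilon> * B) * indicator {-N..N} t"
          by (simp add: mult_ac)
      qed
      show "integrable lborel (\<lambda>t. (1/\<epsilon> * B) * indicator {-N..N} t)"
        by (intro integrable_mult_right integrable_real_indicator) (auto simp: emeasure_lborel_Icc_eq)
    qed measurable
  qed
  then have "continuous_on UNIV (trunc_hilbert \<epsilon> N f)"
    by (simp add: continuous_on_eq_continuous_at)
  moreover have "trunc_hilbert \<epsilon> N f s = 0" if s: "\<bar>N\<bar> + M < \<bar>s\<bar>" for s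
  proof -
    have "(\<lambda>t. hilbert_kernel \<epsilon> N (s - t) *\<^sub>R f t) = (\<lambda>_. 0)"
    proof
      fix t show "hilbert_kernel \<epsilon> N (s - t) *\<^sub>R f t = 0"
      proof (cases "t \<in> {-M..M}")
      case True
      then have "\<not> \<bar>s - t\<bar> \<le> N" using s by auto
      then show ?thesis by (simp add: hilbert_kernel_def)
      qed (simp add: M(3))
    qed
    then show ?thesis by (simp only: trunc_hilbert_def integral_zero)
  qed
  ultimately show ?thesis by (auto simp: cont_compact_supp_def)
qed

text \<open>Truncating \<open>1/t\<close> sharply instead of smoothly costs at most the Poisson kernel, pointwise. The
  version with strict inequality is what remains of \<open>1/t\<close> beyond the outer truncation.\<close>

lemma one_div_minus_conjugate_Poisson:
  fixes \<epsilon> t :: real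
  assumes "\<epsilon> > 0"
  shows "\<bar>indicator {t. \<epsilon> \<le> \<bar>t\<bar>} t / t - t / (t\<^sup>2 + \<epsilon>\<^sup>2)\<bar> \<le> \<epsilon> / (t\<^sup>2 + \<epsilon>\<^sup>2)"
    and "\<bar>indicator {t. \<epsilon> < \<bar>t\<bar>} t / t - t / (t\<^sup>2 + \<epsilon>\<^sup>2)\<bar> \<le> \<epsilon> / (t\<^sup>2 + \<epsilon>\<^sup>2)"
proof -
  have pos: "t\<^sup>2 + \<epsilon>\<^sup>2 > 0" using assms by (intro add_nonneg_pos) auto
  have 1: "\<bar>0 / t - t / (t\<^sup>2 + \<epsilon>\<^sup>2)\<bar> \<le> \<epsilon> / (t\<^sup>2 + \<epsilon>\<^sup>2)" if "\<bar>t\<bar> \<le> \<epsilon>"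
    using that pos by (simp add: abs_div divide_right_mono)
  have 2: "\<bar>1 / t - t / (t\<^sup>2 + \<epsilon>\<^sup>2)\<bar> \<le> \<epsilon> / (t\<^sup>2 + \<epsilon>\<^sup>2)" if "\<epsilon> \<le> \<bar>t\<bar>"
  proof -
    have t: "\<bar>t\<bar> > 0" using that assms by linarith
    have "1 / t - t / (t\<^sup>2 + \<epsilon>\<^sup>2) = (\<epsilon> / t) * (\<epsilon> / (t\<^sup>2 + \<epsilon>\<^sup>2))"
      using pos t by (simp add: divide_simps) (simp add: power2_eq_square algebra_simps)
    moreover have "\<bar>\<epsilon> / t\<bar> \<le> 1" using that t assms by (simp add: divide_simps)
    moreover have "\<epsilon> / (t\<^sup>2 + \<epsilon>\<^sup>2) \<ge> 0" using assms by simp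
    ultimately show ?thesis
      by (metis abs_ge_zero abs_mult abs_of_nonneg mult_left_le_one_le)
  qed
  show "\<bar>indicator {t. \<epsilon> \<le> \<bar>t\<bar>} t / t - t / (t\<^sup>2 + \<epsilon>\<^sup>2)\<bar> \<le> \<epsilon> / (t\<^sup>2 + \<epsilon>\<^sup>2)"
    using 1 2 by (cases "\<epsilon> \<le> \<bar>t\<bar>") auto
  show "\<bar>indicator {t. \<epsilon> < \<bar>t\<bar>} t / t - t / (t\<^sup>2 + \<epsilon>\<^sup>2)\<bar> \<le> \<epsilon> / (t\<^sup>2 + \<epsilon>\<^sup>2)"
    using 1 2 by (cases "\<epsilon> < \<bar>t\<bar>") auto
qed

text \<open>The truncated kernel is the part of \<open>1/t\<close> with \<open>\<epsilon> \<le> \<bar>t\<bar>\<close> minus the part with \<open>N < \<bar>t\<bar>\<close>. Each is a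
  conjugate Poisson kernel up to a Poisson kernel, that is, up to the real part of the same
  Cauchy integral.\<close>

lemma trunc_hilbert_le_cauchy_ext:
  assumes f: "cont_compact_supp f" "\<And>t. f t \<ge> (0::real)" and \<epsilon>: "0 < \<epsilon>" "\<epsilon> \<le> N"
  shows "\<bar>trunc_hilbert \<epsilon> N f s\<bar>
    \<le> 2 * (norm (cauchy_ext f (Complex s \<epsilon>)) + norm (cauchy_ext f (Complex s N)))"
proof -
  let ?Q = "\<lambda>y t. (s - t) / ((s - t)\<^sup>2 + y\<^sup>2)" and ?P = "\<lambda>y t. y / ((s - t)\<^sup>2 + y\<^sup>2)"
  have N: "N > 0" using \<epsilon> by simp
  note RI = Re_Im_cauchy_ext[OF f(1)]
  note i[simp] = RI(3)[OF \<epsilon>(1)] RI(4)[OF \<epsilon>(1)] RI(3)[OF N] RI(4)[OF N]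
  have intH: "integrable lborel (\<lambda>t. hilbert_kernel \<epsilon> N (s - t) * f t)"
    using trunc_hilbert_integrable[OF \<epsilon>(1) f(1)] by simp
  have pw: "\<bar>hilbert_kernel \<epsilon> N (s - t) * f t - (f t * ?Q \<epsilon> t - f t * ?Q N t)\<bar> \<le> f t * ?P \<epsilon> t + f t * ?P N t" for t
  proof -
    have "hilbert_kernel \<epsilon> N (s - t) = indicator {t. \<epsilon> \<le> \<bar>t\<bar>} (s - t) / (s - t) - indicator {t. N < \<bar>t\<bar>} (s - t) / (s - t)"
      using \<epsilon> by (auto simp: hilbert_kernel_def indicator_def)
    then have "\<bar>hilbert_kernel \<epsilon> N (s - t) - (?Q \<epsilon> t - ?Q N t)\<bar> \<le> ?P \<epsilon> t + ?P N t"
      using one_div_minus_conjugate_Poisson(1)[OF \<epsilon>(1), of "s - t"]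
        one_div_minus_conjugate_Poisson(2)[OF N, of "s - t"] by linarith
    then have "f t * \<bar>hilbert_kernel \<epsilon> N (s - t) - (?Q \<epsilon> t - ?Q N t)\<bar> \<le> f t * (?P \<epsilon> t + ?P N t)"
      by (intro mult_left_mono f(2))
    also have "f t * \<bar>hilbert_kernel \<epsilon> N (s - t) - (?Q \<epsilon> t - ?Q N t)\<bar>
        = \<bar>f t * (hilbert_kernel \<epsilon> N (s - t) - (?Q \<epsilon> t - ?Q N t))\<bar>"
      using f(2) by (simp add: abs_mult)
    also have "f t * (hilbert_kernel \<epsilon> N (s - t) - (?Q \<epsilon> t - ?Q N t))
        = hilbert_kernel \<epsilon> N (s - t) * f t - (f t * ?Q \<epsilon> t - f t * ?Q N t)"
      by (simp only: right_diff_distrib mult.commute)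
    finally show ?thesis by (simp only: distrib_left)
  qed
  have aux: "\<bar>integral\<^sup>L lborel A - (integral\<^sup>L lborel B1 - integral\<^sup>L lborel B2)\<bar>
      \<le> integral\<^sup>L lborel P1 + integral\<^sup>L lborel P2"
    if [simp]: "integrable lborel A" "integrable lborel B1" "integrable lborel B2"
      "integrable lborel P1" "integrable lborel P2"
      and le: "\<And>t. \<bar>A t - (B1 t - B2 t)\<bar> \<le> P1 t + P2 t" for A B1 B2 P1 P2 :: "real \<Rightarrow> real"
  proof -
    have "\<bar>\<integral>t. A t - (B1 t - B2 t) \<partial>lborel\<bar> \<le> (\<integral>t. P1 t + P2 t \<partial>lborel)"
      by (intro order_trans[OF integral_abs_bound] integral_mono le) auto
    then show ?thesis by simp
  qed
  have "\<bar>trunc_hilbert \<epsilon> N f s - ((\<integral>t. f t * ?Q \<epsilon> t \<partial>lborel) - (\<integral>t. f t * ?Q N t \<partial>lborel))\<bar>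
     \<le> (\<integral>t. f t * ?P \<epsilon> t \<partial>lborel) + (\<integral>t. f t * ?P N t \<partial>lborel)"
    unfolding trunc_hilbert_def real_scaleR_def by (intro aux intH i pw)
  then have "\<bar>trunc_hilbert \<epsilon> N f s - (Im (cauchy_ext f (Complex s \<epsilon>)) - Im (cauchy_ext f (Complex s N)))\<bar>
     \<le> Re (cauchy_ext f (Complex s \<epsilon>)) + Re (cauchy_ext f (Complex s N))"
    unfolding RI(1)[OF \<epsilon>(1)] RI(2)[OF \<epsilon>(1)] RI(1)[OF N] RI(2)[OF N] .
  then show ?thesis unfolding distrib_left
    using abs_Re_le_cmod[of "cauchy_ext f (Complex s \<epsilon>)"] abs_Re_le_cmod[of "cauchy_ext f (Complex s N)"]
      abs_Im_le_cmod[of "cauchy_ext f (Complex s \<epsilon>)"] abs_Im_le_cmod[of "cauchy_ext f (Complex s N)"] by linarith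
qed

lemma trunc_hilbert_add:
  fixes f g :: "real \<Rightarrow> 'b::euclidean_space"
  assumes "\<epsilon> > 0" "cont_compact_supp f" "cont_compact_supp g"
  shows "trunc_hilbert \<epsilon> N (\<lambda>t. f t + g t) s = trunc_hilbert \<epsilon> N f s + trunc_hilbert \<epsilon> N g s"
  unfolding trunc_hilbert_def scaleR_add_right
  by (intro Bochner_Integration.integral_add trunc_hilbert_integrable assms)

lemma trunc_hilbert_linear_image:
  fixes f :: "real \<Rightarrow> 'b::euclidean_space" and L :: "'b \<Rightarrow> 'c::euclidean_space"
  assumes "bounded_linear L" "\<epsilon> > 0" "cont_compact_supp f"
  shows "trunc_hilbert \<epsilon> N (\<lambda>t. L (f t)) s = L (trunc_hilbert \<epsilon> N f s)"
proof -
  interpret bounded_linear L by fact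
  show ?thesis unfolding trunc_hilbert_def scaleR[symmetric]
    by (intro integral_bounded_linear assms trunc_hilbert_integrable)
qed

lemma cont_compact_supp_linear_image:
  assumes "bounded_linear L" "cont_compact_supp f"
  shows "cont_compact_supp (\<lambda>t. L (f t))"
proof -
  interpret bounded_linear L by fact
  obtain M where "continuous_on UNIV f" "\<And>t. M < \<bar>t\<bar> \<Longrightarrow> f t = 0"
    using assms(2) by (auto simp: cont_compact_supp_def)
  then show ?thesis using continuous_on[of UNIV f] zero unfolding cont_compact_supp_def by metis
qed

lemma cont_compact_supp_lborel_integrable:
  fixes f :: "real \<Rightarrow> 'b::euclidean_space"
  assumes "cont_compact_supp f"
  shows "integrable lborel f"
proof -
  obtain M where M: "M > 0" "continuous_on UNIV f" "\<And>t. t \<notin> {-M..M} \<Longrightarrow> f t = 0"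
    using assms by (auto elim: cont_compact_supp_E)
  show ?thesis
    by (rule cont_compact_supp_integrable(1)[OF continuous_on_subset[OF M(2) subset_UNIV] M(3)])
qed

lemma cont_compact_supp_compose:
  assumes "cont_compact_supp f" "continuous_on UNIV h" "h 0 = 0"
  shows "cont_compact_supp (\<lambda>t. h (f t))"
proof -
  obtain M where "continuous_on UNIV f" "\<And>t. M < \<bar>t\<bar> \<Longrightarrow> f t = 0"
    using assms(1) by (auto simp: cont_compact_supp_def)
  then show ?thesis using continuous_on_compose2[OF assms(2)] assms(3) unfolding cont_compact_supp_def
    by (metis subset_UNIV)
qed

lemma trunc_hilbert_measurable [measurable]:
  fixes f :: "real \<Rightarrow> 'b::euclidean_space"
  assumes "\<epsilon> > 0" "cont_compact_supp f"
  shows "trunc_hilbert \<epsilon> N f \<in> borel_measurable borel"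
  using cont_compact_supp_measurable[OF cont_compact_supp_trunc_hilbert[OF assms]] .

lemma trunc_hilbert_Lp_nonneg:
  assumes p: "1 < p" "p < 3"
  obtains C where "C \<ge> 0" "\<And>f \<epsilon> N. cont_compact_supp f \<Longrightarrow> (\<And>t. f t \<ge> (0::real)) \<Longrightarrow> 0 < \<epsilon> \<Longrightarrow> \<epsilon> \<le> N \<Longrightarrow>
    Lp_mass lborel p (trunc_hilbert \<epsilon> N f) \<le> ennreal C * Lp_mass lborel p f"
proof -
  obtain C where C: "C \<ge> 0" "\<And>f y. cont_compact_supp f \<Longrightarrow> (\<And>t. f t \<ge> 0) \<Longrightarrow> y > 0 \<Longrightarrow>
    (\<integral>\<^sup>+x. ennreal (norm (cauchy_ext f (Complex x y)) powr p) \<partial>lborel)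
    \<le> ennreal C * (\<integral>\<^sup>+t. ennreal (f t powr p) \<partial>lborel)"
    using nn_integral_cauchy_ext_le[OF p] by blast
  have "Lp_mass lborel p (trunc_hilbert \<epsilon> N f) \<le> ennreal (2 powr p * 2 powr p * (2 * C)) * Lp_mass lborel p f"
    if f: "cont_compact_supp f" "\<And>t. f t \<ge> (0::real)" and \<epsilon>: "0 < \<epsilon>" "\<epsilon> \<le> N" for f \<epsilon> N
  proof -
    note [measurable] = cont_compact_supp_measurable[OF f(1)]
    let ?F = "\<lambda>y x. 2 * cauchy_ext f (Complex x y)"
    have meas[measurable]: "?F y \<in> borel_measurable lborel" for y
      unfolding cauchy_ext_def Complex_eq by measurable
    have m: "Lp_mass lborel p (?F y) \<le> ennreal (2 powr p) * (ennreal C * Lp_mass lborel p f)" if "y > 0" for y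
    proof -
      have "Lp_mass lborel p (?F y) = ennreal (2 powr p) * Lp_mass lborel p (\<lambda>x. cauchy_ext f (Complex x y))"
        by (rule Lp_mass_scale) (auto simp: norm_mult cauchy_ext_def Complex_eq)
      also have "Lp_mass lborel p (\<lambda>x. cauchy_ext f (Complex x y)) \<le> ennreal C * Lp_mass lborel p f"
        using C(2)[OF f that] f(2) by (simp add: Lp_mass_def)
      finally show ?thesis by (simp add: mult_left_mono)
    qed
    have "Lp_mass lborel p (trunc_hilbert \<epsilon> N f)
      \<le> ennreal (2 powr p) * (Lp_mass lborel p (?F \<epsilon>) + Lp_mass lborel p (?F N))"
      using trunc_hilbert_le_cauchy_ext[OF f \<epsilon>] p
      by (intro Lp_mass_norm_add_le) (auto simp: norm_mult)
    also have "\<dots> \<le> ennreal (2 powr p) * (ennreal (2 powr p) * (ennreal C * Lp_mass lborel p f)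
        + ennreal (2 powr p) * (ennreal C * Lp_mass lborel p f))"
      using \<epsilon> by (intro mult_left_mono add_mono m) auto
    also have "\<dots> = ennreal (2 powr p * 2 powr p * (2 * C)) * Lp_mass lborel p f"
      using C(1) by (simp add: ennreal_mult mult_2[symmetric] mult_ac)
    finally show ?thesis .
  qed
  then show thesis using that[of "2 powr p * 2 powr p * (2 * C)"] C(1) by simp
qed

lemma trunc_hilbert_Lp_real_below_3:
  assumes p: "1 < p" "p < 3"
  obtains C where "C \<ge> 0" "\<And>(f::real\<Rightarrow>real) \<epsilon> N. cont_compact_supp f \<Longrightarrow> 0 < \<epsilon> \<Longrightarrow> \<epsilon> \<le> N \<Longrightarrow>
    Lp_mass lborel p (trunc_hilbert \<epsilon> N f) \<le> ennreal C * Lp_mass lborel p f"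
proof -
  obtain C where C: "C \<ge> 0" "\<And>f \<epsilon> N. cont_compact_supp f \<Longrightarrow> (\<And>t. f t \<ge> (0::real)) \<Longrightarrow> 0 < \<epsilon> \<Longrightarrow> \<epsilon> \<le> N \<Longrightarrow>
    Lp_mass lborel p (trunc_hilbert \<epsilon> N f) \<le> ennreal C * Lp_mass lborel p f"
    using trunc_hilbert_Lp_nonneg[OF p] by blast
  have "Lp_mass lborel p (trunc_hilbert \<epsilon> N f) \<le> ennreal (2 powr p * (2 * C)) * Lp_mass lborel p f"
    if f: "cont_compact_supp f" and \<epsilon>: "0 < \<epsilon>" "\<epsilon> \<le> N" for f :: "real \<Rightarrow> real" and \<epsilon> N
  proof -
    let ?p = "\<lambda>t. max (f t) 0" and ?n = "\<lambda>t. max (- f t) 0"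
    have pn: "cont_compact_supp ?p" "cont_compact_supp ?n"
      by (intro cont_compact_supp_compose[OF f, of "\<lambda>x. max x 0"] cont_compact_supp_compose[OF f, of "\<lambda>x. max (-x) 0"] continuous_intros; simp)+
    have m: "Lp_mass lborel p (trunc_hilbert \<epsilon> N g) \<le> ennreal C * Lp_mass lborel p f"
      if "g = ?p \<or> g = ?n" for g
    proof -
      have "Lp_mass lborel p (trunc_hilbert \<epsilon> N g) \<le> ennreal C * Lp_mass lborel p g"
        using that pn by (intro C(2) \<epsilon>) auto
      also have "\<dots> \<le> ennreal C * Lp_mass lborel p f"
        using that p by (intro mult_left_mono Lp_mass_mono) auto
      finally show ?thesis .
    qed
    have "trunc_hilbert \<epsilon> N ?p s = trunc_hilbert \<epsilon> N f s + trunc_hilbert \<epsilon> N ?n s" for s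
    proof -
      have "(\<lambda>t. f t + ?n t) = ?p" by (auto simp: max_def)
      then show ?thesis using trunc_hilbert_add[OF \<epsilon>(1) f pn(2), of N s] by simp
    qed
    then have eq: "trunc_hilbert \<epsilon> N f s = trunc_hilbert \<epsilon> N ?p s - trunc_hilbert \<epsilon> N ?n s" for s
      by simp
    have "Lp_mass lborel p (trunc_hilbert \<epsilon> N f)
      \<le> ennreal (2 powr p) * (Lp_mass lborel p (trunc_hilbert \<epsilon> N ?p) + Lp_mass lborel p (trunc_hilbert \<epsilon> N ?n))"
      using p unfolding eq by (intro Lp_mass_norm_add_le) (auto intro!: trunc_hilbert_measurable pn \<epsilon>)
    also have "\<dots> \<le> ennreal (2 powr p) * (ennreal C * Lp_mass lborel p f + ennreal C * Lp_mass lborel p f)"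
      by (intro mult_left_mono add_mono m) auto
    also have "\<dots> = ennreal (2 powr p * (2 * C)) * Lp_mass lborel p f"
      using C(1) by (simp add: ennreal_mult mult_2[symmetric] mult_ac)
    finally show ?thesis .
  qed
  then show thesis using that[of "2 powr p * (2 * C)"] C(1) by simp
qed

text \<open>The kernel is odd. All functions are bounded with compact support, so Fubini's theorem applies.\<close>

lemma trunc_hilbert_antisymmetric:
  fixes f g :: "real \<Rightarrow> real"
  assumes \<epsilon>: "0 < \<epsilon>" and f: "cont_compact_supp f" and g: "cont_compact_supp g"
  shows "(\<integral>s. trunc_hilbert \<epsilon> N f s * g s \<partial>lborel) = - (\<integral>s. f s * trunc_hilbert \<epsilon> N g s \<partial>lborel)"
proof -
  note [measurable] = cont_compact_supp_measurable[OF f] cont_compact_supp_measurable[OF g]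
  let ?h = "\<lambda>s t. hilbert_kernel \<epsilon> N (s - t) * f t * g s"
  obtain M where M: "M > 0" "continuous_on UNIV f" "\<And>t. t \<notin> {-M..M} \<Longrightarrow> f t = 0"
    using f by (auto elim: cont_compact_supp_E)
  obtain M' where M': "M' > 0" "continuous_on UNIV g" "\<And>t. t \<notin> {-M'..M'} \<Longrightarrow> g t = 0"
    using g by (auto elim: cont_compact_supp_E)
  obtain B where B: "B > 0" "\<And>t. norm (f t) \<le> B" using f cont_compact_supp_bounded by blast
  obtain B' where B': "B' > 0" "\<And>t. norm (g t) \<le> B'" using g cont_compact_supp_bounded by blast
  have int: "integrable (lborel \<Otimes>\<^sub>M lborel) (case_prod ?h)"
  proof (rule Bochner_Integration.integrable_bound)
    have "emeasure (lborel \<Otimes>\<^sub>M lborel) ({-M'..M'} \<times> {-M..M}) < \<infinity>"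
      by (subst lborel.emeasure_pair_measure_Times) (auto simp: emeasure_lborel_Icc_eq ennreal_mult_less_top)
    then show "integrable (lborel \<Otimes>\<^sub>M lborel) (\<lambda>z. (1/\<epsilon> * B * B') * indicator ({-M'..M'} \<times> {-M..M}) z :: real)"
      by (intro integrable_mult_right integrable_real_indicator) auto
    show "AE z in lborel \<Otimes>\<^sub>M lborel. norm (case_prod ?h z) \<le> norm ((1/\<epsilon> * B * B') * indicator ({-M'..M'} \<times> {-M..M}) z :: real)"
    proof (intro AE_I2)
      fix z :: "real \<times> real"
      show "norm (case_prod ?h z) \<le> norm ((1/\<epsilon> * B * B') * indicator ({-M'..M'} \<times> {-M..M}) z :: real)"
      proof (cases "z \<in> {-M'..M'} \<times> {-M..M}")
        case True
        have "norm (case_prod ?h z) \<le> 1/\<epsilon> * B * B'"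
          unfolding case_prod_beta norm_mult using \<epsilon> B(1) hilbert_kernel_bound'[OF \<epsilon>]
          by (intro mult_mono B(2) B'(2)) auto
        then show ?thesis using True \<epsilon> B B' by simp
      next
        case False
        then have "case_prod ?h z = 0" using M(3) M'(3) by (cases z) auto
        then show ?thesis by simp
      qed
    qed
  qed measurable
  have "(\<integral>s. trunc_hilbert \<epsilon> N f s * g s \<partial>lborel) = (\<integral>s. \<integral>t. ?h s t \<partial>lborel \<partial>lborel)"
    by (simp add: trunc_hilbert_def)
  also have "\<dots> = (\<integral>t. \<integral>s. ?h s t \<partial>lborel \<partial>lborel)"
    by (rule lborel_pair.Fubini_integral[OF int, symmetric])
  also have "\<dots> = (\<integral>t. - (f t * trunc_hilbert \<epsilon> N g t) \<partial>lborel)"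
  proof (intro Bochner_Integration.integral_cong refl)
    fix t
    have "?h s t = (- f t) * (hilbert_kernel \<epsilon> N (t - s) * g s)" for s
      using hilbert_kernel_minus[of \<epsilon> N "t - s"] by simp
    then show "(\<integral>s. ?h s t \<partial>lborel) = - (f t * trunc_hilbert \<epsilon> N g t)"
      by (simp add: trunc_hilbert_def)
  qed
  finally show ?thesis by simp
qed

text \<open>Absorbs a small multiple of \<open>X\<close> into the left-hand side, which is legitimate only if \<open>X\<close> is finite.\<close>

lemma ennreal_le_absorb:
  assumes "X \<le> A + ennreal c * X" "X < top" "0 \<le> c" "c \<le> 1/2"
  shows "X \<le> 2 * A"
proof (cases "A = top")
  case False
  then obtain a x where ax: "A = ennreal a" "X = ennreal x" "a \<ge> 0" "x \<ge> 0"
    using assms(2) by (cases A; cases X) auto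
  have "x \<le> a + c * x"
    using assms(1,3) ax by (simp add: ennreal_mult[symmetric] ennreal_plus[symmetric] del: ennreal_plus)
  moreover have "c * x \<le> 1/2 * x" using assms(4) ax by (intro mult_right_mono)
  ultimately have "x \<le> 2 * a" by linarith
  then show ?thesis using ax by (metis ennreal_leI ennreal_mult ennreal_numeral zero_le_numeral)
qed (simp add: ennreal_mult_top)

text \<open>Duality, without computing a dual norm. With \<open>h\<close> the truncated Hilbert transform of \<open>f\<close> and
  \<open>g = sgn h \<bar>h\<bar>\<close> to the power \<open>p - 1\<close>, the integral of \<open>\<bar>h\<bar>\<^sup>p = h g\<close> is minus that of \<open>f\<close> times the
  transform of \<open>g\<close>. Young's inequality splits this product, and the known bound for the conjugate
  exponent \<open>q \<in> (1, 3)\<close> turns the second part into a multiple of the integral of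
  \<open>\<bar>g\<bar>\<^sup>q = \<bar>h\<bar>\<^sup>p\<close>. The factor \<open>d\<close> makes this multiple at most one half.\<close>

lemma trunc_hilbert_Lp_real_from_3:
  assumes p: "3 \<le> p"
  obtains C where "C \<ge> 0" "\<And>(f::real\<Rightarrow>real) \<epsilon> N. cont_compact_supp f \<Longrightarrow> 0 < \<epsilon> \<Longrightarrow> \<epsilon> \<le> N \<Longrightarrow>
    Lp_mass lborel p (trunc_hilbert \<epsilon> N f) \<le> ennreal C * Lp_mass lborel p f"
proof -
  define q where "q = p / (p - 1)"
  have q: "1 < q" "q < 3" using p by (auto simp: q_def field_simps)
  have pq: "(p - 1) * q = p" using p by (simp add: q_def)
  obtain C where C: "C \<ge> 0" "\<And>(f::real\<Rightarrow>real) \<epsilon> N. cont_compact_supp f \<Longrightarrow> 0 < \<epsilon> \<Longrightarrow> \<epsilon> \<le> N \<Longrightarrow>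
    Lp_mass lborel q (trunc_hilbert \<epsilon> N f) \<le> ennreal C * Lp_mass lborel q f"
    using trunc_hilbert_Lp_real_below_3[OF q] by blast
  \<comment> \<open>chosen so that \<open>d\<^sup>q C \<le> 1/2\<close>; adding 1 to \<open>C\<close> keeps the denominator positive\<close>
  define d where "d = (1 / (2 * (C + 1))) powr (1 / q)"
  have d: "d > 0" using C(1) by (simp add: d_def)
  have dq: "d powr q = 1 / (2 * (C + 1))" using C(1) q by (simp add: d_def powr_powr)
  have dC: "d powr q * C \<le> 1/2" unfolding dq using C(1) by (simp add: field_simps)
  have "Lp_mass lborel p (trunc_hilbert \<epsilon> N f) \<le> ennreal (2 * (1 / d) powr p) * Lp_mass lborel p f"
    if f: "cont_compact_supp f" and \<epsilon>: "0 < \<epsilon>" "\<epsilon> \<le> N" for f :: "real \<Rightarrow> real" and \<epsilon> N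
  proof -
    define h where "h = trunc_hilbert \<epsilon> N f"
    have h: "cont_compact_supp h" unfolding h_def by (rule cont_compact_supp_trunc_hilbert[OF \<epsilon>(1) f])
    define g where "g t = sgn (h t) * \<bar>h t\<bar> powr (p - 1)" for t
    have g: "cont_compact_supp g"
    proof -
      \<comment> \<open>the second form exhibits continuity at zero, as \<open>p > 2\<close>\<close>
      have eq: "sgn x * \<bar>x\<bar> powr (p - 1) = x * \<bar>x\<bar> powr (p - 2)" for x :: real
      proof (cases "x = 0")
        case False
        have "\<bar>x\<bar> powr (p - 1) = \<bar>x\<bar> powr (1 + (p - 2))" by simp
        also have "\<dots> = \<bar>x\<bar> * \<bar>x\<bar> powr (p - 2)"
          unfolding powr_add using False by simp
        finally show ?thesis by (simp add: sgn_mult_abs mult.assoc[symmetric])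
      qed simp
      have "continuous_on UNIV (\<lambda>x::real. \<bar>x\<bar> powr (p - 2))"
        using p by (intro continuous_on_powr' continuous_intros) auto
      then have "continuous_on UNIV (\<lambda>x::real. sgn x * \<bar>x\<bar> powr (p - 1))"
        unfolding eq by (intro continuous_on_mult continuous_on_id)
      from cont_compact_supp_compose[OF h this] show ?thesis unfolding g_def by simp
    qed
    note [measurable] = cont_compact_supp_measurable[OF f] cont_compact_supp_measurable[OF h] cont_compact_supp_measurable[OF g]
      trunc_hilbert_measurable[OF \<epsilon>(1) g, of N]
    have hg: "h t * g t = \<bar>h t\<bar> powr p" for t
    proof (cases "h t = 0")
      case False
      have "h t * g t = \<bar>h t\<bar> powr 1 * \<bar>h t\<bar> powr (p - 1)"
        using False by (simp add: g_def mult.assoc[symmetric] abs_sgn[symmetric])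
      also have "\<dots> = \<bar>h t\<bar> powr p" unfolding powr_add[symmetric] by simp
      finally show ?thesis .
    qed (use p in simp)
    have gq: "\<bar>g t\<bar> powr q = \<bar>h t\<bar> powr p" for t
    proof (cases "h t = 0")
      case False
      then have "\<bar>g t\<bar> = \<bar>h t\<bar> powr (p - 1)" by (simp add: g_def abs_mult abs_sgn_eq)
      then show ?thesis by (simp only: powr_powr pq)
    qed (simp add: g_def)
    have "cont_compact_supp (\<lambda>t. \<bar>h t\<bar> powr p)"
    proof -
      obtain M where M: "\<And>t. M < \<bar>t\<bar> \<Longrightarrow> h t = 0" using h by (auto simp: cont_compact_supp_def)
      have "continuous_on UNIV (\<lambda>t. h t * g t)"
        using h g by (intro continuous_on_mult) (auto simp: cont_compact_supp_def)
      moreover have "\<forall>t. M < \<bar>t\<bar> \<longrightarrow> h t * g t = 0" using M by simp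
      ultimately have "cont_compact_supp (\<lambda>t. h t * g t)" unfolding cont_compact_supp_def by blast
      then show ?thesis unfolding hg .
    qed
    then have inth: "integrable lborel (\<lambda>t. \<bar>h t\<bar> powr p)"
      using cont_compact_supp_lborel_integrable by blast
    have hX: "Lp_mass lborel p h = ennreal (\<integral>t. \<bar>h t\<bar> powr p \<partial>lborel)"
      unfolding Lp_mass_def using inth by (simp add: nn_integral_eq_integral)
    have "(\<integral>t. \<bar>h t\<bar> powr p \<partial>lborel) = (\<integral>t. h t * g t \<partial>lborel)" by (simp add: hg)
    also have "\<dots> = - (\<integral>t. f t * trunc_hilbert \<epsilon> N g t \<partial>lborel)"
      unfolding h_def by (rule trunc_hilbert_antisymmetric[OF \<epsilon>(1) f g])
    finally have dual: "(\<integral>t. \<bar>h t\<bar> powr p \<partial>lborel) = - (\<integral>t. f t * trunc_hilbert \<epsilon> N g t \<partial>lborel)" .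
    have "Lp_mass lborel p h \<le> (\<integral>\<^sup>+t. ennreal (norm (f t * trunc_hilbert \<epsilon> N g t)) \<partial>lborel)"
    proof (cases "integrable lborel (\<lambda>t. f t * trunc_hilbert \<epsilon> N g t)")
      case True
      have "Lp_mass lborel p h \<le> ennreal (norm (\<integral>t. f t * trunc_hilbert \<epsilon> N g t \<partial>lborel))"
        unfolding hX dual by (intro ennreal_leI) simp
      also have "\<dots> \<le> (\<integral>\<^sup>+t. ennreal (norm (f t * trunc_hilbert \<epsilon> N g t)) \<partial>lborel)"
        by (rule integral_norm_bound_ennreal[OF True])
      finally show ?thesis .
    next
      case False
      then show ?thesis unfolding hX dual by (simp add: not_integrable_integral_eq)
    qed
    also have "\<dots> \<le> (\<integral>\<^sup>+t. ennreal (norm ((1 / d) * f t) powr p)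
        + ennreal (norm (d * trunc_hilbert \<epsilon> N g t) powr q) \<partial>lborel)"
    proof (intro nn_integral_mono)
      fix t
      have "norm (f t * trunc_hilbert \<epsilon> N g t) = norm ((1 / d) * f t) * norm (d * trunc_hilbert \<epsilon> N g t)"
        using d by (simp add: abs_mult)
      also have "\<dots> \<le> norm ((1 / d) * f t) powr p + norm (d * trunc_hilbert \<epsilon> N g t) powr q"
        using p by (intro mult_le_powr_add_conjugate) (auto simp: q_def)
      finally show "ennreal (norm (f t * trunc_hilbert \<epsilon> N g t)) \<le> ennreal (norm ((1 / d) * f t) powr p)
        + ennreal (norm (d * trunc_hilbert \<epsilon> N g t) powr q)"
        by (simp add: ennreal_plus[symmetric] ennreal_leI del: ennreal_plus)
    qed
    also have "\<dots> = Lp_mass lborel p (\<lambda>t. (1 / d) * f t) + Lp_mass lborel q (\<lambda>t. d * trunc_hilbert \<epsilon> N g t)"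
      unfolding Lp_mass_def by (intro nn_integral_add) measurable
    also have "Lp_mass lborel p (\<lambda>t. (1 / d) * f t) = ennreal ((1/d) powr p) * Lp_mass lborel p f"
      using d by (intro Lp_mass_scale) (auto simp: abs_mult)
    also have "Lp_mass lborel q (\<lambda>t. d * trunc_hilbert \<epsilon> N g t) = ennreal (d powr q) * Lp_mass lborel q (trunc_hilbert \<epsilon> N g)"
      using d by (intro Lp_mass_scale) (auto simp: abs_mult)
    also have "Lp_mass lborel q (trunc_hilbert \<epsilon> N g) \<le> ennreal C * Lp_mass lborel q g"
      by (intro C(2) g \<epsilon>)
    also have "Lp_mass lborel q g = Lp_mass lborel p h" by (simp add: Lp_mass_def gq)
    finally have "Lp_mass lborel p h \<le> ennreal ((1/d) powr p) * Lp_mass lborel p f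
       + ennreal (d powr q) * (ennreal C * Lp_mass lborel p h)"
      by (simp add: add_left_mono mult_left_mono)
    then have "Lp_mass lborel p h \<le> ennreal ((1/d) powr p) * Lp_mass lborel p f
       + ennreal (d powr q * C) * Lp_mass lborel p h"
      using C(1) by (simp add: ennreal_mult mult.assoc)
    then have "Lp_mass lborel p h \<le> 2 * (ennreal ((1/d) powr p) * Lp_mass lborel p f)"
      by (rule ennreal_le_absorb) (use dC C(1) in \<open>simp_all add: hX\<close>)
    also have "\<dots> = ennreal (2 * (1/d) powr p) * Lp_mass lborel p f"
      by (simp add: ennreal_mult mult.assoc)
    finally show ?thesis by (simp add: h_def)
  qed
  then show thesis using that[of "2 * (1 / d) powr p"] by simp
qed

lemma trunc_hilbert_Lp:
  assumes p: "1 < p"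
  obtains C where "C > 0" "\<And>(f::real\<Rightarrow>complex) \<epsilon> N. cont_compact_supp f \<Longrightarrow> 0 < \<epsilon> \<Longrightarrow> \<epsilon> \<le> N \<Longrightarrow>
    Lp_mass lborel p (trunc_hilbert \<epsilon> N f) \<le> ennreal C * Lp_mass lborel p f"
proof -
  obtain C where C: "C \<ge> 0" "\<And>(f::real\<Rightarrow>real) \<epsilon> N. cont_compact_supp f \<Longrightarrow> 0 < \<epsilon> \<Longrightarrow> \<epsilon> \<le> N \<Longrightarrow>
    Lp_mass lborel p (trunc_hilbert \<epsilon> N f) \<le> ennreal C * Lp_mass lborel p f"
  proof (cases "p < 3")
    case True
    show thesis by (rule trunc_hilbert_Lp_real_below_3[OF p True]) (rule that)
  next
    case False
    then have "3 \<le> p" by simp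
    show thesis by (rule trunc_hilbert_Lp_real_from_3[OF \<open>3 \<le> p\<close>]) (rule that)
  qed
  have "Lp_mass lborel p (trunc_hilbert \<epsilon> N f) \<le> ennreal (2 powr p * (2 * C) + 1) * Lp_mass lborel p f"
    if f: "cont_compact_supp f" and \<epsilon>: "0 < \<epsilon>" "\<epsilon> \<le> N" for f :: "real \<Rightarrow> complex" and \<epsilon> N
  proof -
    let ?p = "\<lambda>t. Re (f t)" and ?n = "\<lambda>t. Im (f t)"
    note pn = cont_compact_supp_linear_image[OF bounded_linear_Re f] cont_compact_supp_linear_image[OF bounded_linear_Im f]
    have m: "Lp_mass lborel p (trunc_hilbert \<epsilon> N g) \<le> ennreal C * Lp_mass lborel p f"
      if "g = ?p \<or> g = ?n" for g
    proof -
      have "Lp_mass lborel p (trunc_hilbert \<epsilon> N g) \<le> ennreal C * Lp_mass lborel p g"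
        using that pn by (intro C(2) \<epsilon>) auto
      also have "\<dots> \<le> ennreal C * Lp_mass lborel p f"
        using that p by (intro mult_left_mono Lp_mass_mono) (auto simp: abs_Re_le_cmod abs_Im_le_cmod)
      finally show ?thesis .
    qed
    have le: "norm (trunc_hilbert \<epsilon> N f s) \<le> norm (trunc_hilbert \<epsilon> N ?p s) + norm (trunc_hilbert \<epsilon> N ?n s)" for s
      unfolding trunc_hilbert_linear_image[OF bounded_linear_Re \<epsilon>(1) f]
        trunc_hilbert_linear_image[OF bounded_linear_Im \<epsilon>(1) f] real_norm_def by (rule cmod_le)
    have "Lp_mass lborel p (trunc_hilbert \<epsilon> N f)
      \<le> ennreal (2 powr p) * (Lp_mass lborel p (trunc_hilbert \<epsilon> N ?p) + Lp_mass lborel p (trunc_hilbert \<epsilon> N ?n))"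
      using p by (intro Lp_mass_norm_add_le le) (auto intro!: trunc_hilbert_measurable pn \<epsilon>)
    also have "\<dots> \<le> ennreal (2 powr p) * (ennreal C * Lp_mass lborel p f + ennreal C * Lp_mass lborel p f)"
      by (intro mult_left_mono add_mono m) auto
    also have "\<dots> = ennreal (2 powr p * (2 * C)) * Lp_mass lborel p f"
      using C(1) by (simp add: ennreal_mult mult_2[symmetric] mult_ac)
    also have "\<dots> \<le> ennreal (2 powr p * (2 * C) + 1) * Lp_mass lborel p f"
      using C(1) by (intro mult_right_mono ennreal_leI) auto
    finally show ?thesis .
  qed
  then show thesis using that[of "2 powr p * (2 * C) + 1"] C(1) by (simp add: add_nonneg_pos)
qed

section \<open>Hilbert transforms along a direction\<close>

text \<open>The truncated Hilbert transform along the line through \<open>x\<close> in the direction \<open>z\<close>. The direction is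
  not normalized: all vectors of the unit ball will be used.\<close>

definition dir_hilbert ::
    "real \<Rightarrow> real \<Rightarrow> 'a::euclidean_space \<Rightarrow> ('a \<Rightarrow> complex) \<Rightarrow> 'a \<Rightarrow> complex" where
  "dir_hilbert \<epsilon> N z f x = (\<integral>t. hilbert_kernel \<epsilon> N t *\<^sub>R f (x - t *\<^sub>R z) \<partial>lborel)"

lemma nn_integral_lborel_translate:
  fixes c :: "'a::euclidean_space"
  assumes [measurable]: "h \<in> borel_measurable borel"
  shows "(\<integral>\<^sup>+x. h (x + c) \<partial>lborel) = (\<integral>\<^sup>+x. h x \<partial>lborel)"
proof -
  have "(\<integral>\<^sup>+x. h x \<partial>lborel) = (\<integral>\<^sup>+x. h x \<partial>distr lborel borel ((+) c))"
    by (simp add: lborel_distr_plus)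
  also have "\<dots> = (\<integral>\<^sup>+x. h (c + x) \<partial>lborel)" by (subst nn_integral_distr) auto
  finally show ?thesis by (simp add: add.commute)
qed

lemma dir_hilbert_measurable_pair:
  fixes f :: "'a::euclidean_space \<Rightarrow> complex"
  assumes [measurable]: "f \<in> borel_measurable borel"
  shows "(\<lambda>(x, z). dir_hilbert \<epsilon> N z f x) \<in> borel_measurable (borel \<Otimes>\<^sub>M borel)"
  unfolding dir_hilbert_def by measurable

lemma dir_hilbert_measurable [measurable]:
  fixes f :: "'a::euclidean_space \<Rightarrow> complex"
  assumes [measurable]: "f \<in> borel_measurable borel"
  shows "dir_hilbert \<epsilon> N z f \<in> borel_measurable borel"
  unfolding dir_hilbert_def by measurable

text \<open>Integrating over a window of each line and then over all base points counts every point of space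
  with the length of the window. This replaces a rotation of coordinates.\<close>

lemma nn_integral_window:
  fixes h :: "'a::euclidean_space \<Rightarrow> ennreal" and z :: 'a
  assumes [measurable]: "h \<in> borel_measurable borel" and R: "0 \<le> R"
  shows "(\<integral>\<^sup>+x. \<integral>\<^sup>+s. indicator {-R..R} s * h (x + s *\<^sub>R z) \<partial>lborel \<partial>lborel)
    = ennreal (2 * R) * (\<integral>\<^sup>+x. h x \<partial>lborel)"
proof -
  have "(\<integral>\<^sup>+x. \<integral>\<^sup>+s. indicator {-R..R} s * h (x + s *\<^sub>R z) \<partial>lborel \<partial>lborel)
     = (\<integral>\<^sup>+s. \<integral>\<^sup>+x. indicator {-R..R} s * h (x + s *\<^sub>R z) \<partial>lborel \<partial>lborel)"
    by (rule lborel_pair.Fubini') measurable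
  also have "\<dots> = (\<integral>\<^sup>+s. indicator {-R..R} s * (\<integral>\<^sup>+x. h x \<partial>lborel) \<partial>lborel)"
    by (simp add: nn_integral_cmult nn_integral_lborel_translate)
  also have "\<dots> = ennreal (2 * R) * (\<integral>\<^sup>+x. h x \<partial>lborel)"
    using R by (simp add: nn_integral_multc)
  finally show ?thesis .
qed

text \<open>On the window \<open>\<bar>s\<bar> \<le> N\<close> the transform only sees the values of \<open>f\<close> with \<open>\<bar>s\<bar> \<le> 2 N\<close>, since the
  kernel is truncated at \<open>N\<close>. So \<open>f\<close> may be multiplied by a cutoff that is supported in
  \<open>\<bar>s\<bar> \<le> 3 N\<close> before the one-dimensional inequality is applied. The windows on the two sides have
  lengths \<open>2 N\<close> and \<open>6 N\<close>, hence the factor 3.\<close>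

lemma dir_hilbert_Lp:
  assumes p: "1 < p"
  obtains C where "C > 0" "\<And>(f::'a::euclidean_space\<Rightarrow>complex) \<epsilon> N z.
    continuous_on UNIV f \<Longrightarrow> 0 < \<epsilon> \<Longrightarrow> \<epsilon> \<le> N \<Longrightarrow>
    Lp_mass lborel p (dir_hilbert \<epsilon> N z f) \<le> ennreal C * Lp_mass lborel p f"
proof -
  obtain C where C: "C > 0" "\<And>(f::real\<Rightarrow>complex) \<epsilon> N. cont_compact_supp f \<Longrightarrow> 0 < \<epsilon> \<Longrightarrow> \<epsilon> \<le> N \<Longrightarrow>
    Lp_mass lborel p (trunc_hilbert \<epsilon> N f) \<le> ennreal C * Lp_mass lborel p f"
    using trunc_hilbert_Lp[OF p] by blast
  have "Lp_mass lborel p (dir_hilbert \<epsilon> N z f) \<le> ennreal (3 * C) * Lp_mass lborel p f"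
    if f: "continuous_on UNIV f" and \<epsilon>: "0 < \<epsilon>" "\<epsilon> \<le> N" for f :: "'a \<Rightarrow> complex" and \<epsilon> N z
  proof -
    have [measurable]: "f \<in> borel_measurable borel" using f by (rule borel_measurable_continuous_onI)
    have N: "N > 0" using \<epsilon> by simp
    define \<phi> where "\<phi> s = max 0 (min 1 (3 - \<bar>s\<bar> / N))" for s
    have \<phi>1: "\<phi> s = 1" if "\<bar>s\<bar> \<le> 2 * N" for s
    proof -
      have "\<bar>s\<bar> / N \<le> 2" using that N by (simp add: divide_le_eq)
      then show ?thesis unfolding \<phi>_def by linarith
    qed
    have \<phi>0: "\<phi> s = 0" if "3 * N < \<bar>s\<bar>" for s
    proof -
      have "\<bar>s\<bar> / N \<ge> 3" using that N by (simp add: le_divide_eq)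
      then show ?thesis unfolding \<phi>_def by linarith
    qed
    have \<phi>b: "0 \<le> \<phi> s" "\<phi> s \<le> 1" for s by (auto simp: \<phi>_def)
    have \<phi>c: "continuous_on UNIV \<phi>" unfolding \<phi>_def using N by (intro continuous_intros) auto
    let ?h = "\<lambda>x. ennreal (norm (dir_hilbert \<epsilon> N z f x) powr p)"
    have line: "(\<integral>\<^sup>+s. indicator {-N..N} s * ?h (x + s *\<^sub>R z) \<partial>lborel)
       \<le> ennreal C * (\<integral>\<^sup>+s. indicator {-(3*N)..3*N} s * ennreal (norm (f (x + s *\<^sub>R z)) powr p) \<partial>lborel)" for x
    proof -
      define g where "g s = \<phi> s *\<^sub>R f (x + s *\<^sub>R z)" for s
      have "continuous_on UNIV g" unfolding g_def
        by (intro continuous_intros \<phi>c continuous_on_compose2[OF f]) auto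
      then have g: "cont_compact_supp g" using \<phi>0 by (auto simp: cont_compact_supp_def g_def intro!: exI[of _ "3 * N"])
      have "trunc_hilbert \<epsilon> N g s = dir_hilbert \<epsilon> N z f (x + s *\<^sub>R z)" if s: "s \<in> {-N..N}" for s
      proof -
        have "hilbert_kernel \<epsilon> N t *\<^sub>R g (s - t) = hilbert_kernel \<epsilon> N t *\<^sub>R f (x + s *\<^sub>R z - t *\<^sub>R z)" for t
        proof (cases "\<bar>t\<bar> \<le> N")
          case True
          then have "\<phi> (s - t) = 1" using s by (intro \<phi>1) auto
          then show ?thesis by (simp add: g_def algebra_simps)
        qed (simp add: hilbert_kernel_def)
        then show ?thesis unfolding trunc_hilbert_eq dir_hilbert_def by presburger
      qed
      then have "(\<integral>\<^sup>+s. indicator {-N..N} s * ?h (x + s *\<^sub>R z) \<partial>lborel) \<le> Lp_mass lborel p (trunc_hilbert \<epsilon> N g)"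
        unfolding Lp_mass_def by (intro nn_integral_mono) (auto simp: indicator_def)
      also have "\<dots> \<le> ennreal C * Lp_mass lborel p g" by (intro C(2) g \<epsilon>)
      also have "Lp_mass lborel p g
          \<le> (\<integral>\<^sup>+s. indicator {-(3*N)..3*N} s * ennreal (norm (f (x + s *\<^sub>R z)) powr p) \<partial>lborel)"
        unfolding Lp_mass_def
      proof (intro nn_integral_mono)
        fix s
        have "norm (g s) \<le> norm (f (x + s *\<^sub>R z))"
          using \<phi>b[of s] by (simp add: g_def mult_left_le_one_le)
        then have "norm (g s) powr p \<le> norm (f (x + s *\<^sub>R z)) powr p" using p by (intro powr_mono2) auto
        then show "ennreal (norm (g s) powr p)
            \<le> indicator {-(3*N)..3*N} s * ennreal (norm (f (x + s *\<^sub>R z)) powr p)"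
          using \<phi>0[of s] by (cases "s \<in> {-(3*N)..3*N}") (auto simp: g_def ennreal_leI)
      qed
      finally show ?thesis by (simp add: mult_left_mono)
    qed
    have "ennreal (2 * N) * Lp_mass lborel p (dir_hilbert \<epsilon> N z f)
       = (\<integral>\<^sup>+x. \<integral>\<^sup>+s. indicator {-N..N} s * ?h (x + s *\<^sub>R z) \<partial>lborel \<partial>lborel)"
      using N unfolding Lp_mass_def by (intro nn_integral_window[symmetric]) auto
    also have "\<dots> \<le> (\<integral>\<^sup>+x. ennreal C * (\<integral>\<^sup>+s. indicator {-(3*N)..3*N} s * ennreal (norm (f (x + s *\<^sub>R z)) powr p) \<partial>lborel) \<partial>lborel)"
      by (intro nn_integral_mono line)
    also have "\<dots> = ennreal C * (\<integral>\<^sup>+x. \<integral>\<^sup>+s. indicator {-(3*N)..3*N} s * ennreal (norm (f (x + s *\<^sub>R z)) powr p) \<partial>lborel \<partial>lborel)"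
      by (intro nn_integral_cmult) measurable
    also have "(\<integral>\<^sup>+x. \<integral>\<^sup>+s. indicator {-(3*N)..3*N} s * ennreal (norm (f (x + s *\<^sub>R z)) powr p) \<partial>lborel \<partial>lborel)
       = ennreal (2 * (3 * N)) * Lp_mass lborel p f"
      using N unfolding Lp_mass_def by (intro nn_integral_window) auto
    finally have "ennreal (2 * N) * Lp_mass lborel p (dir_hilbert \<epsilon> N z f)
       \<le> ennreal (2 * N) * (ennreal (3 * C) * Lp_mass lborel p f)"
      using C(1) N by (simp add: ennreal_mult mult_ac)
    then show ?thesis using N
      by (simp add: ennreal_mult_le_mult_iff)
  qed
  then show thesis using that[of "3 * C"] C(1) by simp
qed

section \<open>The Riesz kernel as an average over directions\<close>

definition riesz_kernel :: "'a::euclidean_space \<Rightarrow> 'a \<Rightarrow> real" where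
  "riesz_kernel e y = (y \<bullet> e) / norm y ^ (DIM('a) + 1)"

text \<open>The ratio between the kernel that comes out of the averaging and the Riesz kernel. It is even,
  lies between 0 and 1, and tends to 1 as \<open>\<epsilon>\<close> tends to 0 and \<open>N\<close> to infinity.\<close>

definition riesz_weight :: "real \<Rightarrow> real \<Rightarrow> 'a::euclidean_space \<Rightarrow> real" where
  "riesz_weight \<epsilon> N y = max 0 ((norm y / max (norm y) \<epsilon>) ^ (DIM('a) + 1) - (norm y / N) ^ (DIM('a) + 1))"

lemma riesz_kernel_measurable [measurable]: "riesz_kernel e \<in> borel_measurable borel"
  unfolding riesz_kernel_def by measurable

lemma riesz_weight_measurable [measurable]: "riesz_weight \<epsilon> N \<in> borel_measurable borel"
  unfolding riesz_weight_def by measurable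

lemma integral_scaleR_substitution:
  fixes g :: "'a::euclidean_space \<Rightarrow> 'b::{banach,second_countable_topology}"
  assumes "t \<noteq> 0" and [measurable]: "g \<in> borel_measurable borel"
  shows "(\<integral>y. g y \<partial>lborel) = (\<bar>t\<bar> ^ DIM('a)) *\<^sub>R (\<integral>z. g (t *\<^sub>R z) \<partial>lborel)"
proof -
  have "(\<integral>y. g y \<partial>lborel) = (\<integral>y. g y \<partial>density (distr lborel borel (\<lambda>x::'a. 0 + t *\<^sub>R x)) (\<lambda>_. ennreal (\<bar>t\<bar>^DIM('a))))"
    using lborel_affine[OF assms(1), of "0::'a"] by simp
  also have "\<dots> = (\<integral>z. (\<bar>t\<bar>^DIM('a)) *\<^sub>R g (t *\<^sub>R z) \<partial>lborel)"
    by (simp add: integral_density integral_distr)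
  finally show ?thesis by simp
qed

lemma integral_two_sided_power:
  fixes a N :: real
  assumes a: "0 < a" "a \<le> N"
  shows "(\<integral>t. indicator {t. a \<le> \<bar>t\<bar> \<and> \<bar>t\<bar> \<le> N} t / \<bar>t\<bar> ^ (n + 2) \<partial>lborel)
    = 2 / real (n + 1) * ((1 / a) ^ (n + 1) - (1 / N) ^ (n + 1))"
proof -
  let ?f = "\<lambda>t::real. indicator {a..N} t * (1 / t ^ (n + 2))"
  have N: "N > 0" using a by simp
  have int: "integrable lborel ?f"
  proof -
    have "continuous_on {a..N} (\<lambda>t::real. 1 / t ^ (n + 2))"
      using a by (intro continuous_intros) auto
    from borel_integrable_compact[OF _ this] show ?thesis by simp
  qed
  have half: "(\<integral>t. ?f t \<partial>lborel) = (1 / real (n + 1)) * ((1 / a) ^ (n + 1) - (1 / N) ^ (n + 1))"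
  proof -
    let ?F = "\<lambda>t::real. - (1 / real (n + 1)) * (1 / t) ^ (n + 1)"
    have "(\<integral>t. (1 / t ^ (n + 2)) * indicator {a..N} t \<partial>lborel) = ?F N - ?F a"
    proof (rule integral_FTC_Icc_real[OF a(2)])
      fix t assume "a \<le> t" "t \<le> N"
      then have t: "t > 0" using a by simp
      show "(?F has_real_derivative 1 / t ^ (n + 2)) (at t)"
      proof -
        have "((\<lambda>t. 1 / t) has_real_derivative - (1 / t\<^sup>2)) (at t)"
          using t by (auto intro!: derivative_eq_intros simp: power2_eq_square)
        from DERIV_cmult[OF DERIV_power[OF this, of "n + 1"], of "- (1 / real (n + 1))"]
        have "(?F has_real_derivative - (1 / real (n + 1)) * (real (n + 1) * (- (1 / t\<^sup>2) * (1 / t) ^ n))) (at t)"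
          by (simp add: mult_ac)
        also have "- (1 / real (n + 1)) * (real (n + 1) * (- (1 / t\<^sup>2) * (1 / t) ^ n)) = 1 / t ^ (n + 2)"
          using t by (simp add: power_one_over power_add divide_simps power2_eq_square)
        finally show ?thesis .
      qed
      show "isCont (\<lambda>t. 1 / t ^ (n + 2)) t" using t by (intro continuous_intros) auto
    qed
    also have "?F N - ?F a = (1 / real (n + 1)) * ((1 / a) ^ (n + 1) - (1 / N) ^ (n + 1))"
      by (simp add: right_diff_distrib)
    finally show ?thesis by (simp add: mult.commute)
  qed
  have "(\<integral>t. indicator {t. a \<le> \<bar>t\<bar> \<and> \<bar>t\<bar> \<le> N} t / \<bar>t\<bar> ^ (n + 2) \<partial>lborel) = (\<integral>t. ?f t + ?f (0 + (-1) * t) \<partial>lborel)"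
  proof (intro Bochner_Integration.integral_cong refl)
    fix t
    show "indicator {t. a \<le> \<bar>t\<bar> \<and> \<bar>t\<bar> \<le> N} t / \<bar>t\<bar> ^ (n + 2) = ?f t + ?f (0 + (-1) * t)"
      using a by (cases "t \<ge> 0") (auto simp: indicator_def)
  qed
  also have "\<dots> = (\<integral>t. ?f t \<partial>lborel) + (\<integral>t. ?f (0 + (-1) * t) \<partial>lborel)"
    by (intro Bochner_Integration.integral_add int lborel_integrable_real_affine) auto
  also have "(\<integral>t. ?f (0 + (-1) * t) \<partial>lborel) = (\<integral>t. ?f t \<partial>lborel)"
    by (subst (2) lborel_integral_real_affine[where c="-1" and t=0]) auto
  finally show ?thesis unfolding half by simp
qed

text \<open>A vector \<open>y\<close> is of the form \<open>t z\<close> with \<open>z\<close> in the unit ball exactly if \<open>\<bar>t\<bar> \<ge> norm y\<close>. Integrating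
  the power of \<open>\<bar>t\<bar>\<close> over these \<open>t\<close> produces the homogeneity of the Riesz kernel; this is where
  averaging over a solid ball avoids polar coordinates.\<close>

lemma riesz_kernel_from_directions:
  fixes y e :: "'a::euclidean_space"
  assumes \<epsilon>: "0 < \<epsilon>" "\<epsilon> \<le> N" and y: "y \<noteq> 0"
  shows "(\<integral>t. indicator {t. norm y \<le> \<bar>t\<bar>} t * (y \<bullet> e) * indicator {t. \<epsilon> \<le> \<bar>t\<bar> \<and> \<bar>t\<bar> \<le> N} t / \<bar>t\<bar> ^ (DIM('a) + 2) \<partial>lborel)
    = 2 / real (DIM('a) + 1) * (riesz_kernel e y * riesz_weight \<epsilon> N y)"
proof -
  let ?n = "DIM('a)" and ?a = "max (norm y) \<epsilon>"
  have a: "?a > 0" using \<epsilon> by simp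
  have N: "N > 0" using \<epsilon> by simp
  have "(\<integral>t. indicator {t. norm y \<le> \<bar>t\<bar>} t * (y \<bullet> e) * indicator {t. \<epsilon> \<le> \<bar>t\<bar> \<and> \<bar>t\<bar> \<le> N} t / \<bar>t\<bar> ^ (?n + 2) \<partial>lborel)
     = (y \<bullet> e) * (\<integral>t. indicator {t. ?a \<le> \<bar>t\<bar> \<and> \<bar>t\<bar> \<le> N} t / \<bar>t\<bar> ^ (?n + 2) \<partial>lborel)"
    unfolding integral_mult_right_zero[symmetric]
    by (intro Bochner_Integration.integral_cong refl) (auto simp: indicator_def)
  also have "(\<integral>t. indicator {t. ?a \<le> \<bar>t\<bar> \<and> \<bar>t\<bar> \<le> N} t / \<bar>t\<bar> ^ (?n + 2) \<partial>lborel)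
     = 2 / real (?n + 1) * max 0 ((1 / ?a) ^ (?n + 1) - (1 / N) ^ (?n + 1))"
  proof (cases "?a \<le> N")
    case True
    have "(1 / N) ^ (?n + 1) \<le> (1 / ?a) ^ (?n + 1)"
      using True a by (intro power_mono divide_left_mono) auto
    then show ?thesis using integral_two_sided_power[OF a True, of ?n] by (simp add: max_def)
  next
    case False
    have "(1 / ?a) ^ (?n + 1) \<le> (1 / N) ^ (?n + 1)"
      using False N a by (intro power_mono divide_left_mono) auto
    moreover have "(\<lambda>t. indicator {t. ?a \<le> \<bar>t\<bar> \<and> \<bar>t\<bar> \<le> N} t / \<bar>t\<bar> ^ (?n + 2)) = (\<lambda>_. 0::real)"
      using False by (auto simp: indicator_def)
    ultimately show ?thesis by (simp only: integral_zero) simp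
  qed
  also have "max 0 ((1 / ?a) ^ (?n + 1) - (1 / N) ^ (?n + 1)) = riesz_weight \<epsilon> N y / norm y ^ (?n + 1)"
    unfolding riesz_weight_def using y
    by (subst max_divide_distrib_right) (simp add: diff_divide_distrib power_divide)
  finally show ?thesis by (simp add: riesz_kernel_def)
qed

text \<open>Fubini's theorem is used twice, before and after the substitution \<open>y = t z\<close> for fixed \<open>t\<close>. Both
  times the integrand is bounded and vanishes outside a product of a ball and an interval, and
  away from \<open>t = 0\<close>, thanks to the two truncations.\<close>

lemma average_dir_hilbert:
  fixes f :: "'a::euclidean_space \<Rightarrow> complex"
  assumes [measurable]: "f \<in> borel_measurable borel" and B: "\<And>x. norm (f x) \<le> B"
    and \<epsilon>: "0 < \<epsilon>" "\<epsilon> \<le> N"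
  shows "(\<integral>z. (indicator (cball 0 1) z * (z \<bullet> e)) *\<^sub>R dir_hilbert \<epsilon> N z f x \<partial>lborel)
    = (2 / real (DIM('a) + 1)) *\<^sub>R (\<integral>y. (riesz_kernel e y * riesz_weight \<epsilon> N y) *\<^sub>R f (x - y) \<partial>lborel)"
proof -
  let ?n = "DIM('a)"
  have N: "N > 0" using \<epsilon> by simp
  have B0: "B \<ge> 0" using B[of 0] norm_ge_zero order_trans by blast
  define H where "H z t = (indicator (cball 0 1) z * (z \<bullet> e) * hilbert_kernel \<epsilon> N t) *\<^sub>R f (x - t *\<^sub>R z)" for z t
  define G where "G y t = (indicator {t. norm y \<le> \<bar>t\<bar>} t * (y \<bullet> e) * indicator {t. \<epsilon> \<le> \<bar>t\<bar> \<and> \<bar>t\<bar> \<le> N} t / \<bar>t\<bar> ^ (?n + 2)) *\<^sub>R f (x - y)" for y t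
  have eqm: "borel_measurable (lborel \<Otimes>\<^sub>M lborel) = (borel_measurable (borel \<Otimes>\<^sub>M borel) :: ('a \<times> real \<Rightarrow> complex) set)"
    by (intro measurable_cong_sets sets_pair_measure_cong) auto
  have [measurable]: "cball (0::'a) 1 \<in> sets borel" by simp
  have [measurable]: "case_prod H \<in> borel_measurable (lborel \<Otimes>\<^sub>M lborel)" unfolding H_def eqm by measurable
  have [measurable]: "case_prod G \<in> borel_measurable (lborel \<Otimes>\<^sub>M lborel)" unfolding G_def eqm by measurable
  have box: "integrable (lborel \<Otimes>\<^sub>M lborel) (\<lambda>q. c * indicator (cball (0::'a) r \<times> {-N..N}) q :: real)" for c r
  proof -
    have "emeasure (lborel \<Otimes>\<^sub>M lborel) (cball (0::'a) r \<times> {-N..N}) < \<infinity>"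
      using emeasure_compact_finite[of "cball (0::'a) r"]
      by (subst lborel.emeasure_pair_measure_Times) (auto simp: emeasure_lborel_Icc_eq ennreal_mult_less_top)
    then show ?thesis by (intro integrable_mult_right integrable_real_indicator) auto
  qed
  have intH: "integrable (lborel \<Otimes>\<^sub>M lborel) (case_prod H)"
  proof (rule Bochner_Integration.integrable_bound[OF box[of "norm e * (1 / \<epsilon>) * B" 1]])
    show "AE q in lborel \<Otimes>\<^sub>M lborel. norm (case_prod H q) \<le> norm (norm e * (1 / \<epsilon>) * B * indicator (cball 0 1 \<times> {-N..N}) q :: real)"
    proof (intro AE_I2)
      fix q :: "'a \<times> real"
      obtain z t where q: "q = (z, t)" by (cases q)
      show "norm (case_prod H q) \<le> norm (norm e * (1 / \<epsilon>) * B * indicator (cball 0 1 \<times> {-N..N}) q :: real)"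
      proof (cases "q \<in> cball 0 1 \<times> {-N..N}")
        case True
        then have z: "norm z \<le> 1" by (simp add: q)
        have "\<bar>z \<bullet> e\<bar> \<le> 1 * norm e"
          by (rule order_trans[OF Cauchy_Schwarz_ineq2]) (use z in \<open>intro mult_right_mono, auto\<close>)
        then have "\<bar>z \<bullet> e\<bar> * \<bar>hilbert_kernel \<epsilon> N t\<bar> * norm (f (x - t *\<^sub>R z)) \<le> (norm e * (1 / \<epsilon>)) * B"
          using \<epsilon> by (intro mult_mono B hilbert_kernel_bound') auto
        then show ?thesis using True z B0 \<epsilon> by (simp add: H_def q abs_mult)
      next
        case False
        then have "case_prod H q = 0" by (auto simp: H_def q hilbert_kernel_def indicator_def)
        then show ?thesis by simp
      qed
    qed
  qed measurable
  have intG: "integrable (lborel \<Otimes>\<^sub>M lborel) (case_prod G)"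
  proof (rule Bochner_Integration.integrable_bound[OF box[of "(N * norm e) * (1 / \<epsilon> ^ (?n + 2)) * B" N]])
    show "AE q in lborel \<Otimes>\<^sub>M lborel. norm (case_prod G q) \<le> norm ((N * norm e) * (1 / \<epsilon> ^ (?n + 2)) * B * indicator (cball 0 N \<times> {-N..N}) q :: real)"
    proof (intro AE_I2)
      fix q :: "'a \<times> real"
      obtain y t where q: "q = (y, t)" by (cases q)
      show "norm (case_prod G q) \<le> norm ((N * norm e) * (1 / \<epsilon> ^ (?n + 2)) * B * indicator (cball 0 N \<times> {-N..N}) q :: real)"
      proof (cases "norm y \<le> \<bar>t\<bar> \<and> \<epsilon> \<le> \<bar>t\<bar> \<and> \<bar>t\<bar> \<le> N")
        case True
        then have y: "norm y \<le> N" by simp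
        have "\<bar>y \<bullet> e\<bar> \<le> N * norm e"
          by (rule order_trans[OF Cauchy_Schwarz_ineq2]) (use y in \<open>intro mult_right_mono, auto\<close>)
        moreover have "1 / \<bar>t\<bar> ^ (?n + 2) \<le> 1 / \<epsilon> ^ (?n + 2)"
          using True \<epsilon> by (intro divide_left_mono power_mono) auto
        ultimately have "\<bar>y \<bullet> e\<bar> * (1 / \<bar>t\<bar> ^ (?n + 2)) * norm (f (x - y)) \<le> (N * norm e) * (1 / \<epsilon> ^ (?n + 2)) * B"
          using \<epsilon> N by (intro mult_mono B) auto
        moreover have "norm (G y t) = \<bar>y \<bullet> e\<bar> * (1 / \<bar>t\<bar> ^ (?n + 2)) * norm (f (x - y))"
          using True by (simp add: G_def abs_mult)
        moreover have "q \<in> cball 0 N \<times> {-N..N}" using True y by (auto simp: q)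
        ultimately show ?thesis using \<epsilon> N B0 by (simp add: q)
      next
        case False
        then have "case_prod G q = 0" by (auto simp: G_def q)
        then show ?thesis by simp
      qed
    qed
  qed measurable
  have "(\<integral>z. (indicator (cball 0 1) z * (z \<bullet> e)) *\<^sub>R dir_hilbert \<epsilon> N z f x \<partial>lborel) = (\<integral>z. \<integral>t. H z t \<partial>lborel \<partial>lborel)"
    unfolding dir_hilbert_def H_def by (simp only: scaleR_scaleR[symmetric] integral_scaleR_right)
  also have "\<dots> = (\<integral>t. \<integral>z. H z t \<partial>lborel \<partial>lborel)"
    by (rule lborel_pair.Fubini_integral[OF intH, symmetric])
  also have "\<dots> = (\<integral>t. \<integral>y. G y t \<partial>lborel \<partial>lborel)"
  proof (rule Bochner_Integration.integral_cong[OF refl])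
    fix t :: real
    show "(\<integral>z. H z t \<partial>lborel) = (\<integral>y. G y t \<partial>lborel)"
    proof (cases "t = 0")
      case True
      then show ?thesis using \<epsilon> by (simp add: H_def G_def hilbert_kernel_def)
    next
      case False
      have "(\<integral>y. G y t \<partial>lborel) = (\<bar>t\<bar> ^ ?n) *\<^sub>R (\<integral>z. G (t *\<^sub>R z) t \<partial>lborel)"
        by (rule integral_scaleR_substitution[OF False]) (simp add: G_def)
      also have "\<dots> = (\<integral>z. (\<bar>t\<bar> ^ ?n) *\<^sub>R G (t *\<^sub>R z) t \<partial>lborel)" by simp
      also have "\<dots> = (\<integral>z. H z t \<partial>lborel)"
      proof (intro Bochner_Integration.integral_cong refl)
        fix z :: 'a
        have i: "indicator {s. norm (t *\<^sub>R z) \<le> \<bar>s\<bar>} t = (indicator (cball 0 1) z :: real)"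
          using False by (auto simp: indicator_def mult_le_cancel_left1)
        have "\<bar>t\<bar> ^ ?n * (t / \<bar>t\<bar> ^ (?n + 2)) = 1 / t"
          using False by (simp add: power_add divide_simps power2_eq_square)
        then have "\<bar>t\<bar> ^ ?n * (indicator (cball 0 1) z * (t *\<^sub>R z \<bullet> e) * indicator {t. \<epsilon> \<le> \<bar>t\<bar> \<and> \<bar>t\<bar> \<le> N} t / \<bar>t\<bar> ^ (?n + 2))
           = indicator (cball 0 1) z * (z \<bullet> e) * (indicator {t. \<epsilon> \<le> \<bar>t\<bar> \<and> \<bar>t\<bar> \<le> N} t * (1 / t))"
          by (simp only: inner_scaleR_left) (simp add: field_simps)
        then show "(\<bar>t\<bar> ^ ?n) *\<^sub>R G (t *\<^sub>R z) t = H z t"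
          unfolding G_def H_def i hilbert_kernel_def scaleR_scaleR by simp
      qed
      finally show ?thesis by simp
    qed
  qed
  also have "\<dots> = (\<integral>y. \<integral>t. G y t \<partial>lborel \<partial>lborel)"
    by (rule lborel_pair.Fubini_integral[OF intG])
  also have "\<dots> = (\<integral>y. (2 / real (?n + 1)) *\<^sub>R (riesz_kernel e y * riesz_weight \<epsilon> N y) *\<^sub>R f (x - y) \<partial>lborel)"
  proof (rule Bochner_Integration.integral_cong_AE)
    have "AE y in lborel. y \<noteq> (0::'a)" by (rule AE_lborel_singleton)
    then show "AE y in lborel. (\<integral>t. G y t \<partial>lborel) = (2 / real (?n + 1)) *\<^sub>R (riesz_kernel e y * riesz_weight \<epsilon> N y) *\<^sub>R f (x - y)"
    proof eventually_elim
      case (elim y)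
      show ?case unfolding G_def scaleR_scaleR riesz_kernel_from_directions[OF \<epsilon> elim, symmetric]
      proof (rule integral_scaleR_left)
        let ?k = "\<lambda>t. indicator {t. norm y \<le> \<bar>t\<bar>} t * (y \<bullet> e) * indicator {t. \<epsilon> \<le> \<bar>t\<bar> \<and> \<bar>t\<bar> \<le> N} t / \<bar>t\<bar> ^ (?n + 2)"
        show "integrable lborel (\<lambda>t. ?k t)"
        proof (rule Bochner_Integration.integrable_bound)
          show "integrable lborel (\<lambda>t. (\<bar>y \<bullet> e\<bar> / \<epsilon> ^ (?n + 2)) * indicator {-N..N} t)"
            by (intro integrable_mult_right integrable_real_indicator) (auto simp: emeasure_lborel_Icc_eq)
          show "AE t in lborel. norm (?k t)
             \<le> norm ((\<bar>y \<bullet> e\<bar> / \<epsilon> ^ (?n + 2)) * indicator {-N..N} t)"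
          proof (intro AE_I2)
            fix t :: real
            have "\<bar>y \<bullet> e\<bar> / \<bar>t\<bar> ^ (?n + 2) \<le> \<bar>y \<bullet> e\<bar> / \<epsilon> ^ (?n + 2)" if "\<epsilon> \<le> \<bar>t\<bar>"
              using that \<epsilon> by (intro divide_left_mono power_mono) auto
            then show "norm (?k t)
               \<le> norm ((\<bar>y \<bullet> e\<bar> / \<epsilon> ^ (?n + 2)) * indicator {-N..N} t)"
              using \<epsilon> by (auto simp: indicator_def abs_mult)
          qed
        qed measurable
      qed
    qed
  qed (simp_all add: G_def)
  finally show ?thesis by (simp only: integral_scaleR_right)
qed

text \<open>Jensen's inequality for Lebesgue measure on the unit ball reduces the average to a single
  direction, where the bound does not depend on the direction. The factor \<open>\<bar>z \<bullet> e\<bar> \<le> 1\<close> is dropped.\<close>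

lemma weighted_riesz_Lp:
  assumes p: "1 < p" and e: "norm (e::'a::euclidean_space) \<le> 1"
  obtains C where "C > 0" "\<And>(f::'a\<Rightarrow>complex) B \<epsilon> N. continuous_on UNIV f \<Longrightarrow> (\<And>x. norm (f x) \<le> B) \<Longrightarrow>
    0 < \<epsilon> \<Longrightarrow> \<epsilon> \<le> N \<Longrightarrow>
    Lp_mass lborel p (\<lambda>x. \<integral>y. (riesz_kernel e y * riesz_weight \<epsilon> N y) *\<^sub>R f (x - y) \<partial>lborel)
    \<le> ennreal C * Lp_mass lborel p f"
proof -
  obtain C where C: "C > 0" "\<And>(f::'a\<Rightarrow>complex) \<epsilon> N z.
    continuous_on UNIV f \<Longrightarrow> 0 < \<epsilon> \<Longrightarrow> \<epsilon> \<le> N \<Longrightarrow>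
    Lp_mass lborel p (dir_hilbert \<epsilon> N z f) \<le> ennreal C * Lp_mass lborel p f"
    using dir_hilbert_Lp[OF p] by blast
  let ?n = "real (DIM('a) + 1) / 2" and ?U = "cball (0::'a) 1"
  define V where "V = measure lborel ?U"
  have V: "emeasure lborel ?U = ennreal V" "V > 0"
    using content_cball_pos[of 1 "0::'a"] emeasure_compact_finite[OF compact_cball, of "0::'a" 1]
    by (auto simp: V_def intro!: emeasure_eq_ennreal_measure)
  have bound: "Lp_mass lborel p (\<lambda>x. \<integral>y. (riesz_kernel e y * riesz_weight \<epsilon> N y) *\<^sub>R f (x - y) \<partial>lborel)
     \<le> ennreal (?n powr p * (V powr (p - 1) * (C * V))) * Lp_mass lborel p f"
    if f: "continuous_on UNIV f" and B: "\<And>x. norm (f x) \<le> B" and \<epsilon>: "0 < \<epsilon>" "\<epsilon> \<le> N"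
    for f :: "'a \<Rightarrow> complex" and B \<epsilon> N
  proof -
    have [measurable]: "f \<in> borel_measurable borel" using f by (rule borel_measurable_continuous_onI)
    have [measurable]: "?U \<in> sets borel" by simp
    note [measurable] = dir_hilbert_measurable_pair[of f \<epsilon> N]
    let ?D = "\<lambda>z x. dir_hilbert \<epsilon> N z f x"
    define A where "A x = (\<integral>z. (indicator ?U z * (z \<bullet> e)) *\<^sub>R ?D z x \<partial>lborel)" for x
    have A[measurable]: "A \<in> borel_measurable borel"
      unfolding A_def dir_hilbert_def by measurable
    have eq: "(\<integral>y. (riesz_kernel e y * riesz_weight \<epsilon> N y) *\<^sub>R f (x - y) \<partial>lborel) = ?n *\<^sub>R A x" for x
    proof -
      have "?n * (2 / real (DIM('a) + 1)) = 1" by (simp add: field_simps)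
      then show ?thesis
        unfolding A_def by (subst average_dir_hilbert[OF _ B \<epsilon>]) (simp_all only: scaleR_scaleR scaleR_one \<open>f \<in> borel_measurable borel\<close>)
    qed
    have pw: "ennreal (norm (A x) powr p)
       \<le> ennreal (V powr (p - 1)) * (\<integral>\<^sup>+z. indicator ?U z * ennreal (norm (?D z x) powr p) \<partial>lborel)" for x
    proof -
      let ?M = "density lborel (indicator ?U :: 'a \<Rightarrow> ennreal)"
      have [measurable]: "(\<lambda>z. ?D z x) \<in> borel_measurable borel" unfolding dir_hilbert_def by measurable
      have "A x = (\<integral>z. indicator ?U z *\<^sub>R ((z \<bullet> e) *\<^sub>R ?D z x) \<partial>lborel)"
        by (simp add: A_def)
      also have "\<dots> = (\<integral>z. (z \<bullet> e) *\<^sub>R ?D z x \<partial>density lborel (\<lambda>z. ennreal (indicator ?U z)))"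
        by (rule integral_density[symmetric]) auto
      also have "\<dots> = (\<integral>z. (z \<bullet> e) *\<^sub>R ?D z x \<partial>?M)" by (simp add: ennreal_indicator)
      finally have "ennreal (norm (A x) powr p)
         \<le> ennreal (V powr (p - 1)) * (\<integral>\<^sup>+z. ennreal (norm ((z \<bullet> e) *\<^sub>R ?D z x) powr p) \<partial>?M)"
        using V p by (simp only:, intro jensen_powr_norm) (auto simp: emeasure_density)
      also have "(\<integral>\<^sup>+z. ennreal (norm ((z \<bullet> e) *\<^sub>R ?D z x) powr p) \<partial>?M)
         = (\<integral>\<^sup>+z. indicator ?U z * ennreal (norm ((z \<bullet> e) *\<^sub>R ?D z x) powr p) \<partial>lborel)"
        by (rule nn_integral_density) auto
      also have "\<dots> \<le> (\<integral>\<^sup>+z. indicator ?U z * ennreal (norm (?D z x) powr p) \<partial>lborel)"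
      proof (intro nn_integral_mono)
        fix z :: 'a
        show "indicator ?U z * ennreal (norm ((z \<bullet> e) *\<^sub>R ?D z x) powr p) \<le> indicator ?U z * ennreal (norm (?D z x) powr p)"
        proof (cases "z \<in> ?U")
          case True
          have "\<bar>z \<bullet> e\<bar> \<le> 1 * 1"
            by (rule order_trans[OF Cauchy_Schwarz_ineq2]) (use True e in \<open>intro mult_mono, auto\<close>)
          then have "norm ((z \<bullet> e) *\<^sub>R ?D z x) \<le> norm (?D z x)"
            by (simp add: mult_left_le_one_le)
          then show ?thesis using p by (intro mult_left_mono ennreal_leI powr_mono2) auto
        qed simp
      qed
      finally show ?thesis by (simp add: mult_left_mono)
    qed
    have "Lp_mass lborel p A
      \<le> (\<integral>\<^sup>+x. ennreal (V powr (p - 1)) * (\<integral>\<^sup>+z. indicator ?U z * ennreal (norm (?D z x) powr p) \<partial>lborel) \<partial>lborel)"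
      unfolding Lp_mass_def by (intro nn_integral_mono pw)
    also have "\<dots> = ennreal (V powr (p - 1)) * (\<integral>\<^sup>+x. \<integral>\<^sup>+z. indicator ?U z * ennreal (norm (?D z x) powr p) \<partial>lborel \<partial>lborel)"
      unfolding dir_hilbert_def by (intro nn_integral_cmult) measurable
    also have "(\<integral>\<^sup>+x. \<integral>\<^sup>+z. indicator ?U z * ennreal (norm (?D z x) powr p) \<partial>lborel \<partial>lborel)
       = (\<integral>\<^sup>+z. \<integral>\<^sup>+x. indicator ?U z * ennreal (norm (?D z x) powr p) \<partial>lborel \<partial>lborel)"
      unfolding dir_hilbert_def by (rule lborel_pair.Fubini') measurable
    also have "\<dots> = (\<integral>\<^sup>+z. indicator ?U z * Lp_mass lborel p (?D z) \<partial>lborel)"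
      unfolding Lp_mass_def by (intro nn_integral_cong nn_integral_cmult) simp
    also have "\<dots> \<le> (\<integral>\<^sup>+z. indicator ?U z * (ennreal C * Lp_mass lborel p f) \<partial>lborel)"
      by (intro nn_integral_mono mult_left_mono C(2) f \<epsilon>) auto
    also have "\<dots> = ennreal V * (ennreal C * Lp_mass lborel p f)"
      by (subst nn_integral_multc) (simp_all add: V)
    finally have AL: "Lp_mass lborel p A \<le> ennreal (V powr (p - 1)) * (ennreal V * (ennreal C * Lp_mass lborel p f))"
      by (simp add: mult_left_mono)
    have "Lp_mass lborel p (\<lambda>x. ?n *\<^sub>R A x) = ennreal (?n powr p) * Lp_mass lborel p A"
      by (rule Lp_mass_scale) auto
    also have "\<dots> \<le> ennreal (?n powr p) * (ennreal (V powr (p - 1)) * (ennreal V * (ennreal C * Lp_mass lborel p f)))"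
      by (intro mult_left_mono AL) auto
    also have "\<dots> = ennreal (?n powr p * (V powr (p - 1) * (C * V))) * Lp_mass lborel p f"
      using C(1) V(2) by (simp add: ennreal_mult mult_ac)
    finally show ?thesis unfolding eq .
  qed
  show thesis
  proof (rule that)
    show "0 < ?n powr p * (V powr (p - 1) * (C * V))" using C(1) V(2) by simp
  qed (rule bound)
qed

section \<open>Principal values of the Riesz kernel\<close>

text \<open>A class on which principal values exist for an elementary reason, which is dense in \<open>L\<^sup>p\<close>, and
  which contains the products of Schwartz functions and chirps.\<close>

definition tame :: "('a::euclidean_space \<Rightarrow> complex) \<Rightarrow> bool" where
  "tame f \<longleftrightarrow> integrable lborel f \<and> (\<exists>B. \<forall>x. norm (f x) \<le> B) \<and>
     (\<exists>L. \<forall>x y. norm (f x - f y) \<le> L * norm (x - y))"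

text \<open>The principal value of the convolution with the Riesz kernel, as an absolutely convergent
  integral: the kernel is odd, so the subtracted term contributes nothing to any even
  truncation.\<close>

definition riesz :: "'a::euclidean_space \<Rightarrow> ('a \<Rightarrow> complex) \<Rightarrow> 'a \<Rightarrow> complex" where
  "riesz e f x = (\<integral>y. riesz_kernel e y *\<^sub>R (f (x - y) - indicator (ball 0 1) y *\<^sub>R f x) \<partial>lborel)"

lemma tame_continuous: 
  assumes "tame f"
  shows "continuous_on UNIV f"
proof -
  obtain L where L: "\<And>x y. norm (f x - f y) \<le> L * norm (x - y)" using assms by (auto simp: tame_def)
  have "norm (f x - f y) \<le> max L 0 * norm (x - y)" for x y
    by (rule order_trans[OF L]) (auto intro: mult_right_mono)
  then have "(max L 0)-lipschitz_on UNIV f"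
    by (auto simp: lipschitz_on_def dist_norm)
  then show ?thesis by (rule lipschitz_on_continuous_on)
qed

lemma tame_measurable [measurable_dest]: "tame f \<Longrightarrow> f \<in> borel_measurable borel"
  by (intro borel_measurable_continuous_onI tame_continuous)

lemma lborel_distr_reflect: "distr lborel borel (\<lambda>y::'a::euclidean_space. x - y) = lborel"
  using lborel_affine[of "-1" x] by (simp add: density_1)

lemma lborel_reflect:
  fixes f :: "'a::euclidean_space \<Rightarrow> 'b::{banach,second_countable_topology}"
  assumes [measurable]: "f \<in> borel_measurable borel"
  shows "integrable lborel (\<lambda>y. f (x - y)) \<longleftrightarrow> integrable lborel f"
    and "(\<integral>y. f (x - y) \<partial>lborel) = (\<integral>y. f y \<partial>lborel)"
proof -
  have "integrable (distr lborel borel (\<lambda>y. x - y)) f \<longleftrightarrow> integrable lborel (\<lambda>y. f (x - y))"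
    by (rule integrable_distr_eq) auto
  then show "integrable lborel (\<lambda>y. f (x - y)) \<longleftrightarrow> integrable lborel f"
    unfolding lborel_distr_reflect by simp
  have "(\<integral>y. f y \<partial>distr lborel borel (\<lambda>y. x - y)) = (\<integral>y. f (x - y) \<partial>lborel)"
    by (rule integral_distr) auto
  then show "(\<integral>y. f (x - y) \<partial>lborel) = (\<integral>y. f y \<partial>lborel)"
    unfolding lborel_distr_reflect by simp
qed

text \<open>The function \<open>norm y\<close> to the power \<open>1 - n\<close> near the origin. On the shell between the radii \<open>2\<^sup>-\<^sup>k\<close>
  and half of it, the function is at most \<open>2\<close> to the power \<open>(k + 1) (n - 1)\<close>, while the volume is
  of the order of \<open>2\<close> to the power \<open>-k n\<close>; the products form a geometric series.\<close>

lemma integrable_norm_singularity: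
  "integrable lborel (\<lambda>y::'a::euclidean_space. indicator (ball 0 1) y * (norm y / norm y ^ DIM('a)))"
proof (rule integrableI_bounded)
  define m where "m = DIM('a) - 1"
  have n: "DIM('a) = Suc m" using DIM_positive[where 'a='a] by (simp add: m_def)
  have [measurable]: "ball (0::'a) 1 \<in> sets borel" "cball (0::'a) r \<in> sets borel" for r by simp_all
  show "(\<lambda>y::'a. indicator (ball 0 1) y * (norm y / norm y ^ DIM('a))) \<in> borel_measurable lborel"
    by measurable
  let ?c = "\<lambda>k::nat. (2::real) ^ ((k + 1) * m)" and ?B = "\<lambda>k::nat. cball (0::'a) (1 / 2 ^ k)"
  let ?v = "unit_ball_vol (real DIM('a))"
  have "(\<integral>\<^sup>+y. ennreal (norm (indicator (ball 0 1) (y::'a) * (norm y / norm y ^ DIM('a)) :: real)) \<partial>lborel)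
      \<le> (\<integral>\<^sup>+y. (\<Sum>k. ennreal (?c k) * indicator (?B k) y) \<partial>lborel)"
  proof (intro nn_integral_mono)
    fix y :: 'a
    show "ennreal (norm (indicator (ball 0 1) y * (norm y / norm y ^ DIM('a)) :: real))
       \<le> (\<Sum>k. ennreal (?c k) * indicator (?B k) y)"
    proof (cases "0 < norm y \<and> norm y < 1")
      case True
      define P where "P k \<longleftrightarrow> 1 / 2 ^ (k + 1) < norm y" for k :: nat
      have "\<exists>k. P k"
      proof -
        obtain k where "(1/2) ^ k < norm y" using True real_arch_pow_inv[of "norm y" "1/2"] by auto
        moreover have "(1/2::real) ^ (k + 1) \<le> (1/2) ^ k" by simp
        ultimately show ?thesis unfolding P_def by (metis order_le_less_trans power_one_over)
      qed
      \<comment> \<open>the index of the dyadic shell that contains \<open>y\<close>\<close>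
      define k where "k = (LEAST k. P k)"
      have Pk: "P k" unfolding k_def using \<open>\<exists>k. P k\<close> LeastI_ex by blast
      have le: "norm y \<le> 1 / 2 ^ k"
      proof (cases k)
        case 0 then show ?thesis using True by simp
      next
        case (Suc l)
        then have "\<not> P l" using not_less_Least[of l P] by (simp add: k_def)
        then show ?thesis using Suc by (simp add: P_def)
      qed
      have "norm y / norm y ^ DIM('a) = (1 / norm y) ^ m" using True by (simp add: n power_divide)
      also have "\<dots> \<le> (2 ^ (k + 1)) ^ m"
        using Pk True by (intro power_mono) (auto simp: P_def field_simps)
      also have "\<dots> = ?c k" by (rule power_mult[symmetric])
      finally have "ennreal (norm (indicator (ball 0 1) y * (norm y / norm y ^ DIM('a)) :: real)) \<le> ennreal (?c k) * indicator (?B k) y"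
        using True le by (simp add: ennreal_leI)
      also have "\<dots> \<le> (\<Sum>k. ennreal (?c k) * indicator (?B k) y)"
      proof -
        define F where "F k = ennreal (?c k) * indicator (?B k) y" for k
        have "sum F {k} \<le> suminf F" by (rule sum_le_suminf) auto
        then show ?thesis unfolding F_def by (simp only: sum.insert_remove sum.empty finite.emptyI empty_Diff add_0_right)
      qed
      finally show ?thesis .
    qed auto
  qed
  also have "\<dots> = (\<Sum>k. ennreal (?c k) * emeasure lborel (?B k))"
    by (subst nn_integral_suminf) (auto simp: nn_integral_cmult_indicator)
  also have "\<dots> = (\<Sum>k. ennreal (2 ^ m * ?v * (1/2) ^ k))"
  proof (intro suminf_cong)
    fix k :: nat
    have "?c k * (?v * (1 / 2 ^ k) ^ DIM('a)) = 2 ^ m * ?v * (1/2) ^ k"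
      by (simp add: n power_mult power_add power_mult_distrib power_divide field_simps)
    then show "ennreal (?c k) * emeasure lborel (?B k) = ennreal (2 ^ m * ?v * (1/2) ^ k)"
      by (simp add: emeasure_cball ennreal_mult'[symmetric])
  qed
  also have "\<dots> = ennreal (\<Sum>k. 2 ^ m * ?v * (1/2) ^ k)"
    by (intro suminf_ennreal2 summable_mult summable_geometric) auto
  finally show "(\<integral>\<^sup>+y. ennreal (norm (indicator (ball 0 1) (y::'a) * (norm y / norm y ^ DIM('a)) :: real)) \<partial>lborel) < \<infinity>"
    by (rule order_le_less_trans) simp
qed

lemma riesz_kernel_bound:
  fixes y e :: "'a::euclidean_space"
  assumes e: "norm e \<le> 1"
  shows "\<bar>riesz_kernel e y\<bar> \<le> 1 / norm y ^ DIM('a)"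
proof (cases "y = 0")
  case False
  have "\<bar>y \<bullet> e\<bar> \<le> norm y * 1"
    by (rule order_trans[OF Cauchy_Schwarz_ineq2]) (use e in \<open>intro mult_left_mono, auto\<close>)
  moreover have "\<bar>riesz_kernel e y\<bar> = \<bar>y \<bullet> e\<bar> / norm y ^ (DIM('a) + 1)"
    by (simp add: riesz_kernel_def abs_mult)
  ultimately have "\<bar>riesz_kernel e y\<bar> \<le> norm y / norm y ^ (DIM('a) + 1)"
    by (simp only: mult_1_right divide_right_mono zero_le_power norm_ge_zero)
  then show ?thesis using False by simp
qed (simp add: riesz_kernel_def)

lemma riesz_kernel_minus: "riesz_kernel e (- y) = - riesz_kernel e y"
  by (simp add: riesz_kernel_def)

text \<open>Inside the unit ball the Lipschitz condition gains one power of \<open>norm y\<close>, which makes the singularity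
  integrable; outside, the kernel is at most 1 and \<open>f\<close> is integrable.\<close>

lemma riesz_integrand_dominated:
  fixes f :: "'a::euclidean_space \<Rightarrow> complex"
  assumes f: "tame f" and e: "norm e \<le> 1"
  obtains G where "integrable lborel G"
    "\<And>y. norm (riesz_kernel e y *\<^sub>R (f (x - y) - indicator (ball 0 1) y *\<^sub>R f x)) \<le> G y"
proof -
  let ?R = "\<lambda>y. riesz_kernel e y *\<^sub>R (f (x - y) - indicator (ball 0 1) y *\<^sub>R f x)"
  note [measurable] = tame_measurable[OF f]
  have "integrable lborel f" using f by (simp add: tame_def)
  then have intfx: "integrable lborel (\<lambda>y. f (x - y))" by (simp add: lborel_reflect)
  obtain L where L: "\<And>x y. norm (f x - f y) \<le> L * norm (x - y)" using f by (auto simp: tame_def)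
  let ?dom = "\<lambda>y. L * (indicator (ball 0 1) y * (norm y / norm y ^ DIM('a))) + norm (f (x - y))"
  have dom: "norm (?R y) \<le> ?dom y" for y
  proof (cases "norm y < 1")
    case True
    have "norm (?R y)
        \<le> 1 / norm y ^ DIM('a) * (L * norm y)"
      using L[of "x - y" x] True riesz_kernel_bound[OF e, of y]
      unfolding norm_scaleR by (intro mult_mono) auto
    then show ?thesis using True by (simp add: add_increasing2)
  next
    case False
    have "1 \<le> norm y ^ DIM('a)" using False by (intro one_le_power) simp
    then have "1 / norm y ^ DIM('a) \<le> 1" by (simp add: divide_le_eq)
    then have "\<bar>riesz_kernel e y\<bar> \<le> 1" using riesz_kernel_bound[OF e, of y] by linarith
    then show ?thesis using False by (simp add: mult_left_le_one_le)
  qed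
  have "integrable lborel ?dom"
    by (intro Bochner_Integration.integrable_add integrable_mult_right integrable_norm_singularity integrable_norm intfx)
  with dom show thesis using that by blast
qed

lemma riesz_integrable:
  fixes f :: "'a::euclidean_space \<Rightarrow> complex"
  assumes f: "tame f" and e: "norm e \<le> 1"
  shows "integrable lborel (\<lambda>y. riesz_kernel e y *\<^sub>R (f (x - y) - indicator (ball 0 1) y *\<^sub>R f x))"
proof -
  let ?R = "\<lambda>y. riesz_kernel e y *\<^sub>R (f (x - y) - indicator (ball 0 1) y *\<^sub>R f x)"
  note [measurable] = tame_measurable[OF f]
  have [measurable]: "ball (0::'a) 1 \<in> sets borel" by simp
  obtain G where G: "integrable lborel G"
    "\<And>y. norm (?R y) \<le> G y"
    using riesz_integrand_dominated[OF f e] by blast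
  have "norm (?R y) \<le> norm (G y)" for y
    using G(2)[of y] by simp
  then show ?thesis
    by (intro Bochner_Integration.integrable_bound[OF G(1)] AE_I2) (simp, blast)
qed

lemma tame_add: 
  assumes f: "tame f" and g: "tame g"
  shows "tame (\<lambda>x. f x + g x)"
proof -
  obtain B L B' L' where B: "\<And>x. norm (f x) \<le> B" "\<And>x. norm (g x) \<le> B'"
    and L: "\<And>x y. norm (f x - f y) \<le> L * norm (x - y)" "\<And>x y. norm (g x - g y) \<le> L' * norm (x - y)"
    using f g by (auto simp: tame_def)
  have 1: "norm (f x + g x) \<le> B + B'" for x using B norm_triangle_mono by blast
  have 2: "norm (f x + g x - (f y + g y)) \<le> (L + L') * norm (x - y)" for x y
    using norm_triangle_mono[OF L[of x y]] by (simp add: algebra_simps)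
  show ?thesis unfolding tame_def
  proof (intro conjI)
    show "integrable lborel (\<lambda>x. f x + g x)" using f g by (simp add: tame_def)
  qed (use 1 2 in blast)+
qed

lemma tame_scale: 
  assumes f: "tame f"
  shows "tame (\<lambda>x. c * f x)"
proof -
  obtain B L where B: "\<And>x. norm (f x) \<le> B" and L: "\<And>x y. norm (f x - f y) \<le> L * norm (x - y)"
    using f by (auto simp: tame_def)
  have 1: "norm (c * f x) \<le> norm c * B" for x
    unfolding norm_mult by (intro mult_left_mono B) simp
  have 2: "norm (c * f x - c * f y) \<le> (norm c * L) * norm (x - y)" for x y
    unfolding right_diff_distrib[symmetric] norm_mult mult.assoc by (intro mult_left_mono L) simp
  show ?thesis unfolding tame_def
  proof (intro conjI)
    show "integrable lborel (\<lambda>x. c * f x)" using f by (simp add: tame_def)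
  qed (use 1 2 in blast)+
qed

lemma riesz_add:
  assumes "tame f" "tame g" "norm e \<le> 1"
  shows "riesz e (\<lambda>x. f x + g x) x = riesz e f x + riesz e g x"
  unfolding riesz_def
  by (subst Bochner_Integration.integral_add[symmetric, OF riesz_integrable riesz_integrable])
    (use assms in \<open>auto simp: algebra_simps intro!: Bochner_Integration.integral_cong\<close>)

lemma riesz_scale: "riesz e (\<lambda>x. c * f x) x = c * riesz e f x"
  unfolding riesz_def integral_mult_right_zero[symmetric]
  by (intro Bochner_Integration.integral_cong refl) (simp add: right_diff_distrib)

text \<open>An even weight annihilates the subtracted term, since its integral against an odd kernel is
  zero. After that the convergence is dominated. The bound \<open>c k\<close> on the weighted kernel, which may
  grow with \<open>k\<close>, is what allows the two terms to be integrated separately.\<close>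

lemma riesz_weighted_limit:
  fixes f :: "'a::euclidean_space \<Rightarrow> complex" and w :: "nat \<Rightarrow> 'a \<Rightarrow> real"
  assumes f: "tame f" and e: "norm e \<le> 1"
    and [measurable]: "\<And>k. w k \<in> borel_measurable borel"
    and w: "\<And>k y. 0 \<le> w k y" "\<And>k y. w k y \<le> 1" "\<And>k y. w k (- y) = w k y"
    and lim: "\<And>y. y \<noteq> 0 \<Longrightarrow> (\<lambda>k. w k y) \<longlonglongrightarrow> 1"
    and c: "\<And>k y. \<bar>riesz_kernel e y\<bar> * w k y \<le> c k"
  shows "integrable lborel (\<lambda>y. (riesz_kernel e y * w k y) *\<^sub>R f (x - y))"
    and "(\<lambda>k. \<integral>y. (riesz_kernel e y * w k y) *\<^sub>R f (x - y) \<partial>lborel) \<longlonglongrightarrow> riesz e f x"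
proof -
  let ?R = "\<lambda>y. riesz_kernel e y *\<^sub>R (f (x - y) - indicator (ball 0 1) y *\<^sub>R f x)"
  note [measurable] = tame_measurable[OF f]
  have [measurable]: "ball (0::'a) 1 \<in> sets borel" by simp
  have intf: "integrable lborel f" using f by (simp add: tame_def)
  then have intfx: "integrable lborel (\<lambda>y. f (x - y))" by (simp add: lborel_reflect)
  obtain L where L: "\<And>x y. norm (f x - f y) \<le> L * norm (x - y)" using f by (auto simp: tame_def)
  have c0: "c k \<ge> 0" for k using c[of 0 k] by (auto simp: riesz_kernel_def)
  have int1: "integrable lborel (\<lambda>y. (riesz_kernel e y * w k y) *\<^sub>R f (x - y))" for k
  proof (rule Bochner_Integration.integrable_bound)
    show "integrable lborel (\<lambda>y. c k *\<^sub>R f (x - y))" using intfx by simp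
    show "AE y in lborel. norm ((riesz_kernel e y * w k y) *\<^sub>R f (x - y)) \<le> norm (c k *\<^sub>R f (x - y))"
      using c0 w(1) c by (intro AE_I2) (auto simp: abs_mult intro!: mult_right_mono)
  qed measurable
  then show "integrable lborel (\<lambda>y. (riesz_kernel e y * w k y) *\<^sub>R f (x - y))" .
  let ?g = "\<lambda>k y. riesz_kernel e y * w k y * indicator (ball 0 1) y"
  have intg: "integrable lborel (?g k)" for k
  proof (rule Bochner_Integration.integrable_bound)
    have "emeasure lborel (ball (0::'a) 1) < \<infinity>" by (rule emeasure_bounded_finite) simp
    then show "integrable lborel (\<lambda>y::'a. c k * indicator (ball 0 1) y)"
      by (intro integrable_mult_right integrable_real_indicator) auto
    show "AE y in lborel. norm (?g k y) \<le> norm (c k * indicator (ball 0 1) y)"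
      using c0 w(1) c by (intro AE_I2) (auto simp: abs_mult indicator_def)
  qed measurable
  have zero: "(\<integral>y. ?g k y \<partial>lborel) = 0" for k
  proof -
    have "(\<integral>y. ?g k y \<partial>lborel) = (\<integral>y. ?g k (0 - y) \<partial>lborel)"
      by (rule lborel_reflect(2)[symmetric]) measurable
    also have "(\<lambda>y. ?g k (0 - y)) = (\<lambda>y. - ?g k y)"
      by (auto simp: riesz_kernel_minus w indicator_def)
    finally show ?thesis by simp
  qed
  have eq: "(\<integral>y. (riesz_kernel e y * w k y) *\<^sub>R f (x - y) \<partial>lborel)
      = (\<integral>y. w k y *\<^sub>R (?R y) \<partial>lborel)" for k
  proof -
    have "(\<integral>y. w k y *\<^sub>R (?R y) \<partial>lborel)
       = (\<integral>y. (riesz_kernel e y * w k y) *\<^sub>R f (x - y) - ?g k y *\<^sub>R f x \<partial>lborel)"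
    proof (rule Bochner_Integration.integral_cong[OF refl])
      fix y
      show "w k y *\<^sub>R (?R y)
        = (riesz_kernel e y * w k y) *\<^sub>R f (x - y) - ?g k y *\<^sub>R f x"
        by (simp only: scaleR_diff_right scaleR_scaleR mult.commute mult.left_commute)
    qed
    also have "\<dots> = (\<integral>y. (riesz_kernel e y * w k y) *\<^sub>R f (x - y) \<partial>lborel) - (\<integral>y. ?g k y *\<^sub>R f x \<partial>lborel)"
      by (intro Bochner_Integration.integral_diff int1 integrable_scaleR_left intg)
    also have "(\<integral>y. ?g k y *\<^sub>R f x \<partial>lborel) = 0"
      by (subst integral_scaleR_left[OF intg]) (simp only: zero scaleR_zero_left)
    finally show ?thesis by (simp only: diff_zero)
  qed
  obtain G where G: "integrable lborel G"
    "\<And>y. norm (?R y) \<le> G y"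
    using riesz_integrand_dominated[OF f e] by blast
  show "(\<lambda>k. \<integral>y. (riesz_kernel e y * w k y) *\<^sub>R f (x - y) \<partial>lborel) \<longlonglongrightarrow> riesz e f x"
    unfolding eq riesz_def
  proof (rule integral_dominated_convergence[where w = G])
    show "integrable lborel G" by (rule G(1))
    show "AE y in lborel. (\<lambda>k. w k y *\<^sub>R (?R y))
        \<longlonglongrightarrow> ?R y"
    proof (intro AE_I2)
      fix y :: 'a
      show "(\<lambda>k. w k y *\<^sub>R (?R y))
        \<longlonglongrightarrow> ?R y"
      proof (cases "y = 0")
        case False
        from tendsto_scaleR[OF lim[OF False] tendsto_const] show ?thesis by (metis scaleR_one)
      qed (simp add: riesz_kernel_def)
    qed
    show "AE y in lborel. norm (w k y *\<^sub>R (?R y)) \<le> G y" for k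
    proof (intro AE_I2)
      fix y
      have "norm (w k y *\<^sub>R (?R y))
         \<le> norm (?R y)"
        unfolding norm_scaleR[of "w k y"] using w(1,2)[of k y] by (intro mult_left_le_one_le) auto
      then show "norm (w k y *\<^sub>R (?R y)) \<le> G y"
        using G(2) order_trans by blast
    qed
  qed measurable
qed

lemma riesz_measurable [measurable]:
  assumes [measurable]: "f \<in> borel_measurable borel"
  shows "riesz e f \<in> borel_measurable borel"
proof -
  have [measurable]: "ball (0::'a::euclidean_space) 1 \<in> sets borel" by simp
  show ?thesis unfolding riesz_def by measurable
qed

lemma riesz_pv:
  fixes f :: "'a::euclidean_space \<Rightarrow> complex"
  assumes f: "tame f" and e: "norm e \<le> 1"
  shows "pv_exists x (\<lambda>y. riesz_kernel e (x - y) *\<^sub>R f y)"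
    and "pv_integral x (\<lambda>y. riesz_kernel e (x - y) *\<^sub>R f y) = riesz e f x"
proof -
  note [measurable] = tame_measurable[OF f]
  let ?h = "\<lambda>y. riesz_kernel e (x - y) *\<^sub>R f y"
  \<comment> \<open>sharp truncation, as a weight\<close>
  define w where "w \<epsilon> y = (indicator {y. \<epsilon> \<le> norm y} y :: real)" for \<epsilon> :: real and y :: 'a
  have c: "\<bar>riesz_kernel e y\<bar> * w \<epsilon> y \<le> 1 / \<epsilon> ^ DIM('a)" if "\<epsilon> > 0" for \<epsilon> y
  proof (cases "\<epsilon> \<le> norm y")
    case True
    have "1 / norm y ^ DIM('a) \<le> 1 / \<epsilon> ^ DIM('a)"
      using True that by (intro divide_left_mono power_mono mult_pos_pos zero_less_power) auto
    then show ?thesis using riesz_kernel_bound[OF e, of y] True by (simp add: w_def)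
  qed (use that in \<open>simp add: w_def\<close>)
  have wl: "(\<lambda>k. w (S k) y) \<longlonglongrightarrow> 1" if S: "\<And>k. 0 < S k" "S \<longlonglongrightarrow> 0" and y: "y \<noteq> 0" for S :: "nat \<Rightarrow> real" and y
  proof -
    have "\<forall>\<^sub>F k in sequentially. S k < norm y" using S(2) y by (intro order_tendstoD) auto
    then have "\<forall>\<^sub>F k in sequentially. w (S k) y = 1" by eventually_elim (simp add: w_def)
    then show ?thesis by (rule tendsto_eventually)
  qed
  have wm[measurable]: "w \<epsilon> \<in> borel_measurable borel" for \<epsilon> unfolding w_def by measurable
  have seq: "integrable lborel (\<lambda>y. (riesz_kernel e y * w (S k) y) *\<^sub>R f (x - y))"
     "(\<lambda>k. \<integral>y. (riesz_kernel e y * w (S k) y) *\<^sub>R f (x - y) \<partial>lborel) \<longlonglongrightarrow> riesz e f x"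
    if S: "\<And>k. 0 < S k" "S \<longlonglongrightarrow> 0" for S :: "nat \<Rightarrow> real" and k
  proof -
    have ev: "w (S k) (- y) = w (S k) y" for k y by (simp add: w_def indicator_def)
    have b: "0 \<le> w (S k) y" "w (S k) y \<le> 1" for k y by (simp_all add: w_def)
    show "integrable lborel (\<lambda>y. (riesz_kernel e y * w (S k) y) *\<^sub>R f (x - y))"
      by (rule riesz_weighted_limit(1)[OF f e, where w = "\<lambda>k. w (S k)" and c = "\<lambda>k. 1 / S k ^ DIM('a)"])
        (rule wm b ev c[OF S(1)] wl[OF S], assumption?)+
    show "(\<lambda>k. \<integral>y. (riesz_kernel e y * w (S k) y) *\<^sub>R f (x - y) \<partial>lborel) \<longlonglongrightarrow> riesz e f x"
      by (rule riesz_weighted_limit(2)[OF f e, where w = "\<lambda>k. w (S k)" and c = "\<lambda>k. 1 / S k ^ DIM('a)"])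
        (rule wm b ev c[OF S(1)] wl[OF S], assumption?)+
  qed
  have ihm[measurable]: "(\<lambda>y. indicator {y. \<epsilon> \<le> norm (x - y)} y *\<^sub>R ?h y) \<in> borel_measurable borel" for \<epsilon>
    by measurable
  have ih: "indicator {y. \<epsilon> \<le> norm (x - y)} (x - y) *\<^sub>R ?h (x - y) = (riesz_kernel e y * w \<epsilon> y) *\<^sub>R f (x - y)" for \<epsilon> y
    by (simp add: w_def indicator_def)
  have int: "integrable lborel (\<lambda>y. indicator {y. \<epsilon> \<le> norm (x - y)} y *\<^sub>R ?h y)" if "\<epsilon> > 0" for \<epsilon>
  proof -
    let ?S = "\<lambda>k. \<epsilon> * (1/2) ^ k"
    have S: "\<And>k. 0 < ?S k" "?S \<longlonglongrightarrow> 0"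
      using that by (auto intro!: tendsto_mult_right_zero LIMSEQ_power_zero)
    have "integrable lborel (\<lambda>y. indicator {y. \<epsilon> \<le> norm (x - y)} (x - y) *\<^sub>R ?h (x - y))"
      unfolding ih using seq(1)[OF S, of 0] by simp
    then show ?thesis by (subst (asm) lborel_reflect(1)[OF ihm])
  qed
  have tr: "truncated_integral x ?h \<epsilon> = (\<integral>y. (riesz_kernel e y * w \<epsilon> y) *\<^sub>R f (x - y) \<partial>lborel)" for \<epsilon>
  proof -
    have "truncated_integral x ?h \<epsilon> = (\<integral>y. indicator {y. \<epsilon> \<le> norm (x - y)} y *\<^sub>R ?h y \<partial>lborel)"
      unfolding truncated_integral_def set_lebesgue_integral_def by (rule integral_completion) (use ihm in simp)
    also have "\<dots> = (\<integral>y. indicator {y. \<epsilon> \<le> norm (x - y)} (x - y) *\<^sub>R ?h (x - y) \<partial>lborel)"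
      by (rule lborel_reflect(2)[symmetric, OF ihm])
    finally show ?thesis unfolding ih .
  qed
  have lim: "(truncated_integral x ?h \<longlongrightarrow> riesz e f x) (at_right 0)"
  proof (rule tendsto_at_right_sequentially[of 0 1])
    fix S :: "nat \<Rightarrow> real" assume S: "\<And>n. 0 < S n" "S \<longlonglongrightarrow> 0"
    show "(\<lambda>n. truncated_integral x ?h (S n)) \<longlonglongrightarrow> riesz e f x" unfolding tr by (rule seq(2)[OF S])
  qed simp
  show "pv_exists x ?h"
    unfolding pv_exists_def set_integrable_def
  proof (intro conjI allI impI exI)
    fix \<epsilon> :: real assume "0 < \<epsilon>"
    then show "integrable lebesgue (\<lambda>y. indicator {y. \<epsilon> \<le> norm (x - y)} y *\<^sub>R ?h y)"
      using int ihm by (subst integrable_completion) auto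
  qed (rule lim)
  show "pv_integral x ?h = riesz e f x"
    unfolding pv_integral_def by (rule tendsto_Lim[OF _ lim]) simp
qed

text \<open>The regularized operators satisfy a uniform bound and converge pointwise, so Fatou's lemma passes
  the bound to the limit.\<close>

lemma riesz_Lp:
  assumes p: "1 < p" and e: "norm (e::'a::euclidean_space) \<le> 1"
  obtains C where "C > 0" "\<And>f::'a \<Rightarrow> complex. tame f \<Longrightarrow>
    Lp_mass lborel p (riesz e f) \<le> ennreal C * Lp_mass lborel p f"
proof -
  obtain C where C: "C > 0" "\<And>(f::'a\<Rightarrow>complex) B \<epsilon> N. continuous_on UNIV f \<Longrightarrow> (\<And>x. norm (f x) \<le> B) \<Longrightarrow>
    0 < \<epsilon> \<Longrightarrow> \<epsilon> \<le> N \<Longrightarrow>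
    Lp_mass lborel p (\<lambda>x. \<integral>y. (riesz_kernel e y * riesz_weight \<epsilon> N y) *\<^sub>R f (x - y) \<partial>lborel)
    \<le> ennreal C * Lp_mass lborel p f"
    using weighted_riesz_Lp[OF p e] by blast
  have "Lp_mass lborel p (riesz e f) \<le> ennreal C * Lp_mass lborel p f" if f: "tame f" for f :: "'a \<Rightarrow> complex"
  proof -
    note [measurable] = tame_measurable[OF f]
    let ?n = "DIM('a) + 1"
    define w where "w k = (riesz_weight (1 / real (Suc k)) (real (Suc k)) :: 'a \<Rightarrow> real)" for k
    have wm[measurable]: "w k \<in> borel_measurable borel" for k unfolding w_def by measurable
    define T where "T k x = (\<integral>y. (riesz_kernel e y * w k y) *\<^sub>R f (x - y) \<partial>lborel)" for k x
    obtain B where B: "\<And>x. norm (f x) \<le> B" using f by (auto simp: tame_def)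
    have T: "Lp_mass lborel p (T k) \<le> ennreal C * Lp_mass lborel p f" for k
      unfolding T_def w_def by (intro C(2)[OF tame_continuous[OF f] B]) (simp, rule order_trans[of _ 1], auto)
    have wle: "w k y \<le> (norm y / max (norm y) (1 / real (Suc k))) ^ ?n" for k y
      unfolding w_def riesz_weight_def
      by (intro max.boundedI zero_le_power divide_nonneg_nonneg) (auto simp: le_max_iff_disj)
    have w0: "0 \<le> w k y" for k y by (simp add: w_def riesz_weight_def)
    have w1: "w k y \<le> 1" for k y
    proof -
      have "0 < max (norm y) (1 / real (Suc k))" by (simp add: less_max_iff_disj)
      then have "norm y / max (norm y) (1 / real (Suc k)) \<le> 1" by (simp add: divide_le_eq del: max_less_iff_conj)
      then have "(norm y / max (norm y) (1 / real (Suc k))) ^ ?n \<le> 1"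
        by (intro power_le_one) (auto simp: le_max_iff_disj)
      then show ?thesis using wle order_trans by blast
    qed
    have we: "w k (- y) = w k y" for k y by (simp add: w_def riesz_weight_def)
    have wc: "\<bar>riesz_kernel e y\<bar> * w k y \<le> real (Suc k) ^ DIM('a)" for k y
    proof (cases "y = 0")
      case False
      let ?m = "max (norm y) (1 / real (Suc k))"
      have m: "?m > 0" "1 / real (Suc k) \<le> ?m" by (auto simp: less_max_iff_disj)
      have "\<bar>riesz_kernel e y\<bar> * w k y \<le> 1 / norm y ^ DIM('a) * (norm y / ?m) ^ ?n"
        using w0 by (intro mult_mono riesz_kernel_bound[OF e] wle) auto
      also have "\<dots> = (1 / ?m) ^ DIM('a) * (norm y / ?m)"
        using False by (simp add: power_divide)
      also have "\<dots> \<le> (1 / ?m) ^ DIM('a) * 1"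
        using m by (intro mult_left_mono) (auto simp: divide_le_eq simp del: max_less_iff_conj)
      also have "(1 / ?m) ^ DIM('a) * 1 \<le> real (Suc k) ^ DIM('a)"
      proof -
        have "1 / ?m \<le> 1 / (1 / real (Suc k))" using m by (intro divide_left_mono) auto
        then have "1 / ?m \<le> real (Suc k)" by simp
        then show ?thesis using m(1) unfolding mult_1_right by (intro power_mono) (auto simp del: max_less_iff_conj)
      qed
      finally show ?thesis .
    qed (simp add: riesz_kernel_def)
    have wl: "(\<lambda>k. w k y) \<longlonglongrightarrow> 1" if y: "y \<noteq> 0" for y
    proof -
      have inv: "(\<lambda>k. 1 / real (Suc k)) \<longlonglongrightarrow> 0" using LIMSEQ_inverse_real_of_nat by (simp add: inverse_eq_divide)
      then have "\<forall>\<^sub>F k in sequentially. 1 / real (Suc k) < norm y" using y by (intro order_tendstoD) auto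
      then have ev: "\<forall>\<^sub>F k in sequentially. w k y = max 0 (1 - (norm y * (1 / real (Suc k))) ^ ?n)"
        by eventually_elim (use y in \<open>simp add: w_def riesz_weight_def max_def\<close>)
      have "(\<lambda>k. max 0 (1 - (norm y * (1 / real (Suc k))) ^ ?n)) \<longlonglongrightarrow> max 0 (1 - (norm y * 0) ^ ?n)"
        by (intro tendsto_intros inv)
      then show ?thesis using tendsto_cong[OF ev] by simp
    qed
    have lim: "(\<lambda>k. T k x) \<longlonglongrightarrow> riesz e f x" for x
      unfolding T_def by (rule riesz_weighted_limit(2)[OF f e wm w0 w1 we wl wc])
    have Tm[measurable]: "T k \<in> borel_measurable borel" for k unfolding T_def by measurable
    show ?thesis
      by (rule Lp_mass_le_of_AE_limit[where u = T, OF _ _ _ T tendsto_const]) (use p lim in auto)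
  qed
  then show thesis using that C(1) by blast
qed

section \<open>Extending operators from a dense subspace\<close>

lemma Lp_space_iff_mass:
  "f \<in> Lp_space p \<longleftrightarrow> f \<in> borel_measurable lebesgue \<and> Lp_mass lebesgue p f < top"
proof -
  have "integrable lebesgue (\<lambda>x. norm (f x) powr p) \<longleftrightarrow> Lp_mass lebesgue p f < top"
    if [measurable]: "f \<in> borel_measurable lebesgue"
    by (simp add: integrable_iff_bounded Lp_mass_def)
  then show ?thesis by (auto simp: Lp_space_def)
qed

lemma Lp_norm_eq_mass: 
  assumes "f \<in> borel_measurable lebesgue"
  shows "Lp_norm p f = enn2real (Lp_mass lebesgue p f) powr (1 / p)"
  using assms by (simp add: Lp_norm_def Lp_mass_def integral_eq_nn_integral)

lemma Lp_norm_le_of_mass_le: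
  assumes p: "0 < p" and f: "f \<in> Lp_space p" and g: "g \<in> Lp_space p" and C: "C \<ge> 0"
    and le: "Lp_mass lebesgue p g \<le> ennreal C * Lp_mass lebesgue p f"
  shows "Lp_norm p g \<le> C powr (1 / p) * Lp_norm p f"
proof -
  have "enn2real (Lp_mass lebesgue p g) \<le> enn2real (ennreal C * Lp_mass lebesgue p f)"
    using le f by (intro enn2real_mono) (auto simp: Lp_space_iff_mass ennreal_mult_less_top)
  then have "enn2real (Lp_mass lebesgue p g) powr (1 / p) \<le> (C * enn2real (Lp_mass lebesgue p f)) powr (1 / p)"
    using p C by (intro powr_mono2) (auto simp: enn2real_mult)
  then show ?thesis using f g C
    by (simp add: Lp_norm_eq_mass powr_mult Lp_space_iff_mass)
qed

lemma Lp_mass_triangle: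
  fixes f g h :: "'a \<Rightarrow> 'b::{banach,second_countable_topology}"
  assumes "f \<in> borel_measurable M" "g \<in> borel_measurable M" "h \<in> borel_measurable M" "0 \<le> p"
  shows "Lp_mass M p (\<lambda>x. f x - g x)
    \<le> ennreal (2 powr p) * (Lp_mass M p (\<lambda>x. f x - h x) + Lp_mass M p (\<lambda>x. h x - g x))"
  using assms norm_triangle_ineq[of "f x - h x" "h x - g x" for x]
  by (intro Lp_mass_norm_add_le) auto

lemma Lp_mass_commute: "Lp_mass M p (\<lambda>x. f x - g x) = Lp_mass M p (\<lambda>x. g x - f x)"
  by (simp add: Lp_mass_def norm_minus_commute)

lemma AE_eq_of_Lp_mass_small:
  fixes f g :: "'a \<Rightarrow> 'b::{banach,second_countable_topology}"
  assumes [measurable]: "f \<in> borel_measurable M" "g \<in> borel_measurable M" 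
    and small: "\<And>e. e > 0 \<Longrightarrow> Lp_mass M p (\<lambda>x. f x - g x) \<le> ennreal (A * e)"
  shows "AE x in M. f x = g x"
proof -
  have "Lp_mass M p (\<lambda>x. f x - g x) \<le> 0"
  proof (rule ennreal_le_epsilon)
    fix e :: real assume e: "e > 0"
    have "A * (e / (\<bar>A\<bar> + 1)) \<le> e"
    proof -
      have "A * e \<le> (\<bar>A\<bar> + 1) * e" using e by (intro mult_right_mono) auto
      then show ?thesis by (simp add: divide_le_eq mult.commute)
    qed
    then show "Lp_mass M p (\<lambda>x. f x - g x) \<le> 0 + ennreal e"
      using small[of "e / (\<bar>A\<bar> + 1)"] e by (simp, meson ennreal_leI order_trans)
  qed
  then have "(\<integral>\<^sup>+x. ennreal (norm (f x - g x) powr p) \<partial>M) = 0" by (simp add: Lp_mass_def)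
  then have "AE x in M. ennreal (norm (f x - g x) powr p) = 0"
    by (subst (asm) nn_integral_0_iff_AE) auto
  then show ?thesis by eventually_elim (auto simp: ennreal_eq_0_iff)
qed

text \<open>The step from \<open>L\<^sup>p\<close> to pointwise convergence in the Riesz-Fischer theorem. The weights \<open>2\<^sup>p\<close> to the
  power \<open>k\<close> leave the sum of the masses finite; hence for almost every \<open>x\<close> the increments are
  bounded by a multiple of \<open>2\<^sup>-\<^sup>k\<close>.\<close>

lemma AE_convergent_of_fast_Lp_mass:
  fixes u :: "nat \<Rightarrow> 'a \<Rightarrow> 'b::{banach,second_countable_topology}"
  assumes [measurable]: "\<And>k. u k \<in> borel_measurable M" and p: "0 < p" and A: "0 \<le> A"
    and fast: "\<And>k. Lp_mass M p (\<lambda>x. u (Suc k) x - u k x) \<le> ennreal (A * ((1/4) powr p) ^ k)"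
  shows "AE x in M. convergent (\<lambda>k. u k x)"
proof -
  let ?r = "2 powr p" and ?d = "\<lambda>k x. norm (u (Suc k) x - u k x)"
  have r: "(?r * (1/4) powr p) < 1"
  proof -
    have "?r * (1/4) powr p = (1/2) powr p" by (simp add: powr_mult[symmetric])
    also have "\<dots> < 1" using powr_less_mono2[of p "1/2" 1] p by simp
    finally show ?thesis .
  qed
  have "(\<integral>\<^sup>+x. (\<Sum>k. ennreal (?r ^ k * ?d k x powr p)) \<partial>M) = (\<Sum>k. \<integral>\<^sup>+x. ennreal (?r ^ k * ?d k x powr p) \<partial>M)"
    by (rule nn_integral_suminf) measurable
  also have "\<dots> = (\<Sum>k. ennreal (?r ^ k) * Lp_mass M p (\<lambda>x. u (Suc k) x - u k x))"
    unfolding Lp_mass_def by (intro suminf_cong) (simp add: ennreal_mult nn_integral_cmult)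
  also have "\<dots> \<le> (\<Sum>k. ennreal (A * (?r * (1/4) powr p) ^ k))"
  proof (intro suminf_le summableI)
    fix k
    have "ennreal (?r ^ k) * Lp_mass M p (\<lambda>x. u (Suc k) x - u k x) \<le> ennreal (?r ^ k) * ennreal (A * ((1/4) powr p) ^ k)"
      by (intro mult_left_mono fast) auto
    also have "\<dots> = ennreal (A * (?r * (1/4) powr p) ^ k)"
      using A by (simp add: ennreal_mult[symmetric] power_mult_distrib mult_ac)
    finally show "ennreal (?r ^ k) * Lp_mass M p (\<lambda>x. u (Suc k) x - u k x) \<le> ennreal (A * (?r * (1/4) powr p) ^ k)" .
  qed
  also have "\<dots> = ennreal (\<Sum>k. A * (?r * (1/4) powr p) ^ k)"
    using A r by (intro suminf_ennreal2 summable_mult summable_geometric) auto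
  finally have "(\<integral>\<^sup>+x. (\<Sum>k. ennreal (?r ^ k * ?d k x powr p)) \<partial>M) \<noteq> \<infinity>"
    by (auto simp: top_unique)
  then have "AE x in M. (\<Sum>k. ennreal (?r ^ k * ?d k x powr p)) \<noteq> \<infinity>"
    by (intro nn_integral_PInf_AE) measurable
  then show ?thesis
  proof eventually_elim
    case (elim x)
    define S where "S = enn2real (\<Sum>k. ennreal (?r ^ k * ?d k x powr p))"
    have S: "(\<Sum>k. ennreal (?r ^ k * ?d k x powr p)) = ennreal S" "S \<ge> 0"
      using elim by (auto simp: S_def less_top)
    have dk: "?d k x \<le> S powr (1 / p) * (1/2) ^ k" for k
    proof -
      define F where "F k = ennreal (?r ^ k * ?d k x powr p)" for k
      have "sum F {k} \<le> suminf F" by (rule sum_le_suminf) auto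
      then have "F k \<le> ennreal S" using S(1) by (simp add: F_def[abs_def])
      then have "?r ^ k * ?d k x powr p \<le> S" using S(2) by (simp add: F_def)
      moreover have "?r ^ k * ?d k x powr p = (2 ^ k * ?d k x) powr p"
        by (simp add: powr_mult powr_power powr_realpow[symmetric] powr_powr mult.commute)
      ultimately have "((2 ^ k * ?d k x) powr p) powr (1 / p) \<le> S powr (1 / p)"
        using p by (intro powr_mono2) auto
      then have "2 ^ k * ?d k x \<le> S powr (1 / p)" using p by (simp add: powr_powr)
      then show ?thesis by (simp add: field_simps power_one_over)
    qed
    have "summable (\<lambda>k. u (Suc k) x - u k x)"
    proof (rule summable_comparison_test)
      show "\<exists>N. \<forall>n\<ge>N. ?d n x \<le> S powr (1 / p) * (1/2) ^ n" using dk by blast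
      show "summable (\<lambda>n. S powr (1 / p) * (1/2::real) ^ n)" by (intro summable_mult summable_geometric) auto
    qed
    then have "convergent (\<lambda>n. \<Sum>k<n. u (Suc k) x - u k x)" by (simp add: summable_iff_convergent)
    then have "convergent (\<lambda>n. u n x - u 0 x)" by (simp only: sum_lessThan_telescope[of "\<lambda>k. u k x"])
    then show ?case by (subst (asm) convergent_diff_const_right_iff)
  qed
qed

text \<open>For \<open>f\<close> in \<open>L\<^sup>p\<close>, a fast approximating sequence from \<open>D\<close> has images that converge almost everywhere,
  and the limit \<open>u\<close> satisfies \<open>Lp_mass (u - W h) \<le> K Lp_mass (f - h)\<close> for all \<open>h \<in> D\<close> by Fatou's
  lemma. This inequality determines \<open>u\<close> almost everywhere, so it is taken as the definition of \<open>T f\<close>;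
  well-definedness, linearity, boundedness and agreement with \<open>W\<close> on \<open>D\<close> all follow from it alone.\<close>

lemma bounded_extension:
  fixes D :: "('a::euclidean_space \<Rightarrow> complex) set" and W :: "('a \<Rightarrow> complex) \<Rightarrow> 'a \<Rightarrow> complex"
  assumes p: "0 < p" and C: "0 < C"
    and D: "D \<subseteq> Lp_space p" "\<And>f g. f \<in> D \<Longrightarrow> g \<in> D \<Longrightarrow> (\<lambda>x. f x + g x) \<in> D" "\<And>f c. f \<in> D \<Longrightarrow> (\<lambda>x. c * f x) \<in> D"
    and dense: "\<And>f e. f \<in> Lp_space p \<Longrightarrow> 0 < e \<Longrightarrow> \<exists>h\<in>D. Lp_mass lebesgue p (\<lambda>x. f x - h x) \<le> ennreal e"
    and Wm: "\<And>f. f \<in> D \<Longrightarrow> W f \<in> borel_measurable lebesgue"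
    and Wadd: "\<And>f g x. f \<in> D \<Longrightarrow> g \<in> D \<Longrightarrow> W (\<lambda>x. f x + g x) x = W f x + W g x"
    and Wscale: "\<And>f c x. f \<in> D \<Longrightarrow> W (\<lambda>x. c * f x) x = c * W f x"
    and Wle: "\<And>f. f \<in> D \<Longrightarrow> Lp_mass lebesgue p (W f) \<le> ennreal C * Lp_mass lebesgue p f"
  obtains T where "bounded_linear_on_Lp p T" "\<And>f. f \<in> D \<Longrightarrow> AE x in lebesgue. T f x = W f x"
    "\<exists>C>0. \<forall>f\<in>Lp_space p. Lp_norm p (T f) \<le> C * Lp_norm p f"
proof -
  let ?m = "Lp_mass (lebesgue :: 'a measure) p"
  let ?d = "\<lambda>f g. ?m (\<lambda>x. f x - g x)"
  define q where "q = 2 powr p"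
  have q: "q > 0" by (simp add: q_def)
  have Dm: "f \<in> borel_measurable lebesgue" if "f \<in> D" for f using D(1) that by (auto simp: Lp_space_def)
  have tri: "?d f g \<le> ennreal q * (?d f h + ?d h g)"
    if "f \<in> borel_measurable lebesgue" "g \<in> borel_measurable lebesgue" "h \<in> borel_measurable lebesgue" for f g h :: "'a \<Rightarrow> complex"
    unfolding q_def using that p by (intro Lp_mass_triangle) auto
  have Ddiff: "(\<lambda>x. f x - g x) \<in> D" "W (\<lambda>x. f x - g x) x = W f x - W g x" if fg: "f \<in> D" "g \<in> D" for f g x
  proof -
    have eq: "(\<lambda>x. f x - g x) = (\<lambda>x. f x + (-1) * g x)" by auto
    show "(\<lambda>x. f x - g x) \<in> D" unfolding eq by (intro D fg)
    show "W (\<lambda>x. f x - g x) x = W f x - W g x"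
      unfolding eq using Wadd[OF fg(1) D(3)[OF fg(2)], of "-1" x] Wscale[OF fg(2), of "-1" x] by simp
  qed
  have Wdiff: "?d (W f) (W g) \<le> ennreal C * ?d f g" if "f \<in> D" "g \<in> D" for f g
    using Wle[OF Ddiff(1)[OF that]] Ddiff(2)[OF that] by (simp add: Lp_mass_def)
  define K where "K = C * q"
  have K: "K > 0" using C q by (simp add: K_def)
  have ex: "\<exists>u. u \<in> borel_measurable lebesgue \<and> (\<forall>h\<in>D. ?d u (W h) \<le> ennreal K * ?d f h)"
    if f: "f \<in> Lp_space p" for f
  proof -
    have fm[measurable]: "f \<in> borel_measurable lebesgue" using f by (simp add: Lp_space_def)
    \<comment> \<open>the masses of the errors decrease like \<open>r\<^sup>k\<close>, fast enough for almost everywhere convergence\<close>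
    let ?r = "(1/4) powr p"
    have r: "?r < 1" "0 < ?r" using powr_less_mono2[of p "1/4" 1] p by auto
    have "\<forall>k. \<exists>h\<in>D. ?d f h \<le> ennreal (?r ^ k)" using dense[OF f] r by simp
    then obtain h where h: "\<And>k. h k \<in> D" "\<And>k. ?d f (h k) \<le> ennreal (?r ^ k)" by metis
    have hm[measurable]: "h k \<in> borel_measurable lebesgue" "W (h k) \<in> borel_measurable lebesgue" for k
      using h Dm Wm by auto
    have "AE x in lebesgue. convergent (\<lambda>k. W (h k) x)"
    proof (rule AE_convergent_of_fast_Lp_mass[OF hm(2) p])
      fix k
      have "?d (W (h (Suc k))) (W (h k)) \<le> ennreal C * ?d (h (Suc k)) (h k)"
        by (intro Wdiff h)
      also have "?d (h (Suc k)) (h k) \<le> ennreal q * (?d (h (Suc k)) f + ?d f (h k))"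
        by (intro tri) auto
      also have "?d (h (Suc k)) f \<le> ennreal (?r ^ k)"
      proof -
        have "?r ^ Suc k \<le> ?r ^ k" using r by (intro power_decreasing) auto
        then show ?thesis using h(2)[of "Suc k"] unfolding Lp_mass_commute[of _ _ "h (Suc k)"]
          by (meson ennreal_leI order_trans)
      qed
      also have "?d f (h k) \<le> ennreal (?r ^ k)" by (rule h)
      finally have "?d (W (h (Suc k))) (W (h k)) \<le> ennreal C * (ennreal q * (ennreal (?r ^ k) + ennreal (?r ^ k)))"
        by (simp add: mult_left_mono add_mono)
      also have "\<dots> = ennreal ((2 * K) * ?r ^ k)"
        using C q r by (simp add: K_def ennreal_mult[symmetric] ennreal_plus[symmetric] mult_ac del: ennreal_plus)
      finally show "?d (W (h (Suc k))) (W (h k)) \<le> ennreal ((2 * K) * ?r ^ k)" .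
    qed (use K in simp)
    define u where "u x = lim (\<lambda>k. W (h k) x)" for x
    have ulim: "AE x in lebesgue. (\<lambda>k. W (h k) x) \<longlonglongrightarrow> u x"
      using \<open>AE x in lebesgue. convergent _\<close> by eventually_elim (simp add: u_def convergent_LIMSEQ_iff)
    have um[measurable]: "u \<in> borel_measurable lebesgue"
      unfolding u_def by (rule borel_measurable_lim_metric) (rule hm)
    have "?d u (W g) \<le> ennreal K * ?d f g" if g: "g \<in> D" for g
    proof (rule Lp_mass_le_of_AE_limit[OF _ p])
      show "(\<lambda>x. W (h k) x - W g x) \<in> borel_measurable lebesgue" for k using Wm[OF g] by measurable
      show "AE x in lebesgue. (\<lambda>k. W (h k) x - W g x) \<longlonglongrightarrow> u x - W g x"
        using ulim by eventually_elim (intro tendsto_intros)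
      fix k
      have "?d (W (h k)) (W g) \<le> ennreal C * ?d (h k) g" by (intro Wdiff h g)
      also have "?d (h k) g \<le> ennreal q * (?d (h k) f + ?d f g)"
        using Dm[OF g] by (intro tri) auto
      also have "?d (h k) f \<le> ennreal (?r ^ k)" using h(2)[of k] by (simp add: Lp_mass_commute[of _ _ "h k"])
      finally have "?d (W (h k)) (W g) \<le> ennreal C * (ennreal q * (ennreal (?r ^ k) + ?d f g))"
        by (simp add: mult_left_mono add_right_mono)
      also have "\<dots> = ennreal K * (ennreal (?r ^ k) + ?d f g)"
        using C q by (simp add: K_def ennreal_mult mult.assoc)
      finally show "?d (W (h k)) (W g) \<le> ennreal K * (ennreal (?r ^ k) + ?d f g)" .
    next
      have "(\<lambda>k. ?r ^ k) \<longlonglongrightarrow> 0" using r by (intro LIMSEQ_power_zero) auto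
      then have "(\<lambda>k. ennreal K * (ennreal (?r ^ k) + ?d f g)) \<longlonglongrightarrow> ennreal K * (ennreal 0 + ?d f g)"
        by (intro ennreal_tendsto_cmult tendsto_add tendsto_ennrealI tendsto_const) auto
      then show "(\<lambda>k. ennreal K * (ennreal (?r ^ k) + ?d f g)) \<longlonglongrightarrow> ennreal K * ?d f g" by simp
    qed
    with um show ?thesis by blast
  qed
  define T where "T f = (SOME u. u \<in> borel_measurable lebesgue \<and> (\<forall>h\<in>D. ?d u (W h) \<le> ennreal K * ?d f h))" for f
  have T: "T f \<in> borel_measurable lebesgue" "\<And>h. h \<in> D \<Longrightarrow> ?d (T f) (W h) \<le> ennreal K * ?d f h"
    if "f \<in> Lp_space p" for f
    using someI_ex[OF ex[OF that]] by (auto simp: T_def)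
  \<comment> \<open>\<open>u\<close> and \<open>T f\<close> are both close to \<open>W h\<close> when \<open>h\<close> is close to \<open>f\<close>\<close>
  have uniq: "AE x in lebesgue. u x = T f x"
    if f: "f \<in> Lp_space p" and u: "u \<in> borel_measurable lebesgue" and A: "A \<ge> 0"
      and ap: "\<And>e. e > 0 \<Longrightarrow> \<exists>h\<in>D. ?d f h \<le> ennreal (A * e) \<and> ?d u (W h) \<le> ennreal (A * e)" for f u A
  proof (rule AE_eq_of_Lp_mass_small[OF u T(1)[OF f], of p "q * (A + K * A)"])
    fix e :: real assume e: "e > 0"
    obtain h where h: "h \<in> D" "?d f h \<le> ennreal (A * e)" "?d u (W h) \<le> ennreal (A * e)"
      using ap[OF e] by blast
    have "?d u (T f) \<le> ennreal q * (?d u (W h) + ?d (W h) (T f))"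
      by (intro tri u T(1) f Wm h)
    also have "?d (W h) (T f) \<le> ennreal K * ?d f h"
      using T(2)[OF f h(1)] by (simp add: Lp_mass_commute[of _ _ "W h"])
    also have "?d f h \<le> ennreal (A * e)" by (rule h)
    also have "?d u (W h) \<le> ennreal (A * e)" by (rule h)
    finally have "?d u (T f) \<le> ennreal q * (ennreal (A * e) + ennreal K * ennreal (A * e))"
      by (simp add: mult_left_mono add_mono)
    also have "\<dots> = ennreal (q * (A + K * A) * e)"
      using q K A e by (simp add: ennreal_mult[symmetric] ennreal_plus[symmetric] algebra_simps del: ennreal_plus)
    finally show "?d u (T f) \<le> ennreal (q * (A + K * A) * e)" .
  qed
  have zero: "(\<lambda>x. 0) \<in> Lp_space p" by (simp add: Lp_space_def)
  obtain h0 where "h0 \<in> D" using dense[OF zero, of 1] by auto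
  then have D0: "(\<lambda>x. 0) \<in> D" and W0: "W (\<lambda>x. 0) = (\<lambda>x. 0)"
    using D(3)[of h0 0] Wscale[of h0 0] by auto
  have Tle: "?m (T f) \<le> ennreal K * ?m f" if "f \<in> Lp_space p" for f
    using T(2)[OF that D0] by (simp add: W0)
  have TLp: "T f \<in> Lp_space p" if f: "f \<in> Lp_space p" for f
    using Tle[OF f] T(1)[OF f] f by (auto simp: Lp_space_iff_mass ennreal_mult_less_top intro: le_less_trans)
  have bound: "\<forall>f\<in>Lp_space p. Lp_norm p (T f) \<le> K powr (1 / p) * Lp_norm p f"
    using Lp_norm_le_of_mass_le[OF p _ TLp _ Tle] K by auto
  have Dense: "\<exists>h\<in>D. ?d f h \<le> ennreal e \<and> ?d (T f) (W h) \<le> ennreal (K * e)"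
    if f: "f \<in> Lp_space p" and e: "0 < e" for f e
  proof -
    obtain h where h: "h \<in> D" "?d f h \<le> ennreal e" using dense[OF f e] by blast
    have "?d (T f) (W h) \<le> ennreal K * ?d f h" by (rule T(2)[OF f h(1)])
    also have "\<dots> \<le> ennreal K * ennreal e" by (intro mult_left_mono h) auto
    finally show ?thesis using h K e by (auto simp: ennreal_mult)
  qed
  have Lp_add: "(\<lambda>x. f x + g x) \<in> Lp_space p" if f: "f \<in> Lp_space p" and g: "g \<in> Lp_space p"
    for f g :: "'a \<Rightarrow> complex"
  proof -
    have [measurable]: "f \<in> borel_measurable lebesgue" "g \<in> borel_measurable lebesgue"
      using f g by (auto simp: Lp_space_def)
    have "?m (\<lambda>x. f x + g x) \<le> ennreal (2 powr p) * (?m f + ?m g)"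
      using p by (intro Lp_mass_norm_add_le norm_triangle_ineq) auto
    also have "\<dots> < top" using f g by (auto simp: Lp_space_iff_mass ennreal_mult_less_top)
    finally show ?thesis by (simp add: Lp_space_iff_mass)
  qed
  have msc: "?m (\<lambda>x. c * f x) = ennreal (norm c powr p) * ?m f" if "f \<in> borel_measurable lebesgue"
    for c :: complex and f :: "'a \<Rightarrow> complex"
    using that by (intro Lp_mass_scale) (auto simp: norm_mult)
  have "bounded_linear_on_Lp p T"
    unfolding bounded_linear_on_Lp_def
  proof (intro conjI ballI allI impI)
    fix f g :: "'a \<Rightarrow> complex" assume f: "f \<in> Lp_space p" and g: "g \<in> Lp_space p" and eq: "AE x in lebesgue. f x = g x"
    show "AE x in lebesgue. T f x = T g x"
    proof (rule uniq[OF g T(1)[OF f], of "1 + K"])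
      fix e :: real assume e: "e > 0"
      obtain h where h: "h \<in> D" "?d f h \<le> ennreal e" "?d (T f) (W h) \<le> ennreal (K * e)"
        using Dense[OF f e] by blast
      have "?d g h = ?d f h"
        unfolding Lp_mass_def by (rule nn_integral_cong_AE) (use eq in \<open>eventually_elim, simp\<close>)
      moreover have "e \<le> (1 + K) * e" "K * e \<le> (1 + K) * e" using e K by (auto simp: distrib_right)
      ultimately show "\<exists>h\<in>D. ?d g h \<le> ennreal ((1 + K) * e) \<and> ?d (T f) (W h) \<le> ennreal ((1 + K) * e)"
        using h by (metis ennreal_leI order_trans)
    qed (use K in simp)
  next
    fix f g :: "'a \<Rightarrow> complex" assume f: "f \<in> Lp_space p" and g: "g \<in> Lp_space p"
    have [measurable]: "f \<in> borel_measurable lebesgue" "g \<in> borel_measurable lebesgue"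
      "T f \<in> borel_measurable lebesgue" "T g \<in> borel_measurable lebesgue"
      using f g T(1) by (auto simp: Lp_space_def)
    have "AE x in lebesgue. T f x + T g x = T (\<lambda>x. f x + g x) x"
    proof (rule uniq[OF Lp_add[OF f g], of _ "q * (2 + 2 * K)"])
      fix e :: real assume e: "e > 0"
      obtain h where h: "h \<in> D" "?d f h \<le> ennreal e" "?d (T f) (W h) \<le> ennreal (K * e)"
        using Dense[OF f e] by blast
      obtain h' where h': "h' \<in> D" "?d g h' \<le> ennreal e" "?d (T g) (W h') \<le> ennreal (K * e)"
        using Dense[OF g e] by blast
      note [measurable] = Dm[OF h(1)] Dm[OF h'(1)] Wm[OF h(1)] Wm[OF h'(1)]
      have two: "?m (\<lambda>x. a x + b x - (c x + d x)) \<le> ennreal (q * (2 + 2 * K) * e)"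
        if [measurable]: "a \<in> borel_measurable lebesgue" "b \<in> borel_measurable lebesgue" "c \<in> borel_measurable lebesgue" "d \<in> borel_measurable lebesgue"
          and ab: "?d a c \<le> ennreal (r * e)" "?d b d \<le> ennreal (r * e)" and r: "0 \<le> r" "r \<le> 1 + K"
        for a b c d :: "'a \<Rightarrow> complex" and r
      proof -
        have "?m (\<lambda>x. a x + b x - (c x + d x)) \<le> ennreal (2 powr p) * (?d a c + ?d b d)"
          using p by (intro Lp_mass_norm_add_le) (auto simp: add_diff_add norm_triangle_ineq)
        also have "\<dots> \<le> ennreal (2 powr p) * (ennreal (r * e) + ennreal (r * e))"
          by (intro mult_left_mono add_mono ab) auto
        also have "\<dots> = ennreal (q * (2 * r) * e)"
          using q r e by (simp add: q_def[symmetric] ennreal_mult[symmetric] ennreal_plus[symmetric] mult_ac del: ennreal_plus)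
        also have "\<dots> \<le> ennreal (q * (2 + 2 * K) * e)"
          using r q e by (intro ennreal_leI mult_right_mono mult_left_mono) auto
        finally show ?thesis .
      qed
      show "\<exists>h\<in>D. ?m (\<lambda>x. f x + g x - h x) \<le> ennreal (q * (2 + 2 * K) * e) \<and>
          ?m (\<lambda>x. T f x + T g x - W h x) \<le> ennreal (q * (2 + 2 * K) * e)"
      proof (intro bexI[of _ "\<lambda>x. h x + h' x"] conjI)
        show "?m (\<lambda>x. f x + g x - (h x + h' x)) \<le> ennreal (q * (2 + 2 * K) * e)"
          using h(2) h'(2) K by (intro two[of _ _ _ _ 1]) auto
        show "?m (\<lambda>x. T f x + T g x - W (\<lambda>x. h x + h' x) x) \<le> ennreal (q * (2 + 2 * K) * e)"
          unfolding Wadd[OF h(1) h'(1)] using h(3) h'(3) K by (intro two[of _ _ _ _ K]) auto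
      qed (intro D h h')
    qed (use q K in auto)
    then show "AE x in lebesgue. T (\<lambda>y. f y + g y) x = T f x + T g x" by eventually_elim simp
  next
    fix c and f :: "'a \<Rightarrow> complex" assume f: "f \<in> Lp_space p"
    have [measurable]: "f \<in> borel_measurable lebesgue" "T f \<in> borel_measurable lebesgue"
      using f T(1) by (auto simp: Lp_space_def)
    have cf: "(\<lambda>x. c * f x) \<in> Lp_space p"
      using f by (auto simp: Lp_space_iff_mass msc ennreal_mult_less_top)
    have "AE x in lebesgue. c * T f x = T (\<lambda>x. c * f x) x"
    proof (rule uniq[OF cf, of _ "norm c powr p * (1 + K)"])
      fix e :: real assume e: "e > 0"
      obtain h where h: "h \<in> D" "?d f h \<le> ennreal e" "?d (T f) (W h) \<le> ennreal (K * e)"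
        using Dense[OF f e] by blast
      note [measurable] = Dm[OF h(1)] Wm[OF h(1)]
      have one: "?m (\<lambda>x. c * a x - c * b x) \<le> ennreal (norm c powr p * (1 + K) * e)"
        if [measurable]: "a \<in> borel_measurable lebesgue" "b \<in> borel_measurable lebesgue"
          and ab: "?d a b \<le> ennreal (r * e)" and r: "0 \<le> r" "r \<le> 1 + K" for a b :: "'a \<Rightarrow> complex" and r
      proof -
        have "?m (\<lambda>x. c * a x - c * b x) = ennreal (norm c powr p) * ?d a b"
          unfolding right_diff_distrib[symmetric] by (rule msc) measurable
        also have "\<dots> \<le> ennreal (norm c powr p) * ennreal (r * e)" by (intro mult_left_mono ab) auto
        also have "\<dots> = ennreal (norm c powr p * r * e)"
          using r e by (simp add: ennreal_mult[symmetric] mult_ac)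
        also have "\<dots> \<le> ennreal (norm c powr p * (1 + K) * e)"
          using r e by (intro ennreal_leI mult_right_mono mult_left_mono) auto
        finally show ?thesis .
      qed
      show "\<exists>h\<in>D. ?m (\<lambda>x. c * f x - h x) \<le> ennreal (norm c powr p * (1 + K) * e) \<and>
          ?m (\<lambda>x. c * T f x - W h x) \<le> ennreal (norm c powr p * (1 + K) * e)"
      proof (intro bexI[of _ "\<lambda>x. c * h x"] conjI)
        show "?m (\<lambda>x. c * f x - c * h x) \<le> ennreal (norm c powr p * (1 + K) * e)"
          using h(2) K by (intro one[of _ _ 1]) auto
        show "?m (\<lambda>x. c * T f x - W (\<lambda>x. c * h x) x) \<le> ennreal (norm c powr p * (1 + K) * e)"
          unfolding Wscale[OF h(1)] using h(3) K by (intro one[of _ _ K]) auto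
      qed (intro D h)
    qed (use K in auto)
    then show "AE x in lebesgue. T (\<lambda>y. c * f y) x = c * T f x" by eventually_elim simp
  next
    show "\<exists>C. \<forall>f\<in>Lp_space p. Lp_norm p (T f) \<le> C * Lp_norm p f" using bound by blast
  qed (rule TLp)
  moreover have "AE x in lebesgue. T f x = W f x" if f: "f \<in> D" for f
  proof -
    have "AE x in lebesgue. W f x = T f x"
      by (rule uniq[of f "W f" 0]) (use f D(1) Wm in \<open>auto simp: Lp_mass_def intro!: bexI[of _ f]\<close>)
    then show ?thesis by eventually_elim simp
  qed
  moreover have "\<exists>C>0. \<forall>f\<in>Lp_space p. Lp_norm p (T f) \<le> C * Lp_norm p f"
    using bound K by (intro exI[of _ "K powr (1 / p)"]) auto
  ultimately show thesis using that by blast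
qed

section \<open>Density in \<open>L\<^sup>p\<close>\<close>

lemma Lp_mass_dominated_small:
  fixes u :: "nat \<Rightarrow> 'a \<Rightarrow> complex"
  assumes [measurable]: "f \<in> borel_measurable M" "\<And>k. u k \<in> borel_measurable M" "G \<in> borel_measurable M"
    and p: "0 < p" and lim: "\<And>x. (\<lambda>k. u k x) \<longlonglongrightarrow> f x"
    and dom: "\<And>k x. norm (f x - u k x) \<le> norm (G x)" and G: "Lp_mass M p (G :: 'a \<Rightarrow> real) < top"
    and e: "0 < e"
  obtains k where "Lp_mass M p (\<lambda>x. f x - u k x) \<le> ennreal e"
proof -
  have "(\<lambda>k. \<integral>\<^sup>+x. ennreal (norm (f x - u k x) powr p) \<partial>M) \<longlonglongrightarrow> (\<integral>\<^sup>+x. 0 \<partial>M)"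
  proof (rule nn_integral_dominated_convergence[where w = "\<lambda>x. ennreal (norm (G x) powr p)"])
    show "AE x in M. ennreal (norm (f x - u k x) powr p) \<le> ennreal (norm (G x) powr p)" for k
      using p dom by (intro AE_I2 ennreal_leI powr_mono2) auto
    show "AE x in M. (\<lambda>k. ennreal (norm (f x - u k x) powr p)) \<longlonglongrightarrow> 0"
    proof (intro AE_I2)
      fix x
      have "(\<lambda>k. norm (f x - u k x) powr p) \<longlonglongrightarrow> norm (f x - f x) powr p"
        using p by (intro tendsto_powr2 tendsto_intros lim) auto
      then have "(\<lambda>k. ennreal (norm (f x - u k x) powr p)) \<longlonglongrightarrow> ennreal (norm (f x - f x) powr p)"
        by (rule tendsto_ennrealI)
      then show "(\<lambda>k. ennreal (norm (f x - u k x) powr p)) \<longlonglongrightarrow> 0" by simp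
    qed
  qed (use G in \<open>auto simp: Lp_mass_def\<close>)
  then have "(\<lambda>k. Lp_mass M p (\<lambda>x. f x - u k x)) \<longlonglongrightarrow> 0" by (simp add: Lp_mass_def)
  then have "\<forall>\<^sub>F k in sequentially. Lp_mass M p (\<lambda>x. f x - u k x) < ennreal e"
    using e by (intro order_tendstoD) auto
  then obtain k where "Lp_mass M p (\<lambda>x. f x - u k x) < ennreal e" by (auto simp: eventually_sequentially)
  then show thesis by (intro that[of k]) simp
qed

text \<open>The closure of the tame functions in \<open>L\<^sup>p\<close>. It is shown to contain the indicators of compact sets,
  then of sets of finite measure, and finally all of \<open>L\<^sup>p\<close>.\<close>

definition approximable :: "real \<Rightarrow> ('a::euclidean_space \<Rightarrow> complex) \<Rightarrow> bool" where
  "approximable p f \<longleftrightarrow> f \<in> borel_measurable lebesgue \<and>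
     (\<forall>e>0. \<exists>h. tame h \<and> Lp_mass lebesgue p (\<lambda>x. f x - h x) \<le> ennreal e)"

lemma tame_measurable_lebesgue: "tame f \<Longrightarrow> f \<in> borel_measurable lebesgue"
  by (rule measurable_completion) (simp add: tame_measurable)

text \<open>A bounded integrable function belongs to \<open>L\<^sup>p\<close> because \<open>\<bar>f\<bar>\<^sup>p \<le> B\<close> to the power \<open>p - 1\<close>, times \<open>\<bar>f\<bar>\<close>.\<close>

lemma tame_in_Lp_space:
  assumes f: "tame f" and p: "1 < p"
  shows "f \<in> Lp_space p"
proof -
  obtain B where B: "\<And>x. norm (f x) \<le> B" using f by (auto simp: tame_def)
  have B0: "B \<ge> 0" using B[of 0] norm_ge_zero order_trans by blast
  note [measurable] = tame_measurable[OF f]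
  have "Lp_mass lborel p f \<le> (\<integral>\<^sup>+x. ennreal (B powr (p - 1)) * ennreal (norm (f x)) \<partial>lborel)"
    unfolding Lp_mass_def
  proof (intro nn_integral_mono)
    fix x
    have "norm (f x) powr p = norm (f x) powr (p - 1) * norm (f x)"
      by (cases "f x = 0") (simp_all add: powr_diff)
    also have "\<dots> \<le> B powr (p - 1) * norm (f x)"
      using B p by (intro mult_right_mono powr_mono2) auto
    finally show "ennreal (norm (f x) powr p) \<le> ennreal (B powr (p - 1)) * ennreal (norm (f x))"
      by (simp add: ennreal_mult'[symmetric] ennreal_leI)
  qed
  also have "\<dots> = ennreal (B powr (p - 1)) * (\<integral>\<^sup>+x. ennreal (norm (f x)) \<partial>lborel)"
    by (intro nn_integral_cmult) measurable
  also have "\<dots> < top" using f by (auto simp: tame_def integrable_iff_bounded ennreal_mult_less_top)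
  finally show ?thesis
    by (simp add: Lp_space_iff_mass tame_measurable_lebesgue[OF f] Lp_mass_def nn_integral_completion)
qed

lemma approximable_limit:
  assumes p: "0 < p" and f: "f \<in> borel_measurable lebesgue"
    and ap: "\<And>e. e > 0 \<Longrightarrow> \<exists>g. approximable p g \<and> Lp_mass lebesgue p (\<lambda>x. f x - g x) \<le> ennreal e"
  shows "approximable p f"
  unfolding approximable_def
proof (intro conjI allI impI f)
  fix e :: real assume e: "e > 0"
  define d where "d = e / (2 * 2 powr p)"
  have d: "d > 0" using e by (simp add: d_def)
  obtain g where g: "approximable p g" "Lp_mass lebesgue p (\<lambda>x. f x - g x) \<le> ennreal d" using ap[OF d] by blast
  then obtain h where h: "tame h" "Lp_mass lebesgue p (\<lambda>x. g x - h x) \<le> ennreal d"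
    using d by (auto simp: approximable_def)
  have "Lp_mass lebesgue p (\<lambda>x. f x - h x)
      \<le> ennreal (2 powr p) * (Lp_mass lebesgue p (\<lambda>x. f x - g x) + Lp_mass lebesgue p (\<lambda>x. g x - h x))"
    using p f g h by (intro Lp_mass_triangle) (auto simp: approximable_def tame_measurable_lebesgue)
  also have "\<dots> \<le> ennreal (2 powr p) * (ennreal d + ennreal d)"
    by (intro mult_left_mono add_mono g h) auto
  also have "\<dots> = ennreal e"
    using d by (simp add: ennreal_mult[symmetric] ennreal_plus[symmetric] d_def del: ennreal_plus)
  finally show "\<exists>h. tame h \<and> Lp_mass lebesgue p (\<lambda>x. f x - h x) \<le> ennreal e" using h by blast
qed

lemma approximable_tame:
  assumes "tame f"
  shows "approximable p f"
  using assms unfolding approximable_def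
  by (auto simp: tame_measurable_lebesgue Lp_mass_def intro!: exI[of _ f])

lemma approximable_add:
  assumes p: "0 < p" and f: "approximable p f" and g: "approximable p g"
  shows "approximable p (\<lambda>x. f x + g x)"
  unfolding approximable_def
proof (intro conjI allI impI)
  have [measurable]: "f \<in> borel_measurable lebesgue" "g \<in> borel_measurable lebesgue"
    using f g by (auto simp: approximable_def)
  show "(\<lambda>x. f x + g x) \<in> borel_measurable lebesgue" by measurable
  fix e :: real assume e: "e > 0"
  define d where "d = e / (2 * 2 powr p)"
  have d: "d > 0" using e by (simp add: d_def)
  obtain h where h: "tame h" "Lp_mass lebesgue p (\<lambda>x. f x - h x) \<le> ennreal d"
    using f d by (auto simp: approximable_def)
  obtain h' where h': "tame h'" "Lp_mass lebesgue p (\<lambda>x. g x - h' x) \<le> ennreal d"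
    using g d by (auto simp: approximable_def)
  have "Lp_mass lebesgue p (\<lambda>x. f x + g x - (h x + h' x))
      \<le> ennreal (2 powr p) * (Lp_mass lebesgue p (\<lambda>x. f x - h x) + Lp_mass lebesgue p (\<lambda>x. g x - h' x))"
    using p tame_measurable_lebesgue[OF h(1)] tame_measurable_lebesgue[OF h'(1)]
    by (intro Lp_mass_norm_add_le) (auto simp: add_diff_add norm_triangle_ineq)
  also have "\<dots> \<le> ennreal (2 powr p) * (ennreal d + ennreal d)"
    by (intro mult_left_mono add_mono h h') auto
  also have "\<dots> = ennreal e"
    using d by (simp add: ennreal_mult[symmetric] ennreal_plus[symmetric] d_def del: ennreal_plus)
  finally show "\<exists>h. tame h \<and> Lp_mass lebesgue p (\<lambda>x. f x + g x - h x) \<le> ennreal e"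
    using tame_add[OF h(1) h'(1)] by blast
qed

lemma approximable_scale:
  assumes f: "approximable p f"
  shows "approximable p (\<lambda>x. c * f x)"
  unfolding approximable_def
proof (intro conjI allI impI)
  have [measurable]: "f \<in> borel_measurable lebesgue" using f by (auto simp: approximable_def)
  show "(\<lambda>x. c * f x) \<in> borel_measurable lebesgue" by measurable
  fix e :: real assume e: "e > 0"
  define d where "d = e / (norm c powr p + 1)"
  have d: "d > 0" using e by (simp add: d_def add_nonneg_pos)
  obtain h where h: "tame h" "Lp_mass lebesgue p (\<lambda>x. f x - h x) \<le> ennreal d"
    using f d by (auto simp: approximable_def)
  have "Lp_mass lebesgue p (\<lambda>x. c * f x - c * h x) = ennreal (norm c powr p) * Lp_mass lebesgue p (\<lambda>x. f x - h x)"
    using tame_measurable_lebesgue[OF h(1)]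
    by (intro Lp_mass_scale) (auto simp: norm_mult right_diff_distrib[symmetric])
  also have "\<dots> \<le> ennreal (norm c powr p) * ennreal d" by (intro mult_left_mono h) auto
  also have "\<dots> = ennreal (norm c powr p * d)" using d by (simp add: ennreal_mult)
  also have "norm c powr p * d \<le> e"
  proof -
    have "norm c powr p * d \<le> (norm c powr p + 1) * d" using d by (intro mult_right_mono) auto
    also have "\<dots> = e" unfolding d_def using powr_ge_zero[of "norm c" p] by (simp add: add_nonneg_eq_0_iff)
    finally show ?thesis .
  qed
  finally show "\<exists>h. tame h \<and> Lp_mass lebesgue p (\<lambda>x. c * f x - h x) \<le> ennreal e"
    using tame_scale[OF h(1)] by (metis ennreal_leI)
qed

text \<open>The functions \<open>max 0 (1 - m dist(x, K))\<close> are Lipschitz with compact support and converge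
  to the indicator of \<open>K\<close>, because \<open>K\<close> is closed.\<close>

lemma approximable_compact:
  fixes K :: "'a::euclidean_space set"
  assumes p: "0 < p" and K: "compact K"
  shows "approximable p (\<lambda>x. of_real (indicator K x))"
proof (cases "K = {}")
  case True
  have "tame (\<lambda>x::'a. 0)" by (auto simp: tame_def intro!: exI[of _ 0])
  then show ?thesis using True by (simp add: approximable_tame)
next
  case False
  have Kb[measurable]: "K \<in> sets borel" using K by (simp add: borel_closed compact_imp_closed)
  obtain R where R: "R > 0" "\<And>x. x \<in> K \<Longrightarrow> norm x \<le> R" using compact_imp_bounded[OF K] by (auto simp: bounded_pos)
  define u where "u m x = complex_of_real (max 0 (1 - real (Suc m) * infdist x K))" for m x
  have supp: "u m x = 0" if "x \<notin> cball 0 (R + 1)" for m x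
  proof -
    have "infdist x K \<ge> 1"
    proof (rule ccontr)
      assume "\<not> infdist x K \<ge> 1"
      obtain y where "y \<in> K" "infdist x K = dist x y"
        using infdist_attains_inf[OF compact_imp_closed[OF K] False] by blast
      then have "norm x < R + 1"
        using \<open>\<not> infdist x K \<ge> 1\<close> R(2)[of y] norm_triangle_sub[of x y] by (auto simp: dist_norm)
      then show False using that by simp
    qed
    then have "1 * 1 \<le> real (Suc m) * infdist x K" by (intro mult_mono) auto
    then show ?thesis by (simp add: u_def)
  qed
  have ub: "norm (u m x) \<le> 1" for m x using infdist_nonneg[of x K] by (simp add: u_def)
  have um: "u m \<in> borel_measurable borel" for m
    unfolding u_def by (intro borel_measurable_continuous_onI continuous_intros)
  have box: "integrable lborel (indicator (cball (0::'a) (R + 1)) :: 'a \<Rightarrow> real)"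
    using emeasure_compact_finite[OF compact_cball] by (intro integrable_real_indicator) auto
  have tame: "tame (u m)" for m
    unfolding tame_def
  proof (intro conjI)
    show "integrable lborel (u m)"
      by (rule Bochner_Integration.integrable_bound[OF box])
        (use um supp ub in \<open>auto simp: indicator_def intro!: AE_I2\<close>)
    show "\<exists>B. \<forall>x. norm (u m x) \<le> B" using ub by blast
    show "\<exists>L. \<forall>x y. norm (u m x - u m y) \<le> L * norm (x - y)"
    proof (intro exI[of _ "real (Suc m)"] allI)
      fix x y
      have "norm (u m x - u m y) \<le> \<bar>real (Suc m) * infdist x K - real (Suc m) * infdist y K\<bar>"
        unfolding u_def of_real_diff[symmetric] norm_of_real by (auto simp: max_def)
      also have "\<dots> = real (Suc m) * \<bar>infdist x K - infdist y K\<bar>"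
        by (simp add: abs_mult right_diff_distrib[symmetric] del: of_nat_Suc)
      also have "\<dots> \<le> real (Suc m) * norm (x - y)"
        using infdist_triangle_abs[of x K y] by (intro mult_left_mono) (auto simp: dist_norm)
      finally show "norm (u m x - u m y) \<le> real (Suc m) * norm (x - y)" .
    qed
  qed
  show ?thesis
  proof (rule approximable_limit[OF p])
    show "(\<lambda>x. complex_of_real (indicator K x)) \<in> borel_measurable lebesgue"
      by (rule measurable_completion) simp
    fix e :: real assume e: "e > 0"
    have "\<exists>k. Lp_mass lebesgue p (\<lambda>x. of_real (indicator K x) - u k x) \<le> ennreal e"
    proof (rule Lp_mass_dominated_small[where G = "indicator (cball (0::'a) (R + 1)) :: 'a \<Rightarrow> real", OF _ _ _ p _ _ _ e])
      show "(\<lambda>x. complex_of_real (indicator K x)) \<in> borel_measurable lebesgue"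
        by (rule measurable_completion) simp
      show "u k \<in> borel_measurable lebesgue" for k by (rule tame_measurable_lebesgue[OF tame])
      show "(indicator (cball (0::'a) (R + 1)) :: 'a \<Rightarrow> real) \<in> borel_measurable lebesgue"
        by (rule borel_measurable_indicator) simp
      show "(\<lambda>k. u k x) \<longlonglongrightarrow> of_real (indicator K x)" for x
      proof (cases "x \<in> K")
        case True then show ?thesis by (simp add: u_def)
      next
        case F: False
        then have pos: "infdist x K > 0"
          using in_closed_iff_infdist_zero[OF compact_imp_closed[OF K] False] infdist_nonneg[of x K] by (simp add: less_le)
        then obtain k0 where k0: "1 / infdist x K < real k0" using reals_Archimedean2 by blast
        have "\<forall>\<^sub>F k in sequentially. u k x = 0"
          using eventually_ge_at_top[of k0]
        proof eventually_elim
          case (elim k)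
          have "1 / infdist x K \<le> real (Suc k)" using k0 elim by linarith
          then show ?case using pos by (simp add: u_def divide_le_eq)
        qed
        then show ?thesis using F by (simp add: tendsto_eventually)
      qed
      show "norm (of_real (indicator K x) - u k x) \<le> norm (indicator (cball (0::'a) (R + 1)) x :: real)" for k x
      proof (cases "x \<in> cball 0 (R + 1)")
        case True
        have "norm (of_real (indicator K x) - u k x) \<le> 1"
          unfolding u_def of_real_diff[symmetric] norm_of_real using infdist_nonneg[of x K]
          by (auto simp: indicator_def max_def)
        then show ?thesis using True by simp
      next
        case False
        then have "x \<notin> K" using R by force
        then show ?thesis using supp[OF False] False by simp
      qed
      have "Lp_mass lebesgue p (indicator (cball (0::'a) (R + 1)) :: 'a \<Rightarrow> real) = emeasure lebesgue (cball (0::'a) (R + 1))"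
      proof -
        have "ennreal (norm (indicator (cball (0::'a) (R + 1)) x :: real) powr p) = indicator (cball (0::'a) (R + 1)) x" for x
          by (simp add: indicator_def)
        then show ?thesis by (simp add: Lp_mass_def)
      qed
      then show "Lp_mass lebesgue p (indicator (cball (0::'a) (R + 1)) :: 'a \<Rightarrow> real) < top"
        using emeasure_compact_finite[OF compact_cball, of "0::'a" "R + 1"] by simp
    qed blast
    then show "\<exists>g. approximable p g \<and> Lp_mass lebesgue p (\<lambda>x. of_real (indicator K x) - g x) \<le> ennreal e"
      using approximable_tame[OF tame] by blast
  qed
qed

text \<open>Intersecting with large balls reduces to bounded sets, and these are approximated from inside by
  closed sets, which are then compact.\<close>

lemma approximable_indicator:
  fixes E :: "'a::euclidean_space set"
  assumes p: "0 < p" and E: "E \<in> sets lebesgue" "emeasure lebesgue E < top"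
  shows "approximable p (\<lambda>x. of_real (indicator E x))"
proof -
  have mI: "Lp_mass lebesgue p (\<lambda>x. complex_of_real (indicator A x)) = emeasure lebesgue A" if "A \<in> sets lebesgue" for A :: "'a set"
  proof -
    have "ennreal (norm (complex_of_real (indicator A x)) powr p) = indicator A x" for x
      by (simp add: indicator_def)
    then show ?thesis using that by (simp add: Lp_mass_def)
  qed
  have bdd: "approximable p (\<lambda>x. of_real (indicator E x))" if E: "E \<in> sets lebesgue" "bounded E" for E :: "'a set"
  proof (rule approximable_limit[OF p])
    show "(\<lambda>x. complex_of_real (indicator E x)) \<in> borel_measurable lebesgue" using E by measurable
    fix e :: real assume "e > 0"
    then obtain T where T: "closed T" "T \<subseteq> E" "E - T \<in> lmeasurable" "emeasure lebesgue (E - T) < ennreal e"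
      using sets_lebesgue_inner_closed[OF E(1)] by metis
    have "compact T" using T(1) bounded_subset[OF E(2) T(2)] by (simp add: compact_eq_bounded_closed)
    then have ap: "approximable p (\<lambda>x. of_real (indicator T x))" by (rule approximable_compact[OF p])
    have eq: "complex_of_real (indicator E x) - of_real (indicator T x) = of_real (indicator (E - T) x)" for x
      using T(2) by (cases "x \<in> T"; cases "x \<in> E") auto
    have "Lp_mass lebesgue p (\<lambda>x. complex_of_real (indicator (E - T) x)) \<le> ennreal e"
      unfolding mI[OF fmeasurableD[OF T(3)]] using T(4) by (rule less_imp_le)
    then have "Lp_mass lebesgue p (\<lambda>x. complex_of_real (indicator E x) - of_real (indicator T x)) \<le> ennreal e"
      by (simp only: eq)
    with ap show "\<exists>g. approximable p g \<and> Lp_mass lebesgue p (\<lambda>x. of_real (indicator E x) - g x) \<le> ennreal e"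
      by blast
  qed
  show ?thesis
  proof (rule approximable_limit[OF p])
    show "(\<lambda>x. complex_of_real (indicator E x)) \<in> borel_measurable lebesgue" using E by measurable
    fix e :: real assume e: "e > 0"
    let ?u = "\<lambda>k x. complex_of_real (indicator (E \<inter> cball 0 (real k)) x)"
    have Ek: "E \<inter> cball 0 (real k) \<in> sets lebesgue" for k using E by auto
    have "\<exists>k. Lp_mass lebesgue p (\<lambda>x. of_real (indicator E x) - ?u k x) \<le> ennreal e"
    proof (rule Lp_mass_dominated_small[where G = "indicator E :: 'a \<Rightarrow> real", OF _ _ _ p _ _ _ e])
      show "(\<lambda>x. complex_of_real (indicator E x)) \<in> borel_measurable lebesgue" using E by measurable
      show "?u k \<in> borel_measurable lebesgue" for k using Ek[of k] by measurable
      show "(indicator E :: 'a \<Rightarrow> real) \<in> borel_measurable lebesgue" using E by measurable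
      show "(\<lambda>k. ?u k x) \<longlonglongrightarrow> of_real (indicator E x)" for x
      proof (rule tendsto_eventually)
        obtain k0 where k0: "norm x \<le> real k0" using real_arch_simple by blast
        show "\<forall>\<^sub>F k in sequentially. ?u k x = of_real (indicator E x)"
          using eventually_ge_at_top[of k0]
        proof eventually_elim
          case (elim k)
          then have "x \<in> cball 0 (real k)" using k0 by simp
          then show ?case by (cases "x \<in> E") auto
        qed
      qed
      show "norm (of_real (indicator E x) - ?u k x) \<le> norm (indicator E x :: real)" for k x
        by (cases "x \<in> E"; cases "x \<in> cball 0 (real k)") auto
      have "Lp_mass lebesgue p (indicator E :: 'a \<Rightarrow> real) = Lp_mass lebesgue p (\<lambda>x. complex_of_real (indicator E x))"
        by (simp add: Lp_mass_def)
      then show "Lp_mass lebesgue p (indicator E :: 'a \<Rightarrow> real) < top" using E mI[OF E(1)] by simp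
    qed blast
    then obtain k where k: "Lp_mass lebesgue p (\<lambda>x. of_real (indicator E x) - ?u k x) \<le> ennreal e" by blast
    have "bounded (E \<inter> cball 0 (real k))" by (intro bounded_Int) simp
    from bdd[OF Ek this] k
    show "\<exists>g. approximable p g \<and> Lp_mass lebesgue p (\<lambda>x. of_real (indicator E x) - g x) \<le> ennreal e"
      by blast
  qed
qed

text \<open>Simple functions bounded by \<open>2 \<bar>f\<bar>\<close> approximate \<open>f\<close>. They lie in \<open>L\<^sup>p\<close>, so each nonzero value is
  taken on a set of finite measure.\<close>

lemma Lp_space_approximable:
  assumes p: "0 < p" and f: "f \<in> Lp_space p"
  shows "approximable p f"
proof (rule approximable_limit[OF p])
  show fm[measurable]: "f \<in> borel_measurable lebesgue" using f by (simp add: Lp_space_def)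
  fix e :: real assume e: "e > 0"
  obtain s where s: "\<And>i. simple_function lebesgue (s i)" "\<And>x. (\<lambda>i. s i x) \<longlonglongrightarrow> f x"
    "\<And>i x. norm (s i x) \<le> 2 * norm (f x)"
    using borel_measurable_implies_sequence_metric[OF fm, of 0] by auto
  have sm[measurable]: "s i \<in> borel_measurable lebesgue" for i by (rule borel_measurable_simple_function[OF s(1)])
  have ms: "Lp_mass lebesgue p (\<lambda>x. c * norm (f x)) < top" if "c \<ge> 0" for c
  proof -
    have "Lp_mass lebesgue p (\<lambda>x. c * norm (f x)) = ennreal (c powr p) * Lp_mass lebesgue p f"
      using that by (intro Lp_mass_scale) auto
    then show ?thesis using f by (simp add: Lp_space_iff_mass ennreal_mult_less_top)
  qed
  have m3: "Lp_mass lebesgue p (\<lambda>x. 3 * norm (f x)) < top" by (rule ms) simp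
  have "\<exists>k. Lp_mass lebesgue p (\<lambda>x. f x - s k x) \<le> ennreal e"
  proof (rule Lp_mass_dominated_small[where G = "\<lambda>x. 3 * norm (f x)", OF fm sm _ p s(2) _ m3 e])
    show "norm (f x - s k x) \<le> norm (3 * norm (f x))" for k x
      using norm_triangle_ineq4[of "f x" "s k x"] s(3)[of k x] by simp
  next
    show "(\<lambda>x. 3 * norm (f x)) \<in> borel_measurable lebesgue" by measurable
  qed blast
  then obtain k where k: "Lp_mass lebesgue p (\<lambda>x. f x - s k x) \<le> ennreal e" by blast
  have fin: "emeasure lebesgue (s k -` {v}) < top" if v: "v \<noteq> 0" for v
  proof -
    have [measurable]: "s k -` {v} \<in> sets lebesgue" using measurable_sets[OF sm, of "{v}" k] by simp
    have "ennreal (norm v powr p) * emeasure lebesgue (s k -` {v}) = (\<integral>\<^sup>+x. ennreal (norm v powr p) * indicator (s k -` {v}) x \<partial>lebesgue)"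
      by (simp add: nn_integral_cmult_indicator)
    also have "\<dots> \<le> Lp_mass lebesgue p (\<lambda>x. 2 * norm (f x))"
      unfolding Lp_mass_def
    proof (intro nn_integral_mono)
      fix x
      have "norm v powr p \<le> norm (2 * norm (f x)) powr p" if "s k x = v"
        using s(3)[of k x] that p by (intro powr_mono2) auto
      then show "ennreal (norm v powr p) * indicator (s k -` {v}) x \<le> ennreal (norm (2 * norm (f x)) powr p)"
        by (auto simp: indicator_def ennreal_leI)
    qed
    also have "\<dots> < top" by (rule ms) simp
    finally show ?thesis using v by (auto simp: ennreal_mult_less_top)
  qed
  have fr: "finite (range (s k))" using simple_functionD(1)[OF s(1)] by simp
  have ap: "approximable p (\<lambda>x. \<Sum>v\<in>V. v * of_real (indicator (s k -` {v}) x))" if "finite V" for V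
    using that
  proof (induction V rule: finite_induct)
    case empty
    have "tame (\<lambda>x::'a. 0)" by (auto simp: tame_def intro!: exI[of _ 0])
    then show ?case by (simp add: approximable_tame)
  next
    case (insert v V)
    have "approximable p (\<lambda>x. v * of_real (indicator (s k -` {v}) x))"
    proof (cases "v = 0")
      case True
      have "tame (\<lambda>x::'a. 0)" by (auto simp: tame_def intro!: exI[of _ 0])
      then show ?thesis using True by (simp add: approximable_tame)
    next
      case False
      have "s k -` {v} \<in> sets lebesgue" using measurable_sets[OF sm, of "{v}" k] by simp
      then show ?thesis by (intro approximable_scale approximable_indicator p fin False)
    qed
    from approximable_add[OF p this insert.IH] show ?case using insert.hyps by simp
  qed
  define g where "g x = (\<Sum>v\<in>range (s k). v * of_real (indicator (s k -` {v}) x))" for x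
  have "s k x = g x" for x
  proof -
    have "g x = (\<Sum>v\<in>range (s k). if v = s k x then v else 0)"
      unfolding g_def by (intro sum.cong) (auto simp: indicator_def)
    then show ?thesis using fr by simp
  qed
  then have "s k = g" by blast
  moreover have "approximable p g" using ap[OF fr] by (simp add: g_def[abs_def])
  ultimately have "approximable p (s k)" by simp
  then show "\<exists>g. approximable p g \<and> Lp_mass lebesgue p (\<lambda>x. f x - g x) \<le> ennreal e" using k by blast
qed

section \<open>Chirps, Schwartz functions and the linear canonical Riesz transform\<close>

definition chirp :: "('n \<Rightarrow> real) \<Rightarrow> real ^ 'n \<Rightarrow> complex" where
  "chirp c x = exp (\<i> * of_real (\<Sum>k\<in>UNIV. c k * (x $ k)\<^sup>2))"

lemma norm_chirp [simp]: "norm (chirp c x) = 1"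
  by (simp add: chirp_def)

lemma chirp_measurable [measurable]: "chirp c \<in> borel_measurable borel"
  unfolding chirp_def by measurable

lemma chirp_inverse: "chirp c x * chirp (\<lambda>k. - c k) x = 1"
proof -
  have "(\<Sum>k\<in>UNIV. - c k * (x $ k)\<^sup>2) = - (\<Sum>k\<in>UNIV. c k * (x $ k)\<^sup>2)"
    by (simp add: sum_negf)
  then show ?thesis unfolding chirp_def by (simp add: exp_minus del: of_real_sum)
qed

lemma chirp_has_derivative:
  "(chirp c has_derivative (\<lambda>v. chirp c x * (\<i> * of_real (\<Sum>k\<in>UNIV. 2 * c k * x $ k * v $ k)))) (at x)"
proof -
  have "((\<lambda>x. \<Sum>k\<in>UNIV. c k * (x $ k)\<^sup>2) has_derivative (\<lambda>v. \<Sum>k\<in>UNIV. 2 * c k * x $ k * v $ k)) (at x)"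
    by (auto intro!: derivative_eq_intros bounded_linear_imp_has_derivative bounded_linear_vec_nth simp: mult_ac)
  then have "((\<lambda>x. \<i> * of_real (\<Sum>k\<in>UNIV. c k * (x $ k)\<^sup>2)) has_derivative
      (\<lambda>v. \<i> * of_real (\<Sum>k\<in>UNIV. 2 * c k * x $ k * v $ k))) (at x)"
    by (intro has_derivative_mult_right has_derivative_of_real)
  moreover have "(exp has_derivative (\<lambda>h. exp (\<i> * of_real (\<Sum>k\<in>UNIV. c k * (x $ k)\<^sup>2)) * h))
      (at (\<i> * of_real (\<Sum>k\<in>UNIV. c k * (x $ k)\<^sup>2) :: complex))"
    using DERIV_exp has_field_derivative_def by blast
  ultimately show ?thesis
    unfolding chirp_def by (rule has_derivative_compose)
qed

lemma schwartz_bounded: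
  assumes "f \<in> schwartz"
  obtains B where "\<And>x. norm ((\<Prod>k\<in>UNIV. (x $ k) ^ \<alpha> k) *\<^sub>R partial_derivs is f x) \<le> B"
proof -
  have "bounded (range (\<lambda>x. (\<Prod>k\<in>UNIV. (x $ k) ^ \<alpha> k) *\<^sub>R partial_derivs is f x))"
    using assms unfolding schwartz_def by blast
  then obtain B where "\<forall>y\<in>range (\<lambda>x. (\<Prod>k\<in>UNIV. (x $ k) ^ \<alpha> k) *\<^sub>R partial_derivs is f x). norm y \<le> B"
    unfolding bounded_iff by blast
  then show thesis by (intro that[of B]) blast
qed

text \<open>Expanding the product of the factors \<open>1 + x\<^sub>k\<^sup>2\<close> gives one monomial for each set of indices, and
  each monomial times \<open>f\<close> is bounded.\<close>

lemma schwartz_rapid_decay: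
  fixes f :: "real ^ 'n \<Rightarrow> complex"
  assumes f: "f \<in> schwartz"
  obtains B where "B \<ge> 0" "\<And>x. norm (f x) \<le> B * (\<Prod>k\<in>UNIV. 1 / (1 + (x $ k)\<^sup>2))"
proof -
  have "\<forall>S. \<exists>B. \<forall>x. norm ((\<Prod>k\<in>UNIV. (x $ k) ^ (if k \<in> S then 2 else 0)) *\<^sub>R f x) \<le> B"
    using schwartz_bounded[OF f, of "\<lambda>k. if k \<in> _ then 2 else 0" "[]"]
    unfolding partial_derivs_def by (metis foldr.simps(1) id_apply)
  then obtain B where B: "\<And>S x. norm ((\<Prod>k\<in>UNIV. (x $ k) ^ (if k \<in> S then 2 else 0)) *\<^sub>R f x) \<le> B S" by metis
  have B0: "B S \<ge> 0" for S using B[of 0 S] norm_ge_zero order_trans by blast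
  have "norm (f x) \<le> (\<Sum>S\<in>Pow UNIV. B S) * (\<Prod>k\<in>UNIV. 1 / (1 + (x $ k)\<^sup>2))" for x :: "real ^ 'n"
  proof -
    have "(\<Prod>k\<in>UNIV. 1 + (x $ k)\<^sup>2) = (\<Sum>S\<in>Pow UNIV. (\<Prod>k\<in>S. 1) * (\<Prod>k\<in>UNIV - S. (x $ k)\<^sup>2))"
      by (rule prod_add) simp
    also have "\<dots> = (\<Sum>S\<in>Pow UNIV. \<Prod>k\<in>UNIV. (x $ k) ^ (if k \<in> UNIV - S then 2 else 0))"
    proof (intro sum.cong refl)
      fix S :: "'n set"
      have "(\<Prod>k\<in>UNIV. (x $ k) ^ (if k \<in> UNIV - S then 2 else 0)) = (\<Prod>k\<in>UNIV. if k \<in> UNIV - S then (x $ k)\<^sup>2 else 1)"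
        by (intro prod.cong) auto
      also have "\<dots> = (\<Prod>k\<in>UNIV - S. (x $ k)\<^sup>2)" by (subst prod.inter_restrict[symmetric]) auto
      finally show "(\<Prod>k\<in>S. 1) * (\<Prod>k\<in>UNIV - S. (x $ k)\<^sup>2) = (\<Prod>k\<in>UNIV. (x $ k) ^ (if k \<in> UNIV - S then 2 else 0))" by simp
    qed
    finally have P: "(\<Prod>k\<in>UNIV. 1 + (x $ k)\<^sup>2) * norm (f x) = (\<Sum>S\<in>Pow UNIV. (\<Prod>k\<in>UNIV. (x $ k) ^ (if k \<in> UNIV - S then 2 else 0)) * norm (f x))"
      by (simp add: sum_distrib_right)
    also have "\<dots> \<le> (\<Sum>S\<in>Pow UNIV. B (UNIV - S))"
    proof (intro sum_mono)
      fix S :: "'n set"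
      have "(\<Prod>k\<in>UNIV. (x $ k) ^ (if k \<in> UNIV - S then 2 else 0)) * norm (f x)
         \<le> norm ((\<Prod>k\<in>UNIV. (x $ k) ^ (if k \<in> UNIV - S then 2 else 0)) *\<^sub>R f x)"
        unfolding norm_scaleR by (intro mult_right_mono) auto
      also have "\<dots> \<le> B (UNIV - S)" by (rule B)
      finally show "(\<Prod>k\<in>UNIV. (x $ k) ^ (if k \<in> UNIV - S then 2 else 0)) * norm (f x) \<le> B (UNIV - S)" .
    qed
    also have "\<dots> = (\<Sum>S\<in>Pow UNIV. B S)"
      by (rule sum.reindex_bij_witness[of _ "\<lambda>S. UNIV - S" "\<lambda>S. UNIV - S"]) auto
    finally have "(\<Prod>k\<in>UNIV. 1 + (x $ k)\<^sup>2) * norm (f x) \<le> (\<Sum>S\<in>Pow UNIV. B S)" .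
    moreover have "(\<Prod>k\<in>UNIV. 1 + (x $ k)\<^sup>2) > 0" by (intro prod_pos) (auto intro: add_pos_nonneg)
    ultimately show ?thesis by (simp add: prod_dividef field_simps)
  qed
  then show thesis using that[of "\<Sum>S\<in>Pow UNIV. B S"] B0 by (simp add: sum_nonneg)
qed

text \<open>The integral factorizes over the coordinates, and each factor is the integral of the Poisson
  kernel at height 1.\<close>

lemma nn_integral_prod_Cauchy:
  "(\<integral>\<^sup>+x. ennreal (\<Prod>k\<in>UNIV. 1 / (1 + ((x :: real ^ 'n) $ k)\<^sup>2)) \<partial>lborel) < top"
proof -
  have B: "(Basis :: (real ^ 'n) set) = range (\<lambda>k. axis k 1)" by (auto simp: Basis_vec_def)
  have inj: "inj (\<lambda>k::'n. axis k (1::real))" by (auto simp: inj_on_def axis_eq_axis)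
  have "(\<integral>\<^sup>+x. ennreal (\<Prod>k\<in>UNIV. 1 / (1 + ((x :: real ^ 'n) $ k)\<^sup>2)) \<partial>lborel)
    = (\<integral>\<^sup>+x. (\<Prod>b\<in>Basis. ennreal (1 / (1 + ((x :: real ^ 'n) \<bullet> b)\<^sup>2))) \<partial>lborel)"
  proof (intro nn_integral_cong)
    fix x :: "real ^ 'n"
    show "ennreal (\<Prod>k\<in>UNIV. 1 / (1 + (x $ k)\<^sup>2)) = (\<Prod>b\<in>Basis. ennreal (1 / (1 + (x \<bullet> b)\<^sup>2)))"
      unfolding B prod.reindex[OF inj] by (simp add: inner_axis prod_ennreal)
  qed
  also have "\<dots> = (\<Prod>b\<in>(Basis :: (real ^ 'n) set). \<integral>\<^sup>+t. ennreal (1 / (1 + t\<^sup>2)) \<partial>lborel)"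
    by (rule nn_integral_lborel_prod) auto
  also have "\<dots> < top"
  proof -
    have "(\<integral>\<^sup>+t. ennreal (1 / (1 + (t::real)\<^sup>2)) \<partial>lborel) \<le> ennreal pi"
      using nn_integral_Poisson_kernel_le[of 1 0] by (simp add: add.commute)
    also have "\<dots> < top" by simp
    finally show ?thesis by (simp add: power_less_top_ennreal)
  qed
  finally show ?thesis .
qed

text \<open>Differentiating the chirp produces factors that grow linearly, \<open>x\<^sub>k\<close>; they are absorbed by
  the decay of \<open>f\<close>, so the product has a bounded derivative and is Lipschitz.\<close>

lemma schwartz_chirp_tame:
  fixes f :: "real ^ 'n \<Rightarrow> complex"
  assumes f: "f \<in> schwartz"
  shows "tame (\<lambda>x. f x * chirp c x)"
proof -
  have diff: "f differentiable (at x)" for x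
    using f unfolding schwartz_def partial_derivs_def by (auto dest!: spec[of _ "[]"])
  let ?f' = "\<lambda>x. frechet_derivative f (at x)"
  have f': "(f has_derivative ?f' x) (at x)" for x using diff frechet_derivative_works by blast
  obtain B where B: "B \<ge> 0" "\<And>x. norm (f x) \<le> B * (\<Prod>k\<in>UNIV. 1 / (1 + (x $ k)\<^sup>2))"
    using schwartz_rapid_decay[OF f] by blast
  have Bf: "norm (f x) \<le> B" for x
  proof -
    have "(\<Prod>k\<in>UNIV. 1 / (1 + (x $ k)\<^sup>2)) \<le> 1" by (intro prod_le_1) (auto simp: divide_le_eq add_pos_nonneg)
    then show ?thesis using B(2)[of x] B(1) by (meson mult_left_le order_trans)
  qed
  have "\<forall>k. \<exists>M. \<forall>x. norm (?f' x (axis k 1)) \<le> M"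
  proof
    fix k
    show "\<exists>M. \<forall>x. norm (?f' x (axis k 1)) \<le> M"
      using schwartz_bounded[OF f, of "\<lambda>_. 0" "[k]"] by (auto simp: partial_derivs_def partial_deriv_def)
  qed
  then obtain M where M: "\<And>k x. norm (?f' x (axis k 1)) \<le> M k" by metis
  have "\<forall>k. \<exists>M. \<forall>x. norm ((x $ k) *\<^sub>R f x) \<le> M"
  proof
    fix k
    obtain M where M: "\<And>x. norm ((\<Prod>i\<in>UNIV. (x $ i) ^ (if i = k then 1 else 0)) *\<^sub>R f x) \<le> M"
      using schwartz_bounded[OF f, of "\<lambda>i. if i = k then 1 else 0" "[]"] by (auto simp: partial_derivs_def)
    have "(\<Prod>i\<in>UNIV. (x $ i) ^ (if i = k then 1 else 0)) = x $ k" for x :: "real ^ 'n"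
    proof -
      have "(\<Prod>i\<in>UNIV. (x $ i) ^ (if i = k then 1 else 0)) = (\<Prod>i\<in>UNIV. if i = k then x $ i else 1)"
        by (intro prod.cong) auto
      then show ?thesis by simp
    qed
    then show "\<exists>M. \<forall>x. norm ((x $ k) *\<^sub>R f x) \<le> M" using M by (intro exI[of _ M]) simp
  qed
  then obtain Q where Q: "\<And>k x. norm ((x $ k) *\<^sub>R f x) \<le> Q k" by metis
  define L where "L = (\<Sum>k\<in>UNIV. M k + 2 * \<bar>c k\<bar> * Q k)"
  have M0: "M k \<ge> 0" "Q k \<ge> 0" for k using M[of 0 k] Q[of 0 k] norm_ge_zero order_trans by blast+
  have L0: "L \<ge> 0" unfolding L_def by (intro sum_nonneg) (simp add: M0)
  let ?g = "\<lambda>x. f x * chirp c x"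
  let ?g' = "\<lambda>x v. f x * (chirp c x * (\<i> * of_real (\<Sum>k\<in>UNIV. 2 * c k * x $ k * v $ k))) + ?f' x v * chirp c x"
  have g': "(?g has_derivative ?g' x) (at x)" for x
    by (rule has_derivative_mult[OF f' chirp_has_derivative])
  have g'le: "norm (?g' x v) \<le> L * norm v" for x v
  proof -
    have lin: "linear (?f' x)" using f' has_derivative_linear by blast
    have "?f' x v = (\<Sum>k\<in>UNIV. v $ k *\<^sub>R ?f' x (axis k 1))"
    proof -
      have "v = (\<Sum>k\<in>UNIV. v $ k *\<^sub>R axis k 1)"
        using basis_expansion[of v] by (simp add: scalar_mult_eq_scaleR)
      then have "?f' x v = ?f' x (\<Sum>k\<in>UNIV. v $ k *\<^sub>R axis k 1)" by simp
      then show ?thesis by (simp add: linear_sum[OF lin] linear_scale[OF lin])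
    qed
    then have "norm (?f' x v) \<le> (\<Sum>k\<in>UNIV. \<bar>v $ k\<bar> * norm (?f' x (axis k 1)))"
      using norm_sum[of "\<lambda>k. v $ k *\<^sub>R ?f' x (axis k 1)" UNIV] by simp
    also have "\<dots> \<le> (\<Sum>k\<in>UNIV. norm v * M k)"
      using M by (intro sum_mono mult_mono component_le_norm_cart) auto
    finally have 1: "norm (?f' x v) \<le> (\<Sum>k\<in>UNIV. norm v * M k)" .
    have "norm (f x * (\<i> * of_real (\<Sum>k\<in>UNIV. 2 * c k * x $ k * v $ k)))
        = norm (\<Sum>k\<in>UNIV. (2 * c k * v $ k) *\<^sub>R ((x $ k) *\<^sub>R f x))"
    proof -
      have "(\<Sum>k\<in>UNIV. (2 * c k * v $ k) *\<^sub>R ((x $ k) *\<^sub>R f x)) = (\<Sum>k\<in>UNIV. 2 * c k * x $ k * v $ k) *\<^sub>R f x"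
        by (simp add: scaleR_sum_left mult_ac)
      then show ?thesis by (simp add: norm_mult mult.commute del: of_real_sum)
    qed
    also have "\<dots> \<le> (\<Sum>k\<in>UNIV. norm ((2 * c k * v $ k) *\<^sub>R ((x $ k) *\<^sub>R f x)))" by (rule norm_sum)
    also have "\<dots> \<le> (\<Sum>k\<in>UNIV. (2 * \<bar>c k\<bar> * norm v) * Q k)"
    proof (intro sum_mono)
      fix k
      have "\<bar>2 * c k * v $ k\<bar> \<le> 2 * \<bar>c k\<bar> * norm v"
        unfolding abs_mult using component_le_norm_cart[of v k] by (simp add: mult_left_mono)
      then show "norm ((2 * c k * v $ k) *\<^sub>R ((x $ k) *\<^sub>R f x)) \<le> (2 * \<bar>c k\<bar> * norm v) * Q k"
        unfolding norm_scaleR[of "2 * c k * v $ k"] by (intro mult_mono Q) auto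
    qed
    finally have 2: "norm (f x * (\<i> * of_real (\<Sum>k\<in>UNIV. 2 * c k * x $ k * v $ k))) \<le> (\<Sum>k\<in>UNIV. (2 * \<bar>c k\<bar> * norm v) * Q k)" .
    have "norm (?g' x v) \<le> norm (f x * (\<i> * of_real (\<Sum>k\<in>UNIV. 2 * c k * x $ k * v $ k))) + norm (?f' x v)"
      by (rule order_trans[OF norm_triangle_ineq]) (simp add: norm_mult del: of_real_sum)
    also have "\<dots> \<le> (\<Sum>k\<in>UNIV. (2 * \<bar>c k\<bar> * norm v) * Q k) + (\<Sum>k\<in>UNIV. norm v * M k)"
      by (rule add_mono[OF 2 1])
    also have "\<dots> = L * norm v"
      unfolding L_def sum_distrib_right sum.distrib[symmetric]
      by (intro sum.cong refl) (simp add: algebra_simps)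
    finally show ?thesis .
  qed
  have Lip: "norm (?g x - ?g y) \<le> L * norm (x - y)" for x y
  proof (rule differentiable_bound[OF convex_UNIV])
    show "(?g has_derivative ?g' x) (at x within UNIV)" for x using g' by simp
    show "onorm (?g' x) \<le> L" for x by (rule onorm_le[OF g'le])
  qed auto
  have fc: "continuous_on UNIV f"
    using diff by (simp add: continuous_on_eq_continuous_at differentiable_imp_continuous_within)
  then have fm[measurable]: "f \<in> borel_measurable borel" by (rule borel_measurable_continuous_onI)
  have "integrable lborel ?g"
  proof (rule integrableI_bounded)
    have "(\<integral>\<^sup>+x. ennreal (norm (?g x)) \<partial>lborel) \<le> (\<integral>\<^sup>+x. ennreal B * ennreal (\<Prod>k\<in>UNIV. 1 / (1 + ((x::real^'n) $ k)\<^sup>2)) \<partial>lborel)"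
      using B by (intro nn_integral_mono) (simp add: norm_mult ennreal_mult'[symmetric] ennreal_leI)
    also have "\<dots> = ennreal B * (\<integral>\<^sup>+x. ennreal (\<Prod>k\<in>UNIV. 1 / (1 + ((x::real^'n) $ k)\<^sup>2)) \<partial>lborel)"
      by (intro nn_integral_cmult) measurable
    also have "\<dots> < top" using nn_integral_prod_Cauchy[where 'n='n] by (simp add: ennreal_mult_less_top)
    finally show "(\<integral>\<^sup>+x. ennreal (norm (?g x)) \<partial>lborel) < \<infinity>" by simp
  qed measurable
  moreover have "norm (?g x) \<le> B" for x using Bf by (simp add: norm_mult)
  ultimately show ?thesis using Lip unfolding tame_def by blast
qed

lemma LCRT_integrand_eq_riesz_kernel:
  fixes A :: "real ^ 2 ^ 2 ^ 'n"
  defines "a \<equiv> \<lambda>k. A $ k $ 1 $ 1 / (2 * A $ k $ 1 $ 2)"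
  shows "LCRT_integrand A j f x y = riesz_kernel (axis j 1) (x - y) *\<^sub>R (f y * chirp a y)"
  unfolding LCRT_integrand_def riesz_kernel_def chirp_def a_def
  by (simp add: inner_axis scaleR_conv_of_real)

theorem theorem2p10:
  fixes A :: "real ^ 2 ^ 2 ^ 'n" and j :: 'n and p :: real
  assumes "\<And>k. det (A $ k) = 1"
    and "\<And>k. A $ k $ 1 $ 2 \<noteq> 0"
    and "\<And>k. A $ k $ 1 $ 1 = A $ k $ 2 $ 2"
    and "1 < p"
  shows "(\<forall>f\<in>schwartz. \<forall>x. pv_exists x (LCRT_integrand A j f x)) \<and>
    (\<exists>T. bounded_linear_on_Lp p T \<and>
      (\<forall>f\<in>schwartz. AE x in lebesgue. T f x = LCRT A j f x) \<and>
      (\<exists>C>0. \<forall>f\<in>Lp_space p. Lp_norm p (T f) \<le> C * Lp_norm p f))"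
proof -
  define a where "a k = A $ k $ 1 $ 1 / (2 * A $ k $ 1 $ 2)" for k
  define d where "d k = - (A $ k $ 2 $ 2 / (2 * A $ k $ 1 $ 2))" for k
  define r where "r = riesz_const CARD('n)"
  define e where "e = (axis j 1 :: real ^ 'n)"
  have e: "norm e \<le> 1" by (simp add: e_def)
  have p: "1 < p" "0 < p" using \<open>1 < p\<close> by auto
  have r: "r > 0" unfolding r_def riesz_const_def by (intro divide_pos_pos Gamma_real_pos) auto
  have integrand: "LCRT_integrand A j f x = (\<lambda>y. riesz_kernel e (x - y) *\<^sub>R (f y * chirp a y))" for f x
    unfolding e_def a_def[abs_def] by (rule ext) (rule LCRT_integrand_eq_riesz_kernel)
  \<comment> \<open>the chirp is built into the dense subspace, so that the extension theorem yields the operator itself\<close>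
  define D where "D = {f :: real ^ 'n \<Rightarrow> complex. tame (\<lambda>y. f y * chirp a y)}"
  define W where "W f x = of_real r * chirp d x * riesz e (\<lambda>y. f y * chirp a y) x" for f x
  have DS: "schwartz \<subseteq> D" using schwartz_chirp_tame by (auto simp: D_def)
  have LW: "LCRT A j f x = W f x" if "f \<in> D" for f x
  proof -
    have "- \<i> * of_real (\<Sum>k\<in>UNIV. A $ k $ 2 $ 2 / (2 * A $ k $ 1 $ 2) * (x $ k)\<^sup>2) = \<i> * of_real (\<Sum>k\<in>UNIV. d k * (x $ k)\<^sup>2)"
      by (simp add: d_def sum_negf)
    then show ?thesis
      unfolding LCRT_def integrand W_def chirp_def[of d] r_def
      using riesz_pv(2)[OF _ e, of "\<lambda>y. f y * chirp a y" x] that by (simp add: D_def)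
  qed
  have unchirp: "f x * chirp a x * chirp (\<lambda>k. - a k) x = f x" for f :: "real ^ 'n \<Rightarrow> complex" and x
    using chirp_inverse[of a x] by (simp add: mult.assoc)
  have chm[measurable]: "chirp c \<in> borel_measurable lebesgue" for c :: "'n \<Rightarrow> real"
    by (rule measurable_completion) simp
  have mass_chirp: "Lp_mass M p (\<lambda>x. f x * chirp c x) = Lp_mass M p f" for f M and c :: "'n \<Rightarrow> real"
    by (simp add: Lp_mass_def norm_mult)
  have Db: "f \<in> borel_measurable borel" if "f \<in> D" for f
  proof -
    have "(\<lambda>x. (f x * chirp a x) * chirp (\<lambda>k. - a k) x) \<in> borel_measurable borel"
      using that by (intro borel_measurable_times tame_measurable chirp_measurable) (simp add: D_def)
    then show ?thesis by (simp only: unchirp)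
  qed
  have Dm: "f \<in> borel_measurable lebesgue" if "f \<in> D" for f
    by (rule measurable_completion) (use Db[OF that] in simp)
  have Wb: "W f \<in> borel_measurable borel" if "f \<in> D" for f
  proof -
    have [measurable]: "f \<in> borel_measurable borel" by (rule Db[OF that])
    show ?thesis unfolding W_def by measurable
  qed
  obtain C where C: "C > 0" "\<And>f. tame f \<Longrightarrow> Lp_mass lborel p (riesz e f) \<le> ennreal C * Lp_mass lborel p f"
    using riesz_Lp[OF p(1) e] by blast
  obtain T where T: "bounded_linear_on_Lp p T" "\<And>f. f \<in> D \<Longrightarrow> AE x in lebesgue. T f x = W f x"
    "\<exists>C>0. \<forall>f\<in>Lp_space p. Lp_norm p (T f) \<le> C * Lp_norm p f"
  proof (rule bounded_extension[of p "r powr p * C" D W])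
    show "0 < r powr p * C" using r C(1) by simp
    show "D \<subseteq> Lp_space p"
    proof
      fix f assume f: "f \<in> D"
      then have "Lp_mass lebesgue p (\<lambda>x. f x * chirp a x) < top"
        using tame_in_Lp_space[OF _ p(1)] by (auto simp: D_def Lp_space_iff_mass)
      then show "f \<in> Lp_space p" using Dm[OF f] by (simp add: Lp_space_iff_mass mass_chirp)
    qed
    show "(\<lambda>x. f x + g x) \<in> D" if "f \<in> D" "g \<in> D" for f g
      using tame_add[of "\<lambda>x. f x * chirp a x" "\<lambda>x. g x * chirp a x"] that by (simp add: D_def distrib_right)
    show "(\<lambda>x. c * f x) \<in> D" if "f \<in> D" for f c
      using tame_scale[of "\<lambda>x. f x * chirp a x" c] that by (simp add: D_def mult.assoc)
    show "\<exists>h\<in>D. Lp_mass lebesgue p (\<lambda>x. f x - h x) \<le> ennreal \<delta>" if f: "f \<in> Lp_space p" and \<delta>: "0 < \<delta>" for f \<delta>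
    proof -
      have [measurable]: "f \<in> borel_measurable lebesgue" using f by (simp add: Lp_space_def)
      have "(\<lambda>x. f x * chirp a x) \<in> Lp_space p"
        using f by (simp add: Lp_space_iff_mass mass_chirp)
      then obtain h where h: "tame h" "Lp_mass lebesgue p (\<lambda>x. f x * chirp a x - h x) \<le> ennreal \<delta>"
        using Lp_space_approximable[OF p(2)] \<delta> unfolding approximable_def by blast
      let ?h = "\<lambda>x. h x * chirp (\<lambda>k. - a k) x"
      have "(\<lambda>x. ?h x * chirp a x) = h"
        using chirp_inverse[of a] by (intro ext) (simp add: mult.assoc mult.commute[of "chirp (\<lambda>k. - a k) _"])
      then have "?h \<in> D" using h(1) by (simp only: D_def mem_Collect_eq)
      have eq: "(\<lambda>x. f x - ?h x) = (\<lambda>x. (f x * chirp a x - h x) * chirp (\<lambda>k. - a k) x)"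
        by (simp only: left_diff_distrib unchirp)
      show ?thesis
      proof (rule bexI[OF _ \<open>?h \<in> D\<close>])
        show "Lp_mass lebesgue p (\<lambda>x. f x - ?h x) \<le> ennreal \<delta>"
          unfolding eq mass_chirp by (rule h(2))
      qed
    qed
    show "W f \<in> borel_measurable lebesgue" if "f \<in> D" for f
      by (rule measurable_completion) (use Wb[OF that] in simp)
    show "W (\<lambda>x. f x + g x) x = W f x + W g x" if "f \<in> D" "g \<in> D" for f g x
      using riesz_add[of "\<lambda>x. f x * chirp a x" "\<lambda>x. g x * chirp a x", OF _ _ e] that
      by (simp add: W_def D_def distrib_left distrib_right)
    show "W (\<lambda>x. c * f x) x = c * W f x" for f c x
      using riesz_scale[of e c "\<lambda>x. f x * chirp a x"] by (simp add: W_def mult_ac)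
    show "Lp_mass lebesgue p (W f) \<le> ennreal (r powr p * C) * Lp_mass lebesgue p f" if f: "f \<in> D" for f
    proof -
      have t: "tame (\<lambda>y. f y * chirp a y)" using f by (simp add: D_def)
      have "Lp_mass lebesgue p (W f) = Lp_mass lborel p (W f)" by (rule Lp_mass_lebesgue_eq_lborel[OF Wb[OF f]])
      also have "\<dots> = ennreal (r powr p) * Lp_mass lborel p (riesz e (\<lambda>y. f y * chirp a y))"
        using r tame_measurable[OF t] by (intro Lp_mass_scale) (auto simp: W_def norm_mult)
      also have "\<dots> \<le> ennreal (r powr p) * (ennreal C * Lp_mass lborel p (\<lambda>y. f y * chirp a y))"
        by (intro mult_left_mono C(2) t) auto
      also have "\<dots> = ennreal (r powr p * C) * Lp_mass lebesgue p f"
        using C(1) by (simp add: mass_chirp Lp_mass_lebesgue_eq_lborel[OF Db[OF f]] ennreal_mult mult.assoc)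
      finally show ?thesis .
    qed
  next
    fix T
    assume "bounded_linear_on_Lp p T" "\<And>f. f \<in> D \<Longrightarrow> AE x in lebesgue. T f x = W f x"
      "\<exists>C>0. \<forall>f\<in>Lp_space p. Lp_norm p (T f) \<le> C * Lp_norm p f"
    then show thesis by (rule that)
  qed (rule p(2))
  have "pv_exists x (LCRT_integrand A j f x)" if "f \<in> schwartz" for f x
    unfolding integrand using schwartz_chirp_tame[OF that] by (rule riesz_pv(1)[OF _ e])
  moreover have "AE x in lebesgue. T f x = LCRT A j f x" if "f \<in> schwartz" for f
    using T(2)[of f] LW[of f] DS that by auto
  ultimately show ?thesis using T(1,3) by blast
qed

end
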